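(* Let $\mathcal{N}\subseteq\mathbb{V}^{m\times n}$ be a nonempty open set, let $g:\mathbb{R}^m\to\mathbb{R}^m$ be absolutely symmetric on an open set $\hat\sigma_{\mathcal{N}}\subseteq\mathbb{R}^m$ containing $\{\sigma(X)\mid X\in\mathcal{N}\}$, and let $G:\mathcal{N}\to\mathbb{V}^{m\times n}$ be the spectral operator with respect to $g$. Let $\overline{X}\in\mathcal{N}$ have the singular value decomposition $\overline{X}=\overline{U}[\mathrm{Diag}(\sigma(\overline{X}))\quad 0]\overline{V}^{*}$ with $(\overline{U},\overline{V})\in\mathbb{O}^m\times\mathbb{O}^n$. Then $G$ is Hadamard directionally differentiable at $\overline{X}$ if and only if $g$ is Hadamard directionally differentiable at $\overline{\sigma}=\sigma(\overline{X})$. In that case, the directional derivative of $G$ at $\overline{X}$ along any direction $H\in\mathbb{V}^{m\times n}$ is $$G'(\overline{X};H)=\overline{U}\,g^{[1]}(\overline{X};H)\,\overline{V}^{*},$$ where $g^{[1]}(\overline{X};H)$ is the first divided directional difference of $g$ at $\overline{X}$ along $H$ (defined in the context).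
   Context: Fix $m\le n$. $\mathbb{V}^{p\times q}$ denotes $\mathbb{R}^{p\times q}$ or $\mathbb{C}^{p\times q}$ (the field is fixed), viewed as a real Euclidean space with inner product $\mathrm{Re}(\mathrm{trace}(X^{*}Y))$, $X^{*}$ being the (conjugate) transpose. $\mathbb{S}^p$ is the real space of $p\times p$ real symmetric (complex Hermitian) matrices, and $\mathbb{O}^p$ the set of orthogonal (unitary) $p\times p$ matrices. For $Y\in\mathbb{S}^p$, $\lambda(Y)$ is the vector of eigenvalues in non-increasing order and $\mathbb{O}^p(Y)$ the set of $P\in\mathbb{O}^p$ with $Y=P\,\mathrm{Diag}(\lambda(Y))P^{*}$. For $Z\in\mathbb{V}^{p\times q}$, $p\le q$, $\sigma(Z)\in\mathbb{R}^p$ is the vector of singular values in non-increasing order and $\mathbb{O}^{p,q}(Z)$ the set of $(U,V)\in\mathbb{O}^p\times\mathbb{O}^q$ with $Z=U[\mathrm{Diag}(\sigma(Z))\quad 0]V^{*}$. A signed permutation matrix has exactly one nonzero entry in each row and column, that entry being $\pm1$. $g$ is absolutely symmetric on $D$ if $g(Qx)=Qg(x)$ for all $x\in D$ and all $m\times m$ signed permutation matrices $Q$. The spectral operator is $G(X)=U[\mathrm{Diag}(g(\sigma(X)))\quad 0]V^{*}$, $X\in\mathcal{N}$, with $(U,V)\in\mathbb{O}^{m,n}(X)$ (independent of the choice). A function $F$ from an open subset $\mathcal{O}$ of a finite dimensional real Euclidean space $\mathcal{Z}$ to another such space is Hadamard directionally differentiable at $z\in\mathcal{O}$ if $\lim_{t\downarrow0,\,h'\to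 h}\frac{F(z+th')-F(z)}{t}$ exists for every $h\in\mathcal{Z}$; this limit then equals the directional derivative $F'(z;h)$. Notation at $\overline{X}$: write $\overline{V}=[\overline{V}_1\quad\overline{V}_2]$ with $\overline{V}_1\in\mathbb{V}^{n\times m}$, $\overline{V}_2\in\mathbb{V}^{n\times(n-m)}$. Let $\overline\nu_1>\cdots>\overline\nu_r>0$ be the distinct nonzero singular values of $\overline{X}$, $a_l:=\{i\mid\overline\sigma_i=\overline\nu_l\}$ ($l=1,\ldots,r$), $a:=\{i\mid\overline\sigma_i>0\}$, $b:=\{i\mid\overline\sigma_i=0\}$ (subsets of $\{1,\ldots,m\}$). $Y_J$ is the submatrix of $Y$ consisting of the columns indexed by $J$. $S(Y):=\frac12(Y+Y^{*})$, $T(Y):=\frac12(Y-Y^{*})$ for square $Y$; $\circ$ is the entrywise (Hadamard) product. Define $\overline{\mathcal{E}}^0_1,\overline{\mathcal{E}}^0_2\in\mathbb{R}^{m\times m}$ and $\overline{\mathcal{F}}^0\in\mathbb{R}^{m\times(n-m)}$ by $$(\overline{\mathcal{E}}^0_1)_{ij}=\frac{g_i(\overline\sigma)-g_j(\overline\sigma)}{\overline\sigma_i-\overline\sigma_j}\ \text{if }\overline\sigma_i\ne\overline\sigma_j,\ 0\text{ otherwise};\quad(\overline{\mathcal{E}}^0_2)_{ij}=\frac{g_i(\overline\sigma)+g_j(\overline\sigma)}{\overline\sigma_i+\overline\sigma_j}\ \text{if }\overline\sigma_i+\overline\sigma_j\ne0,\ 0\text{ otherwise};$$ $$(\overline{\mathcal{F}}^0)_{ij}=\frac{g_i(\overline\sigma)}{\overline\sigma_i}\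 \text{if }\overline\sigma_i\ne0,\ 0\text{ otherwise}.$$ When $g$ is directionally differentiable at $\overline\sigma$, put $\phi:=g'(\overline\sigma;\cdot):\mathbb{R}^m\to\mathbb{R}^m$ and write $\phi(h)=(\phi_1(h),\ldots,\phi_r(h),\phi_{r+1}(h))$ with $\phi_l(h)\in\mathbb{R}^{|a_l|}$, $l\le r$, $\phi_{r+1}(h)\in\mathbb{R}^{|b|}$. Let $\mathcal{W}:=\mathbb{S}^{|a_1|}\times\cdots\times\mathbb{S}^{|a_r|}\times\mathbb{V}^{|b|\times(n-|a|)}$. For $W=(W_1,\ldots,W_{r+1})\in\mathcal{W}$ let $\kappa(W):=(\lambda(W_1),\ldots,\lambda(W_r),\sigma(W_{r+1}))\in\mathbb{R}^m$ and define $\Phi(W)=(\Phi_1(W),\ldots,\Phi_{r+1}(W))\in\mathcal{W}$ by $\Phi_l(W)=\widetilde{P}_l\mathrm{Diag}(\phi_l(\kappa(W)))\widetilde{P}_l^{*}$ for $1\le l\le r$ with $\widetilde{P}_l\in\mathbb{O}^{|a_l|}(W_l)$, and $\Phi_{r+1}(W)=\widetilde{M}\,\mathrm{Diag}(\phi_{r+1}(\kappa(W)))\widetilde{N}_1^{*}$ with $(\widetilde{M},\widetilde{N})\in\mathbb{O}^{|b|,n-|a|}(W_{r+1})$ and $\widetilde{N}_1$ the first $|b|$ columns of $\widetilde{N}$ (this is independent of the choices). Let $$\widehat\Phi(W):=\begin{bmatrix}\mathrm{Diag}(\Phi_1(W),\ldots,\Phi_r(W))&0\\0&\Phi_{r+1}(W)\end{bmatrix}\in\mathbb{V}^{m\times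 n}$$ (with block diagonal upper-left block), and for $H\in\mathbb{V}^{m\times n}$ $$D(H):=\big(S(\overline{U}_{a_1}^{*}H\overline{V}_{a_1}),\ldots,S(\overline{U}_{a_r}^{*}H\overline{V}_{a_r}),\ \overline{U}_b^{*}H[\overline{V}_b\quad\overline{V}_2]\big)\in\mathcal{W}.$$ The first divided directional difference is $$g^{[1]}(\overline{X};H):=\big[\overline{\mathcal{E}}^0_1\circ S(\overline{U}^{*}H\overline{V}_1)+\overline{\mathcal{E}}^0_2\circ T(\overline{U}^{*}H\overline{V}_1)\quad\ \overline{\mathcal{F}}^0\circ(\overline{U}^{*}H\overline{V}_2)\big]+\widehat\Phi(D(H)).$$ *)

theory Defs
  imports
    "HOL-Analysis.Abstract_Metric_Spaces"
    "HOL-Computational_Algebra.Fundamental_Theorem_Algebra"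
    "Jordan_Normal_Form.Schur_Decomposition"
    "Jordan_Normal_Form.DL_Submatrix"
begin

section \<open>Finite dimensional real Euclidean spaces and directional derivatives\<close>

text \<open>
  The types of matrices and vectors do not fix the dimensions, so a Euclidean space is given by its
  carrier, its real scaling and its inner product; addition and subtraction are those of the type.
\<close>

record 'a eucl =
  points :: "'a set"
  scl :: "real \<Rightarrow> 'a \<Rightarrow> 'a"
  inprod :: "'a \<Rightarrow> 'a \<Rightarrow> real"

text \<open>
  The value 0 off the carrier is a dummy: \<^locale>\<open>Metric_space\<close> wants nonnegativity and symmetry on
  the whole type, where differences of matrices of different sizes make no sense.
\<close>

definition eucl_dist :: "('a :: minus) eucl \<Rightarrow> 'a \<Rightarrow> 'a \<Rightarrow> real" where
  "eucl_dist Z x y = (if x \<in> points Z \<and> y \<in> points Z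
     then sqrt (inprod Z (x - y) (x - y)) else 0)"

definition eucl_topology :: "('a :: minus) eucl \<Rightarrow> 'a topology" where
  "eucl_topology Z = Metric_space.mtopology (points Z) (eucl_dist Z)"

definition diff_quot ::
  "('a :: plus) eucl \<Rightarrow> ('b :: minus) eucl \<Rightarrow> ('a \<Rightarrow> 'b) \<Rightarrow> 'a \<Rightarrow> real \<Rightarrow> 'a \<Rightarrow> 'b" where
  "diff_quot Z Z' F z t h = scl Z' (1 / t) (F (z + scl Z t h) - F z)"

definition has_dir_deriv ::
  "('a :: plus) eucl \<Rightarrow> ('b :: minus) eucl \<Rightarrow> ('a \<Rightarrow> 'b) \<Rightarrow> 'a \<Rightarrow> 'a \<Rightarrow> 'b \<Rightarrow> bool" where
  "has_dir_deriv Z Z' F z h L \<longleftrightarrow>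
     limitin (eucl_topology Z') (\<lambda>t. diff_quot Z Z' F z t h) L (at_right 0)"

definition dir_deriv ::
  "('a :: plus) eucl \<Rightarrow> ('b :: minus) eucl \<Rightarrow> ('a \<Rightarrow> 'b) \<Rightarrow> 'a \<Rightarrow> 'a \<Rightarrow> 'b" where
  "dir_deriv Z Z' F z h = (THE L. has_dir_deriv Z Z' F z h L)"

text \<open>
  Only the values of \<open>F\<close> near \<open>z\<close> matter, so for a function on an open set \<open>F\<close> may be any
  extension of it to the whole type.
\<close>

definition hadamard_dir_differentiable ::
  "('a :: {plus, minus}) eucl \<Rightarrow> ('b :: minus) eucl \<Rightarrow> ('a \<Rightarrow> 'b) \<Rightarrow> 'a \<Rightarrow> bool" where
  "hadamard_dir_differentiable Z Z' F z \<longleftrightarrow>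
     (\<forall>h \<in> points Z. \<exists>L. limitin (eucl_topology Z') (\<lambda>(t, h'). diff_quot Z Z' F z t h') L
        (at_right 0 \<times>\<^sub>F nhdsin (eucl_topology Z) h))"

section \<open>Real and complex matrices\<close>

text \<open>
  The base field is a set \<open>K\<close> of complex numbers, meant to be \<open>\<real>\<close> or \<open>UNIV\<close>: real matrices
  are the complex matrices with real entries, and for them \<^const>\<open>mat_adjoint\<close> is the transpose.
  All indices start at 0.
\<close>

definition mats :: "complex set \<Rightarrow> nat \<Rightarrow> nat \<Rightarrow> complex mat set" where
  "mats K p q = {A \<in> carrier_mat p q. elements_mat A \<subseteq> K}"

definition mat_trace :: "complex mat \<Rightarrow> complex" where
  "mat_trace A = (\<Sum>i<dim_row A. A $$ (i, i))"

definition mat_eucl :: "complex set \<Rightarrow> nat \<Rightarrow> nat \<Rightarrow> complex mat eucl" where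
  "mat_eucl K p q = \<lparr> points = mats K p q,
     scl = (\<lambda>t A. complex_of_real t \<cdot>\<^sub>m A),
     inprod = (\<lambda>X Y. Re (mat_trace (mat_adjoint X * Y))) \<rparr>"

definition vec_eucl :: "nat \<Rightarrow> real vec eucl" where
  "vec_eucl m = \<lparr> points = carrier_vec m, scl = (\<cdot>\<^sub>v), inprod = scalar_prod \<rparr>"

definition unitaries :: "complex set \<Rightarrow> nat \<Rightarrow> complex mat set" where
  "unitaries K p = {P \<in> mats K p p. mat_adjoint P * P = 1\<^sub>m p}"

text \<open>The \<open>p \<times> q\<close> matrix \<open>[Diag(x) 0]\<close>, and \<open>Diag(x)\<close> for \<open>q = p\<close>.\<close>

definition rect_diag :: "nat \<Rightarrow> nat \<Rightarrow> real vec \<Rightarrow> complex mat" where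
  "rect_diag p q x = mat p q (\<lambda>(i, j). if i = j then complex_of_real (x $ i) else 0)"

text \<open>Eigenvalues of a Hermitian matrix, with multiplicity and in non-increasing order.\<close>

definition eig_vals :: "complex mat \<Rightarrow> real vec" where
  "eig_vals Y = vec_of_list (rev (sorted_list_of_multiset (image_mset Re (proots (char_poly Y)))))"

definition eig_bases :: "complex set \<Rightarrow> complex mat \<Rightarrow> complex mat set" where
  "eig_bases K Y = {P \<in> unitaries K (dim_row Y).
     Y = P * rect_diag (dim_row Y) (dim_row Y) (eig_vals Y) * mat_adjoint P}"

text \<open>Singular values of a \<open>p \<times> q\<close> matrix \<open>Z\<close> with \<open>p \<le> q\<close>: the square roots of the \<open>p\<close> eigenvalues
  of \<open>Z Z\<^sup>*\<close>.\<close>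

definition sing_vals :: "complex mat \<Rightarrow> real vec" where
  "sing_vals Z = map_vec sqrt (eig_vals (Z * mat_adjoint Z))"

definition svd_pairs :: "complex set \<Rightarrow> complex mat \<Rightarrow> (complex mat \<times> complex mat) set" where
  "svd_pairs K Z = {(U, V). U \<in> unitaries K (dim_row Z) \<and> V \<in> unitaries K (dim_col Z) \<and>
     Z = U * rect_diag (dim_row Z) (dim_col Z) (sing_vals Z) * mat_adjoint V}"

definition herm_part :: "complex mat \<Rightarrow> complex mat" where
  "herm_part Y = (1 / 2) \<cdot>\<^sub>m (Y + mat_adjoint Y)"

definition skew_part :: "complex mat \<Rightarrow> complex mat" where
  "skew_part Y = (1 / 2) \<cdot>\<^sub>m (Y - mat_adjoint Y)"

definition hadamard_prod :: "real mat \<Rightarrow> complex mat \<Rightarrow> complex mat" where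
  "hadamard_prod E A = mat (dim_row A) (dim_col A)
     (\<lambda>ij. complex_of_real (E $$ ij) * A $$ ij)"

definition hcat :: "complex mat \<Rightarrow> complex mat \<Rightarrow> complex mat" where
  "hcat A B = four_block_mat A B (0\<^sub>m 0 (dim_col A)) (0\<^sub>m 0 (dim_col B))"

definition col_sub :: "complex mat \<Rightarrow> nat set \<Rightarrow> complex mat" where
  "col_sub Y J = submatrix Y UNIV J"

definition subvec :: "real vec \<Rightarrow> nat set \<Rightarrow> real vec" where
  "subvec x J = vec (card J) (\<lambda>k. x $ pick J k)"

section \<open>Spectral operators\<close>

definition signed_perm_mat :: "nat \<Rightarrow> real mat \<Rightarrow> bool" where
  "signed_perm_mat m Q \<longleftrightarrow> Q \<in> carrier_mat m m \<and> elements_mat Q \<subseteq> {-1, 0, 1} \<and>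
     (\<forall>i<m. \<exists>!j. j < m \<and> Q $$ (i, j) \<noteq> 0) \<and>
     (\<forall>j<m. \<exists>!i. i < m \<and> Q $$ (i, j) \<noteq> 0)"

definition abs_symmetric_on :: "nat \<Rightarrow> real vec set \<Rightarrow> (real vec \<Rightarrow> real vec) \<Rightarrow> bool" where
  "abs_symmetric_on m D g \<longleftrightarrow>
     (\<forall>x \<in> D. \<forall>Q. signed_perm_mat m Q \<longrightarrow> g (Q *\<^sub>v x) = Q *\<^sub>v g x)"

text \<open>Here and in \<open>Phi_comps\<close> below the value does not depend on the decompositions picked.\<close>

definition spectral_op :: "complex set \<Rightarrow> (real vec \<Rightarrow> real vec) \<Rightarrow> complex mat \<Rightarrow> complex mat" where
  "spectral_op K g X = (let (U, V) = (SOME UV. UV \<in> svd_pairs K X) in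
     U * rect_diag (dim_row X) (dim_col X) (g (sing_vals X)) * mat_adjoint V)"

section \<open>The first divided directional difference\<close>

text \<open>In this section \<open>s\<close> is the vector of singular values of the base point.\<close>

definition E1_mat :: "(real vec \<Rightarrow> real vec) \<Rightarrow> real vec \<Rightarrow> real mat" where
  "E1_mat g s = mat (dim_vec s) (dim_vec s)
     (\<lambda>(i, j). if s $ i \<noteq> s $ j then (g s $ i - g s $ j) / (s $ i - s $ j) else 0)"

definition E2_mat :: "(real vec \<Rightarrow> real vec) \<Rightarrow> real vec \<Rightarrow> real mat" where
  "E2_mat g s = mat (dim_vec s) (dim_vec s)
     (\<lambda>(i, j). if s $ i + s $ j \<noteq> 0 then (g s $ i + g s $ j) / (s $ i + s $ j) else 0)"

definition F_mat :: "nat \<Rightarrow> (real vec \<Rightarrow> real vec) \<Rightarrow> real vec \<Rightarrow> real mat" where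
  "F_mat n g s = mat (dim_vec s) (n - dim_vec s)
     (\<lambda>(i, j). if s $ i \<noteq> 0 then g s $ i / s $ i else 0)"

definition a_set :: "real vec \<Rightarrow> nat set" where
  "a_set s = {i. i < dim_vec s \<and> s $ i > 0}"

definition b_set :: "real vec \<Rightarrow> nat set" where
  "b_set s = {i. i < dim_vec s \<and> s $ i = 0}"

definition a_blocks :: "real vec \<Rightarrow> nat set list" where
  "a_blocks s = map (\<lambda>nu. {i. i < dim_vec s \<and> s $ i = nu})
     (rev (sorted_list_of_set ((\<lambda>i. s $ i) ` a_set s)))"

text \<open>An element \<open>(W\<^sub>1, \<dots>, W\<^sub>r\<^sub>+\<^sub>1)\<close> of the product space is the pair of the list \<open>[W\<^sub>1, \<dots>, W\<^sub>r]\<close>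
  and \<open>W\<^sub>r\<^sub>+\<^sub>1\<close>.\<close>

type_synonym block_tuple = "complex mat list \<times> complex mat"

definition kappa :: "block_tuple \<Rightarrow> real vec" where
  "kappa W = vec_of_list
     (concat (map (\<lambda>Wl. list_of_vec (eig_vals Wl)) (fst W)) @ list_of_vec (sing_vals (snd W)))"

text \<open>\<open>Phi_comps K s phi W\<close> is \<open>\<Phi>(W)\<close>; \<open>phi\<close> will be the directional derivative of \<open>g\<close> at \<open>s\<close>.\<close>

definition Phi_comps ::
  "complex set \<Rightarrow> real vec \<Rightarrow> (real vec \<Rightarrow> real vec) \<Rightarrow> block_tuple \<Rightarrow> block_tuple" where
  "Phi_comps K s phi W =
     (map2 (\<lambda>J Wl. let P = (SOME P. P \<in> eig_bases K Wl) in
              P * rect_diag (card J) (card J) (subvec (phi (kappa W)) J) * mat_adjoint P)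
        (a_blocks s) (fst W),
      let (M, N) = (SOME MN. MN \<in> svd_pairs K (snd W)); k = card (b_set s) in
        M * rect_diag k k (subvec (phi (kappa W)) (b_set s)) * mat_adjoint (col_sub N {..<k}))"

definition Phi_hat ::
  "complex set \<Rightarrow> nat \<Rightarrow> real vec \<Rightarrow> (real vec \<Rightarrow> real vec) \<Rightarrow> block_tuple \<Rightarrow> complex mat" where
  "Phi_hat K n s phi W = (let (As, B) = Phi_comps K s phi W in
     four_block_mat (diag_block_mat As) (0\<^sub>m (card (a_set s)) (n - card (a_set s)))
       (0\<^sub>m (card (b_set s)) (card (a_set s))) B)"

definition D_map ::
  "nat \<Rightarrow> nat \<Rightarrow> real vec \<Rightarrow> complex mat \<Rightarrow> complex mat \<Rightarrow> complex mat \<Rightarrow> block_tuple" where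
  "D_map m n s U V H =
     (map (\<lambda>J. herm_part (mat_adjoint (col_sub U J) * H * col_sub V J)) (a_blocks s),
      mat_adjoint (col_sub U (b_set s)) * H
        * hcat (col_sub V (b_set s)) (col_sub V {m..<n}))"

definition div_dir_diff ::
  "complex set \<Rightarrow> nat \<Rightarrow> nat \<Rightarrow> (real vec \<Rightarrow> real vec) \<Rightarrow> complex mat \<Rightarrow> complex mat \<Rightarrow>
     complex mat \<Rightarrow> complex mat \<Rightarrow> complex mat" where
  "div_dir_diff K m n g U V X H =
     (let s = sing_vals X;
          A1 = mat_adjoint U * H * col_sub V {..<m};
          A2 = mat_adjoint U * H * col_sub V {m..<n};
          phi = dir_deriv (vec_eucl m) (vec_eucl m) g s
      in hcat (hadamard_prod (E1_mat g s) (herm_part A1) + hadamard_prod (E2_mat g s) (skew_part A1))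
           (hadamard_prod (F_mat n g s) A2)
         + Phi_hat K n s phi (D_map m n s U V H))"

end

theory Submission
  imports Defs "HOL-Combinatorics.Permutations"
begin

text \<open>
  Both notions of differentiability are limits along \<open>t \<down> 0\<close>, \<open>h' \<rightarrow> h\<close>. Such a limit may be tested on
  sequences, and it is enough that every sequence has a subsequence with the prescribed limit
  (\<open>limitin_prodI_sequences\<close>). So compactness of the unitary group can take the place of a perturbation
  theory for singular values and singular vectors.

  Let \<open>g\<close> be Hadamard directionally differentiable at \<open>s = \<sigma>(X)\<close>, put \<open>\<phi> = g'(s; \<cdot>)\<close>, and let
  \<open>X\<^sub>k = X + t\<^sub>k H\<^sub>k\<close> have the singular value decomposition \<open>U\<^sub>k [Diag(s\<^sub>k) 0] V\<^sub>k\<^sup>*\<close>. Along a subsequence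
  \<open>U\<^sub>k \<rightarrow> U'\<close> and \<open>V\<^sub>k \<rightarrow> V'\<close>, and then \<open>X = U' [Diag(s) 0] V'\<^sup>*\<close> (\<open>path_subsequence\<close>). Put
  \<open>P = U'\<^sup>* U\<^sub>k\<close> and \<open>Q = V'\<^sup>* V\<^sub>k\<close>, which tend to 1, and \<open>M = U'\<^sup>* H V'\<close>. Comparing the two expressions for \<open>X\<^sub>k\<close>
  gives, with \<open>s' = s\<^sub>k\<close> and for \<open>i, j < m\<close>,
  \<open>(P + Q)\<^sub>i\<^sub>j (s'\<^sub>j - s\<^sub>i) = t\<^sub>k (a + b)\<^sub>i\<^sub>j\<close> and \<open>(P - Q)\<^sub>i\<^sub>j (s'\<^sub>j + s\<^sub>i) = t\<^sub>k (a - b)\<^sub>i\<^sub>j\<close>, where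
  \<open>a = U'\<^sup>* H\<^sub>k V\<^sub>k \<rightarrow> M\<close> and \<open>b = V'\<^sup>* H\<^sub>k\<^sup>* U\<^sub>k \<rightarrow> M\<^sup>*\<close>. These relations contain the analysis. On the diagonal they say that \<open>(s' - s) / t\<^sub>k\<close>
  converges to \<open>h = Re(diag M)\<close>. For \<open>s\<^sub>i = s\<^sub>j\<close> they say that in the limiting bases the Hermitian parts of the blocks of
  \<open>M\<close> are diagonal, and so is the whole block of the singular value 0. Where \<open>s\<^sub>j \<noteq> s\<^sub>i\<close>, respectively \<open>s\<^sub>j \<noteq> - s\<^sub>i\<close>, they
  give the limit of \<open>(P + Q)\<^sub>i\<^sub>j / t\<^sub>k\<close>, respectively \<open>(P - Q)\<^sub>i\<^sub>j / t\<^sub>k\<close>, and these limits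
  turn \<open>(P [Diag(g(s)) 0] - [Diag(g(s)) 0] Q) / t\<^sub>k\<close> into the divided differences of \<open>g\<close>. Hence the difference
  quotients of \<open>G\<close> converge to \<open>U' (div_diff_part + [Diag(\<phi>(h)) 0]) V'\<^sup>*\<close> (\<open>spectral_limit\<close>).

  It remains to rewrite this limit in the given basis \<open>(U, V)\<close>, so that it no longer depends on the
  subsequence. The matrices \<open>A = U\<^sup>* U'\<close> and \<open>B = V\<^sup>* V'\<close> intertwine \<open>[Diag(s) 0]\<close> with itself, so they are block
  diagonal with equal blocks at the positive singular values. The divided differences are constant on
  blocks and are carried along (\<open>div_diff_part_conj\<close>), and the blocks of \<open>A\<close> and \<open>B\<close> diagonalise
  the components of \<open>D(H)\<close>, with the blocks of \<open>h\<close> as eigenvalues and singular values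
  (\<open>Phi_hat_conj\<close>).

  Conversely, \<open>G\<close> maps \<open>U [Diag(x) 0] V\<^sup>*\<close> to \<open>U [Diag(g(x)) 0] V\<^sup>*\<close> for every real vector \<open>x\<close> whose rearranged
  absolute values lie in \<open>D\<close> (\<open>spectral_op_diagonalized\<close>). So the difference quotients of \<open>g\<close> are diagonals of
  difference quotients of \<open>G\<close>.

  Independence of the chosen decompositions is always the same argument: a matrix that intertwines two
  diagonal matrices has zero entries where the diagonals differ, so it intertwines the images of the diagonals under
  \<open>g\<close> or \<open>\<phi>\<close> as well (\<open>diag_intertwine\<close>, \<open>rect_diag_intertwine\<close>). Decompositions over \<open>K\<close> exist because a weighted trace
  attains its maximum on the pairs of unitary matrices (\<open>svd_exists\<close>).
\<close>

section \<open>Limits in coordinates and along sequences\<close>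

lemma limitin_imp_filterlim_nhdsin:
  assumes "limitin T f l F"
  shows "filterlim f (nhdsin T l) F"
  unfolding filterlim_iff eventually_nhdsin
proof (intro allI impI, elim disjE exE conjE)
  fix P W assume W: "openin T W" "l \<in> W" "\<forall>x\<in>W. P x"
  then have "\<forall>\<^sub>F x in F. f x \<in> W"
    using assms by (auto simp: limitin_def)
  then show "\<forall>\<^sub>F x in F. P (f x)"
    by eventually_elim (use W in auto)
qed (use assms in \<open>auto simp: limitin_def\<close>)

lemma limitin_compose_filterlim:
  assumes "limitin T f l F" "filterlim p F G"
  shows "limitin T (\<lambda>x. f (p x)) l G"
  using assms unfolding limitin_def by (auto dest: eventually_compose_filterlim)

text \<open>The topologies of the statement are metric topologies on a carrier and not type class topologies. The
  locale turns them into convergence of finitely many coordinates, for matrices and for vectors alike.\<close>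

locale coord_space =
  fixes Z :: "('a :: minus) eucl" and I :: "'k set" and c :: "'a \<Rightarrow> 'k \<Rightarrow> 'b :: real_normed_vector"
  assumes finite_I: "finite I"
    and inprod_diff: "\<And>x y. x \<in> points Z \<Longrightarrow> y \<in> points Z \<Longrightarrow>
          inprod Z (x - y) (x - y) = (\<Sum>k\<in>I. (norm (c x k - c y k))\<^sup>2)"
    and coords_inj: "\<And>x y. x \<in> points Z \<Longrightarrow> y \<in> points Z \<Longrightarrow> (\<And>k. k \<in> I \<Longrightarrow> c x k = c y k) \<Longrightarrow> x = y"
begin

lemma dist_eq:
  "x \<in> points Z \<Longrightarrow> y \<in> points Z \<Longrightarrow> eucl_dist Z x y = L2_set (\<lambda>k. norm (c x k - c y k)) I"
  by (simp add: eucl_dist_def inprod_diff L2_set_def)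

sublocale M: Metric_space "points Z" "eucl_dist Z"
proof
  show "0 \<le> eucl_dist Z x y" for x y
    by (auto simp: eucl_dist_def inprod_diff intro: sum_nonneg)
  show "eucl_dist Z x y = eucl_dist Z y x" for x y
    by (auto simp: eucl_dist_def inprod_diff norm_minus_commute)
  show "(eucl_dist Z x y = 0) = (x = y)" if "x \<in> points Z" "y \<in> points Z" for x y
    using coords_inj that by (auto simp: dist_eq L2_set_eq_0_iff finite_I)
  show "eucl_dist Z x z \<le> eucl_dist Z x y + eucl_dist Z y z"
    if "x \<in> points Z" "y \<in> points Z" "z \<in> points Z" for x y z
  proof -
    have "L2_set (\<lambda>k. norm (c x k - c z k)) I
        \<le> L2_set (\<lambda>k. norm (c x k - c y k) + norm (c y k - c z k)) I"
      by (rule L2_set_mono) (use dist_triangle[of "c x _" "c z _" "c y _"] in \<open>auto simp: dist_norm\<close>)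
    also have "\<dots> \<le> L2_set (\<lambda>k. norm (c x k - c y k)) I + L2_set (\<lambda>k. norm (c y k - c z k)) I"
      by (rule L2_set_triangle_ineq)
    finally show ?thesis using that by (simp add: dist_eq)
  qed
qed

lemma topology_eq: "eucl_topology Z = M.mtopology"
  by (simp add: eucl_topology_def)

lemma limitin_iff:
  "limitin (eucl_topology Z) f L F \<longleftrightarrow>
     L \<in> points Z \<and> (\<forall>\<^sub>F x in F. f x \<in> points Z) \<and> (\<forall>k\<in>I. ((\<lambda>x. c (f x) k) \<longlongrightarrow> c L k) F)"
proof (cases "L \<in> points Z \<and> (\<forall>\<^sub>F x in F. f x \<in> points Z)")
  case True
  have "limitin (eucl_topology Z) f L F \<longleftrightarrow> ((\<lambda>x. L2_set (\<lambda>k. norm (c (f x) k - c L k)) I) \<longlongrightarrow> 0) F"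
  proof -
    have "limitin (eucl_topology Z) f L F \<longleftrightarrow> (\<forall>e>0. \<forall>\<^sub>F x in F. f x \<in> points Z \<and> eucl_dist Z (f x) L < e)"
      using True by (simp add: topology_eq M.limitin_metric)
    also have "\<dots> \<longleftrightarrow> (\<forall>e>0. \<forall>\<^sub>F x in F. dist (L2_set (\<lambda>k. norm (c (f x) k - c L k)) I) 0 < e)"
    proof (intro all_cong1 imp_cong refl eventually_cong[of "\<lambda>x. f x \<in> points Z"])
      show "\<forall>\<^sub>F x in F. f x \<in> points Z" using True by blast
    qed (use True in \<open>simp add: dist_eq L2_set_nonneg\<close>)
    finally show ?thesis by (simp add: tendsto_iff)
  qed
  also have "\<dots> \<longleftrightarrow> (\<forall>k\<in>I. ((\<lambda>x. c (f x) k) \<longlongrightarrow> c L k) F)"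
  proof
    assume lim: "((\<lambda>x. L2_set (\<lambda>k. norm (c (f x) k - c L k)) I) \<longlongrightarrow> 0) F"
    show "\<forall>k\<in>I. ((\<lambda>x. c (f x) k) \<longlongrightarrow> c L k) F"
    proof
      fix k assume "k \<in> I"
      have "((\<lambda>x. norm (c (f x) k - c L k)) \<longlongrightarrow> 0) F"
        by (rule tendsto_sandwich[OF _ _ tendsto_const lim])
          (auto intro!: always_eventually member_le_L2_set finite_I \<open>k \<in> I\<close>)
      then show "((\<lambda>x. c (f x) k) \<longlongrightarrow> c L k) F"
        using LIM_zero_cancel tendsto_norm_zero_iff by blast
    qed
  next
    assume lim: "\<forall>k\<in>I. ((\<lambda>x. c (f x) k) \<longlongrightarrow> c L k) F"
    have "((\<lambda>x. L2_set (\<lambda>k. norm (c (f x) k - c L k)) I) \<longlongrightarrow> sqrt (\<Sum>k\<in>I. (norm (c L k - c L k))\<^sup>2)) F"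
      unfolding L2_set_def using lim by (intro tendsto_intros) auto
    then show "((\<lambda>x. L2_set (\<lambda>k. norm (c (f x) k - c L k)) I) \<longlongrightarrow> 0) F" by simp
  qed
  finally show ?thesis using True by blast
next
  case False
  have "\<forall>\<^sub>F x in F. f x \<in> points Z" if "limitin (eucl_topology Z) f L F"
    using that[unfolded topology_eq M.limitin_metric]
    by (auto elim: eventually_mono dest: spec[of _ "1 :: real"])
  moreover have "L \<in> points Z" if "limitin (eucl_topology Z) f L F"
    using that by (simp add: topology_eq M.limitin_metric)
  ultimately show ?thesis using False by blast
qed

lemma limitin_unique:
  assumes "limitin (eucl_topology Z) f L F" "limitin (eucl_topology Z) f L' F" "F \<noteq> bot"
  shows "L = L'"
  using assms by (auto simp: limitin_iff intro!: coords_inj intro: tendsto_unique)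

text \<open>Hadamard limits are uniform over directions near \<open>h\<close>, so they may be evaluated along directions that
  vary with the step size. This is how the derivative of \<open>g\<close> meets the non-straight curve of
  singular values.\<close>

lemma limitin_prod_sequences:
  assumes "limitin T f L (at_right (0 :: real) \<times>\<^sub>F nhdsin (eucl_topology Z) h)"
    and "\<And>k. t k > 0" "t \<longlonglongrightarrow> 0" "limitin (eucl_topology Z) hs h sequentially"
  shows "limitin T (\<lambda>k. f (t k, hs k)) L sequentially"
proof (rule limitin_compose_filterlim[OF assms(1)])
  show "filterlim (\<lambda>k. (t k, hs k)) (at_right (0 :: real) \<times>\<^sub>F nhdsin (eucl_topology Z) h) sequentially"
    using assms(2-4)
    by (intro filterlim_Pair limitin_imp_filterlim_nhdsin)
      (auto simp: filterlim_at less_imp_neq[symmetric])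
qed

text \<open>Both factors of the product filter are countably generated, so a failure of the limit shows on one
  sequence that stays outside a neighbourhood, and then so do all its subsequences. The \<open>r\<close> leaves room for
  compactness arguments.\<close>

lemma limitin_prodI_sequences:
  assumes h: "h \<in> points Z"
    and seq: "\<And>t hs. (\<And>k. t k > 0) \<Longrightarrow> t \<longlonglongrightarrow> 0 \<Longrightarrow> (\<And>k. hs k \<in> points Z) \<Longrightarrow>
        limitin (eucl_topology Z) hs h sequentially \<Longrightarrow>
        \<exists>r. strict_mono (r :: nat \<Rightarrow> nat) \<and> limitin T (\<lambda>k. f (t (r k), hs (r k))) L sequentially"
  shows "limitin T f L (at_right (0 :: real) \<times>\<^sub>F nhdsin (eucl_topology Z) h)"
proof (rule ccontr)
  have inv0: "(\<lambda>k. 1 / real (Suc k)) \<longlonglongrightarrow> 0"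
    using LIMSEQ_inverse_real_of_nat by (simp add: inverse_eq_divide)
  \<comment> \<open>A constant sequence of directions already shows that \<open>L\<close> is a point of \<open>T\<close>.\<close>
  have "limitin (eucl_topology Z) (\<lambda>k. h) h sequentially" using h by (simp add: topology_eq)
  then have T: "L \<in> topspace T"
    using seq[of "\<lambda>k. 1 / real (Suc k)" "\<lambda>k. h"] inv0 h by (auto dest: limitin_topspace)
  assume "\<not> ?thesis"
  then obtain W where W: "openin T W" "L \<in> W"
    and bad: "\<not> (\<forall>\<^sub>F x in at_right (0 :: real) \<times>\<^sub>F nhdsin (eucl_topology Z) h. f x \<in> W)"
    using T unfolding limitin_def by blast
  have "\<exists>t h'. 0 < t \<and> t < 1 / Suc k \<and> h' \<in> points Z \<and> eucl_dist Z h h' < 1 / Suc k \<and> f (t, h') \<notin> W" for k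
  proof (rule ccontr)
    assume neg: "\<not> ?thesis"
    have "\<forall>\<^sub>F t in at_right 0. 0 < t \<and> t < 1 / real (Suc k)"
      unfolding eventually_at_right_field by (intro exI[of _ "1 / real (Suc k)"]) auto
    moreover have "\<forall>\<^sub>F h' in nhdsin (eucl_topology Z) h. h' \<in> points Z \<and> eucl_dist Z h h' < 1 / Suc k"
      unfolding eventually_nhdsin topology_eq using h
      by (intro disjI2 exI[of _ "M.mball h (1 / Suc k)"]) auto
    ultimately have "\<forall>\<^sub>F x in at_right (0 :: real) \<times>\<^sub>F nhdsin (eucl_topology Z) h. f x \<in> W"
      unfolding eventually_prod_filter using neg by blast
    then show False using bad by blast
  qed
  then obtain t hs where th: "\<And>k. 0 < t k" "\<And>k. t k < 1 / Suc k" "\<And>k. hs k \<in> points Z"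
      "\<And>k. eucl_dist Z h (hs k) < 1 / Suc k" "\<And>k. f (t k, hs k) \<notin> W"
    by metis
  have "t \<longlonglongrightarrow> 0"
    by (rule tendsto_sandwich[OF _ _ tendsto_const inv0]) (use th in \<open>auto intro: less_imp_le always_eventually\<close>)
  moreover have "limitin (eucl_topology Z) hs h sequentially"
    unfolding topology_eq M.limitin_metric
  proof (intro conjI h allI impI)
    fix e :: real assume "e > 0"
    then have "\<forall>\<^sub>F k in sequentially. 1 / real (Suc k) < e"
      using inv0 by (auto simp: order_tendsto_iff)
    then show "\<forall>\<^sub>F k in sequentially. hs k \<in> points Z \<and> eucl_dist Z (hs k) h < e"
      by eventually_elim (metis M.commute order.strict_trans th(3,4))
  qed
  ultimately obtain r where "limitin T (\<lambda>k. f (t (r k), hs (r k))) L sequentially"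
    using seq[of t hs] th by blast
  then have "\<forall>\<^sub>F k in sequentially. f (t (r k), hs (r k)) \<in> W"
    using W by (auto simp: limitin_def)
  then show False using th(5) by simp
qed

lemma limitin_fixed_direction:
  assumes "limitin T f L (at_right (0 :: real) \<times>\<^sub>F nhdsin (eucl_topology Z) h)" "h \<in> points Z"
  shows "limitin T (\<lambda>t. f (t, h)) L (at_right 0)"
proof (rule limitin_compose_filterlim[OF assms(1)])
  have "limitin (eucl_topology Z) (\<lambda>t :: real. h) h (at_right 0)"
    using assms(2) by (simp add: topology_eq)
  then show "filterlim (\<lambda>t. (t, h)) (at_right (0 :: real) \<times>\<^sub>F nhdsin (eucl_topology Z) h) (at_right 0)"
    by (intro filterlim_Pair limitin_imp_filterlim_nhdsin filterlim_ident)
qed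

end

section \<open>Matrices over the real or complex field\<close>

text \<open>Entries of products are sums over an index range (\<open>mult_entry\<close>), expanded only on request.\<close>

declare index_mult_mat(1) [simp del]

text \<open>The side conditions of the carrier versions of these laws mention dimensions that do not occur in the
  equation. Stated with \<^const>\<open>dim_row\<close> and \<^const>\<open>dim_col\<close>, the laws are conditional rewrite rules.\<close>

lemma mult_assoc_dim:
  fixes A :: "'a :: semiring_0 mat"
  shows "dim_col A = dim_row B \<Longrightarrow> dim_col B = dim_row C \<Longrightarrow> A * B * C = A * (B * C)"
  by (rule assoc_mult_mat[of A "dim_row A" "dim_col A" B "dim_col B" C "dim_col C"]) auto

lemma mult_entry:
  fixes A :: "'a :: semiring_0 mat"
  shows "i < dim_row A \<Longrightarrow> j < dim_col B \<Longrightarrow> dim_row B = dim_col A \<Longrightarrow>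
    (A * B) $$ (i, j) = (\<Sum>k<dim_col A. A $$ (i, k) * B $$ (k, j))"
  by (simp add: index_mult_mat(1) scalar_prod_def lessThan_atLeast0)

lemma dim_mat_adjoint [simp]:
  "dim_row (mat_adjoint A) = dim_col A" "dim_col (mat_adjoint A) = dim_row A"
  by (simp_all add: mat_adjoint_def)

lemma mat_adjoint_entry [simp]:
  "i < dim_col A \<Longrightarrow> j < dim_row A \<Longrightarrow> mat_adjoint (A :: complex mat) $$ (i, j) = cnj (A $$ (j, i))"
  by (simp add: mat_adjoint_def mat_of_rows_index)

abbreviation (input) adj :: "complex mat \<Rightarrow> complex mat" where "adj \<equiv> mat_adjoint"

lemma mat_adjoint_mult:
  fixes A :: "complex mat"
  shows "dim_col A = dim_row B \<Longrightarrow> adj (A * B) = adj B * adj A"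
  by (rule eq_matI) (auto simp: mult_entry sum_distrib_left mult.commute)

lemma mat_adjoint_adjoint [simp]: "adj (adj (A :: complex mat)) = A"
  by (rule eq_matI) auto

lemma dim_rect_diag [simp]: "dim_row (rect_diag p q x) = p" "dim_col (rect_diag p q x) = q"
  by (simp_all add: rect_diag_def)

lemma rect_diag_entry [simp]:
  "i < p \<Longrightarrow> j < q \<Longrightarrow> rect_diag p q x $$ (i, j) = (if i = j then of_real (x $ i) else 0)"
  by (simp add: rect_diag_def)

lemma mat_adjoint_rect_diag [simp]: "adj (rect_diag p q x) = rect_diag q p x"
  by (rule eq_matI) auto

lemma mult_rect_diag_entry:
  assumes "i < dim_row A" "j < q" "dim_col A = p"
  shows "(A * rect_diag p q x) $$ (i, j) = (if j < p then A $$ (i, j) * of_real (x $ j) else 0)"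
proof -
  have "(A * rect_diag p q x) $$ (i, j) = (\<Sum>k<p. if k = j then A $$ (i, k) * of_real (x $ k) else 0)"
    using assms by (subst mult_entry, simp, simp, simp, intro sum.cong) auto
  then show ?thesis by (simp add: sum.delta)
qed

lemma rect_diag_mult_entry:
  assumes "i < p" "j < dim_col A" "dim_row A = q"
  shows "(rect_diag p q x * A) $$ (i, j) = (if i < q then of_real (x $ i) * A $$ (i, j) else 0)"
proof -
  have "(rect_diag p q x * A) $$ (i, j) = (\<Sum>k<q. if k = i then of_real (x $ i) * A $$ (k, j) else 0)"
    using assms by (subst mult_entry, simp, simp, simp, intro sum.cong) auto
  then show ?thesis by (simp add: sum.delta)
qed

lemmas rect_diag_entries = mult_rect_diag_entry rect_diag_mult_entry

lemma rect_diag_product_entry: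
  assumes "i < dim_row A" "j < dim_row B" "dim_col A = p" "dim_col B = q" "p \<le> q"
  shows "(A * rect_diag p q x * adj B) $$ (i, j)
    = (\<Sum>k<p. A $$ (i, k) * of_real (x $ k) * cnj (B $$ (j, k)))"
proof -
  have "(A * rect_diag p q x * adj B) $$ (i, j)
      = (\<Sum>k<q. if k < p then A $$ (i, k) * of_real (x $ k) * cnj (B $$ (j, k)) else 0)"
    using assms by (subst mult_entry) (auto simp: mult_rect_diag_entry intro!: sum.cong)
  also have "\<dots> = (\<Sum>k<p. A $$ (i, k) * of_real (x $ k) * cnj (B $$ (j, k)))"
    using assms(5) by (intro sum.mono_neutral_cong_right) auto
  finally show ?thesis .
qed

lemma mats_dim: "A \<in> mats K p q \<Longrightarrow> dim_row A = p" "A \<in> mats K p q \<Longrightarrow> dim_col A = q"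
  by (auto simp: mats_def)

lemma mats_iff:
  "A \<in> mats K p q \<longleftrightarrow> dim_row A = p \<and> dim_col A = q \<and> (\<forall>i<p. \<forall>j<q. A $$ (i, j) \<in> K)"
  by (fastforce simp: mats_def elements_mat_def)

lemma matsI:
  "dim_row A = p \<Longrightarrow> dim_col A = q \<Longrightarrow> (\<And>i j. i < p \<Longrightarrow> j < q \<Longrightarrow> A $$ (i, j) \<in> K) \<Longrightarrow> A \<in> mats K p q"
  by (simp add: mats_iff)

lemma mats_entry: "A \<in> mats K p q \<Longrightarrow> i < p \<Longrightarrow> j < q \<Longrightarrow> A $$ (i, j) \<in> K"
  by (simp add: mats_iff)

lemma unitaries_mats: "P \<in> unitaries K p \<Longrightarrow> P \<in> mats K p p"
  by (simp add: unitaries_def)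

lemma unitaries_dim: "P \<in> unitaries K p \<Longrightarrow> dim_row P = p" "P \<in> unitaries K p \<Longrightarrow> dim_col P = p"
  by (auto simp: unitaries_def mats_def)

lemma unitaries_left: "P \<in> unitaries K p \<Longrightarrow> adj P * P = 1\<^sub>m p"
  by (simp add: unitaries_def)

lemma unitaries_right: "P \<in> unitaries K p \<Longrightarrow> P * adj P = 1\<^sub>m p"
  by (rule mat_mult_left_right_inverse[of _ p]) (auto simp: unitaries_left unitaries_dim)

lemma one_mult_dim [simp]:
  fixes A :: "'a :: semiring_1 mat"
  shows "dim_row A = p \<Longrightarrow> 1\<^sub>m p * A = A" "dim_col A = p \<Longrightarrow> A * 1\<^sub>m p = A"
  by (auto intro!: left_mult_one_mat' right_mult_one_mat')

lemma unitaries_cancel_left: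
  "P \<in> unitaries K p \<Longrightarrow> dim_row A = p \<Longrightarrow> adj P * (P * A) = A"
  by (subst mult_assoc_dim[symmetric]) (auto simp: unitaries_left unitaries_dim)

lemma unitaries_cancel_right:
  "P \<in> unitaries K p \<Longrightarrow> dim_row A = p \<Longrightarrow> P * (adj P * A) = A"
  by (subst mult_assoc_dim[symmetric]) (auto simp: unitaries_right unitaries_dim)

lemmas unitaries_simps = unitaries_dim unitaries_left unitaries_right
  unitaries_cancel_left unitaries_cancel_right

lemma unitaries_left_entry:
  assumes "P \<in> unitaries K p" "i < p" "j < p"
  shows "(\<Sum>k<p. cnj (P $$ (k, i)) * P $$ (k, j)) = (if i = j then 1 else 0)"
proof -
  have "(adj P * P) $$ (i, j) = (\<Sum>k<p. cnj (P $$ (k, i)) * P $$ (k, j))"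
    using assms by (simp add: mult_entry unitaries_dim)
  then show ?thesis using assms by (simp add: unitaries_left)
qed

lemma unitariesI:
  assumes "P \<in> mats K p p"
    and "\<And>i j. i < p \<Longrightarrow> j < p \<Longrightarrow> (\<Sum>k<p. cnj (P $$ (k, i)) * P $$ (k, j)) = (if i = j then 1 else 0)"
  shows "P \<in> unitaries K p"
proof -
  have "adj P * P = 1\<^sub>m p"
    by (rule eq_matI) (use assms in \<open>auto simp: mult_entry mats_dim\<close>)
  then show ?thesis using assms(1) by (simp add: unitaries_def)
qed

lemma unitaries_entry_le_1:
  assumes "P \<in> unitaries K p" "i < p" "j < p"
  shows "cmod (P $$ (i, j)) \<le> 1"
proof -
  have "complex_of_real (\<Sum>k<p. (cmod (P $$ (k, j)))\<^sup>2) = 1"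
    using unitaries_left_entry[OF assms(1,3,3)]
    by (simp only: of_real_sum complex_norm_square mult.commute refl if_True)
  then have sum1: "(\<Sum>k<p. (cmod (P $$ (k, j)))\<^sup>2) = 1" by (metis of_real_eq_1_iff)
  have "(cmod (P $$ (i, j)))\<^sup>2 \<le> (\<Sum>k<p. (cmod (P $$ (k, j)))\<^sup>2)"
    using assms by (intro member_le_sum) auto
  then show ?thesis using sum1 by (simp add: abs_square_le_1)
qed

lemma add_mult_dim:
  fixes A :: "'a :: semiring_0 mat"
  shows "dim_row A = dim_row B \<Longrightarrow> dim_col A = dim_col B \<Longrightarrow> dim_col B = dim_row C \<Longrightarrow>
    (A + B) * C = A * C + B * C"
  by (rule add_mult_distrib_mat[of _ "dim_row B" "dim_col B"]) auto

lemma mult_add_dim: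
  fixes A :: "'a :: semiring_0 mat"
  shows "dim_row B = dim_row C \<Longrightarrow> dim_col B = dim_col C \<Longrightarrow> dim_col A = dim_row C \<Longrightarrow>
    A * (B + C) = A * B + A * C"
  by (rule mult_add_distrib_mat[of _ "dim_row A" "dim_row C" _ "dim_col C"]) auto

lemma minus_mult_dim:
  fixes A :: "'a :: ring mat"
  shows "dim_row A = dim_row B \<Longrightarrow> dim_col A = dim_col B \<Longrightarrow> dim_col B = dim_row C \<Longrightarrow>
    (A - B) * C = A * C - B * C"
  by (rule minus_mult_distrib_mat[of _ "dim_row B" "dim_col B"]) auto

lemma mult_minus_dim:
  fixes A :: "'a :: ring mat"
  shows "dim_row B = dim_row C \<Longrightarrow> dim_col B = dim_col C \<Longrightarrow> dim_col A = dim_row C \<Longrightarrow>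
    A * (B - C) = A * B - A * C"
  by (rule mult_minus_distrib_mat[of _ "dim_row A" "dim_row C" _ "dim_col C"]) auto

lemma smult_mult_dim:
  fixes A :: "'a :: comm_semiring_0 mat"
  shows "dim_col A = dim_row B \<Longrightarrow> (c \<cdot>\<^sub>m A) * B = c \<cdot>\<^sub>m (A * B)"
  by (rule mult_smult_assoc_mat[of _ "dim_row A" "dim_row B" _ "dim_col B"]) auto

lemma mult_smult_dim:
  fixes A :: "'a :: comm_semiring_0 mat"
  shows "dim_col A = dim_row B \<Longrightarrow> A * (c \<cdot>\<^sub>m B) = c \<cdot>\<^sub>m (A * B)"
  by (rule mult_smult_distrib[of _ "dim_row A" "dim_row B" _ "dim_col B"]) auto

lemma mat_adjoint_smult:
  "adj (c \<cdot>\<^sub>m (A :: complex mat)) = cnj c \<cdot>\<^sub>m adj A"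
  by (rule eq_matI) auto

lemma mat_adjoint_add:
  fixes A :: "complex mat"
  shows "dim_row A = dim_row B \<Longrightarrow> dim_col A = dim_col B \<Longrightarrow> adj (A + B) = adj A + adj B"
  by (rule eq_matI) auto

lemmas dim_algebra = mult_assoc_dim add_mult_dim mult_add_dim minus_mult_dim mult_minus_dim
  smult_mult_dim mult_smult_dim mat_adjoint_mult mat_adjoint_smult mat_adjoint_add

locale base_field =
  fixes K :: "complex set"
  assumes K: "K = \<real> \<or> K = UNIV"
begin

lemma K_closed [simp, intro]:
  "x \<in> K \<Longrightarrow> y \<in> K \<Longrightarrow> x + y \<in> K"
  "x \<in> K \<Longrightarrow> y \<in> K \<Longrightarrow> x - y \<in> K"
  "x \<in> K \<Longrightarrow> y \<in> K \<Longrightarrow> x * y \<in> K"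
  "x \<in> K \<Longrightarrow> - x \<in> K"
  "x \<in> K \<Longrightarrow> cnj x \<in> K"
  "x \<in> K \<Longrightarrow> x / complex_of_real r \<in> K"
  "complex_of_real r \<in> K" "0 \<in> K" "1 \<in> K"
  using K by (auto simp: Reals_cnj_iff)

lemma K_sum [intro]: "(\<And>k. k \<in> A \<Longrightarrow> f k \<in> K) \<Longrightarrow> sum f A \<in> K"
  by (induction A rule: infinite_finite_induct) auto

lemma K_limit:
  assumes "\<And>k. f k \<in> K" "f \<longlonglongrightarrow> x"
  shows "x \<in> K"
proof (cases "K = \<real>")
  case True
  have "(\<lambda>k. Im (f k)) \<longlonglongrightarrow> Im x" by (intro tendsto_intros assms(2))
  moreover have "(\<lambda>k. Im (f k)) = (\<lambda>k. 0)" using assms(1) True by (auto simp: complex_is_Real_iff)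
  ultimately have "Im x = 0" by (simp add: LIMSEQ_const_iff)
  then show ?thesis using True by (simp add: complex_is_Real_iff)
qed (use K in auto)

lemma mats_mult: "A \<in> mats K p q \<Longrightarrow> B \<in> mats K q r \<Longrightarrow> A * B \<in> mats K p r"
  by (rule matsI) (auto simp: mats_dim mats_entry mult_entry)

lemma mats_adjoint: "A \<in> mats K p q \<Longrightarrow> adj A \<in> mats K q p"
  by (rule matsI) (auto simp: mats_dim mats_entry)

lemma mats_add: "A \<in> mats K p q \<Longrightarrow> B \<in> mats K p q \<Longrightarrow> A + B \<in> mats K p q"
  by (rule matsI) (auto simp: mats_dim mats_entry)

lemma mats_minus: "A \<in> mats K p q \<Longrightarrow> B \<in> mats K p q \<Longrightarrow> A - B \<in> mats K p q"
  by (rule matsI) (auto simp: mats_dim mats_entry)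

lemma mats_smult: "A \<in> mats K p q \<Longrightarrow> of_real t \<cdot>\<^sub>m A \<in> mats K p q"
  by (rule matsI) (auto simp: mats_dim mats_entry)

lemma mats_rect_diag: "rect_diag p q x \<in> mats K p q"
  by (rule matsI) auto

lemma unitaries_adjoint: "P \<in> unitaries K p \<Longrightarrow> adj P \<in> unitaries K p"
  using unitaries_right[of P K p] mats_adjoint[OF unitaries_mats, of P p]
  by (simp add: unitaries_def)

lemma unitaries_mult:
  assumes "P \<in> unitaries K p" "Q \<in> unitaries K p"
  shows "P * Q \<in> unitaries K p"
proof -
  have "adj (P * Q) * (P * Q) = 1\<^sub>m p"
    using assms by (simp add: mat_adjoint_mult mult_assoc_dim unitaries_simps)
  then show ?thesis
    using assms by (auto simp: unitaries_def intro: mats_mult)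
qed

lemmas mats_intros = mats_mult mats_adjoint mats_add mats_minus mats_smult mats_rect_diag unitaries_mats

end

lemma inprod_mat_diff:
  assumes "X \<in> mats K p q" "Y \<in> mats K p q"
  shows "Re (mat_trace (adj (X - Y) * (X - Y)))
    = (\<Sum>ij\<in>{..<p} \<times> {..<q}. (norm (X $$ ij - Y $$ ij))\<^sup>2)"
proof -
  have "mat_trace (adj (X - Y) * (X - Y))
     = (\<Sum>j<q. \<Sum>i<p. cnj (X $$ (i, j) - Y $$ (i, j)) * (X $$ (i, j) - Y $$ (i, j)))"
    using assms unfolding mat_trace_def
    by (simp add: mats_dim mult_entry minus_mat_def)
  also have "\<dots> = (\<Sum>j<q. \<Sum>i<p. of_real ((norm (X $$ (i, j) - Y $$ (i, j)))\<^sup>2))"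
    by (simp only: complex_norm_square mult.commute)
  finally have "Re (mat_trace (adj (X - Y) * (X - Y))) = (\<Sum>j<q. \<Sum>i<p. (norm (X $$ (i, j) - Y $$ (i, j)))\<^sup>2)"
    by (simp only: Re_sum Re_complex_of_real)
  also have "\<dots> = (\<Sum>i<p. \<Sum>j<q. (norm (X $$ (i, j) - Y $$ (i, j)))\<^sup>2)"
    by (rule sum.swap)
  also have "\<dots> = (\<Sum>ij\<in>{..<p} \<times> {..<q}. (norm (X $$ ij - Y $$ ij))\<^sup>2)"
    by (simp add: sum.cartesian_product split_def)
  finally show ?thesis .
qed

global_interpretation mat_space: coord_space "mat_eucl K p q" "{..<p} \<times> {..<q}" "\<lambda>A ij. A $$ ij"
  for K p q
proof
  fix X Y assume "X \<in> points (mat_eucl K p q)" "Y \<in> points (mat_eucl K p q)"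
  then have XY: "X \<in> mats K p q" "Y \<in> mats K p q" by (auto simp: mat_eucl_def)
  show "inprod (mat_eucl K p q) (X - Y) (X - Y) = (\<Sum>k\<in>{..<p} \<times> {..<q}. (norm (X $$ k - Y $$ k))\<^sup>2)"
    using inprod_mat_diff[OF XY] by (simp add: mat_eucl_def)
  show "X = Y" if "\<And>k. k \<in> {..<p} \<times> {..<q} \<Longrightarrow> X $$ k = Y $$ k"
    using XY that by (intro eq_matI) (auto simp: mats_dim)
qed auto

global_interpretation vec_space: coord_space "vec_eucl p" "{..<p}" vec_index for p
proof
  fix x y assume "x \<in> points (vec_eucl p)" "y \<in> points (vec_eucl p)"
  then have xy: "x \<in> carrier_vec p" "y \<in> carrier_vec p" by (auto simp: vec_eucl_def)
  show "inprod (vec_eucl p) (x - y) (x - y) = (\<Sum>k\<in>{..<p}. (norm (x $ k - y $ k))\<^sup>2)"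
    using xy by (simp add: vec_eucl_def scalar_prod_def lessThan_atLeast0 power2_eq_square)
  show "x = y" if "\<And>k. k \<in> {..<p} \<Longrightarrow> x $ k = y $ k"
    using xy that by (intro eq_vecI) auto
qed auto

lemma mat_eucl_simps [simp]:
  "points (mat_eucl K p q) = mats K p q" "scl (mat_eucl K p q) t A = of_real t \<cdot>\<^sub>m A"
  by (simp_all add: mat_eucl_def)

lemma vec_eucl_simps [simp]:
  "points (vec_eucl p) = carrier_vec p" "scl (vec_eucl p) t x = t \<cdot>\<^sub>v x"
  by (simp_all add: vec_eucl_def)

no_notation Finite_Cartesian_Product.vec.vec_nth (infixl \<open>$\<close> 90)

section \<open>Eigenvalues and singular values of diagonalised matrices\<close>

definition nonincreasing :: "real vec \<Rightarrow> bool" where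
  "nonincreasing x \<longleftrightarrow> (\<forall>i j. i \<le> j \<longrightarrow> j < dim_vec x \<longrightarrow> x $ j \<le> x $ i)"

text \<open>The characteristic polynomial is invariant under similarity, and that of a diagonal matrix has the
  diagonal as its multiset of roots.\<close>

lemma eig_vals_diagonalized:
  assumes P: "P \<in> unitaries K p" and x: "dim_vec x = p"
  shows "eig_vals (P * rect_diag p p x * adj P) = vec_of_list (rev (sort (list_of_vec x)))"
proof -
  let ?D = "rect_diag p p x"
  have "similar_mat (P * ?D * adj P) ?D"
    using P by (intro similar_matI[of _ _ P "adj P" p]) (auto simp: unitaries_simps)
  then have "char_poly (P * ?D * adj P) = char_poly ?D" by (rule char_poly_similar)
  also have "\<dots> = (\<Prod>a\<leftarrow>diag_mat ?D. [:- a, 1:])"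
    by (rule char_poly_upper_triangular[of _ p]) auto
  finally have "proots (char_poly (P * ?D * adj P)) = proots (\<Prod>a\<leftarrow>diag_mat ?D. [:- a, 1:])"
    by simp
  also have "\<dots> = (\<Sum>q\<leftarrow>map (\<lambda>a. [:- a, 1:]) (diag_mat ?D). proots q)"
  proof -
    have "0 \<notin> set (map (\<lambda>a. [:- a, 1:]) (diag_mat ?D))" by auto
    from proots_prod_list[OF this] show ?thesis by simp
  qed
  also have "\<dots> = mset (diag_mat ?D)"
  proof -
    have "(\<Sum>q\<leftarrow>map (\<lambda>a. [:- a, 1:]) as. proots q) = mset as" for as :: "complex list"
      by (induction as) auto
    then show ?thesis .
  qed
  also have "diag_mat ?D = map complex_of_real (list_of_vec x)"
    by (rule nth_equalityI) (auto simp: diag_mat_def x list_of_vec_index)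
  finally have "image_mset Re (proots (char_poly (P * ?D * adj P))) = mset (list_of_vec x)"
    by (simp add: multiset.map_comp o_def)
  then show ?thesis by (simp add: eig_vals_def sorted_list_of_multiset_mset)
qed

lemma sort_nonincreasing:
  assumes "nonincreasing x"
  shows "vec_of_list (rev (sort (list_of_vec x))) = x"
proof -
  have "sorted (rev (list_of_vec x))"
    using assms unfolding nonincreasing_def
    by (auto simp: sorted_iff_nth_mono rev_nth list_of_vec_index)
  then have "sort (list_of_vec x) = rev (list_of_vec x)"
    by (intro properties_for_sort) auto
  then show ?thesis by (simp add: vec_list)
qed

lemma eig_vals_nonincreasing:
  assumes "P \<in> unitaries K p" "dim_vec x = p" "nonincreasing x"
  shows "eig_vals (P * rect_diag p p x * adj P) = x"
  using eig_vals_diagonalized[OF assms(1,2)] sort_nonincreasing[OF assms(3)] by simp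

lemma gram_rect_diag:
  fixes x :: "real vec"
  assumes U: "U \<in> unitaries K p" and V: "V \<in> unitaries K q" and pq: "p \<le> q"
  defines "Z \<equiv> U * rect_diag p q x * adj V"
  shows "Z * adj Z = U * rect_diag p p (vec p (\<lambda>i. (x $ i)\<^sup>2)) * adj U"
proof -
  have "rect_diag p q x * rect_diag q p x = rect_diag p p (vec p (\<lambda>i. (x $ i)\<^sup>2))"
    using pq by (intro eq_matI) (auto simp: mult_rect_diag_entry power2_eq_square)
  then have "rect_diag p q x * (rect_diag q p x * adj U) = rect_diag p p (vec p (\<lambda>i. (x $ i)\<^sup>2)) * adj U"
    using U by (subst mult_assoc_dim[symmetric]) (auto simp: unitaries_dim)
  then show ?thesis
    using U V by (simp add: Z_def mat_adjoint_mult mult_assoc_dim unitaries_simps)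
qed

text \<open>The diagonal \<open>x\<close> may be negative and unordered: the eigenvalues of \<open>Z Z\<^sup>*\<close> are the squares of
  its entries, sorted. The permutation is needed because absolute symmetry of \<open>g\<close> speaks of
  rearrangements and not of multisets.\<close>

lemma sing_vals_rearrangement:
  fixes x :: "real vec"
  assumes U: "U \<in> unitaries K p" and V: "V \<in> unitaries K q" and pq: "p \<le> q" and x: "dim_vec x = p"
  defines "s \<equiv> sing_vals (U * rect_diag p q x * adj V)"
  obtains \<pi> where "\<pi> permutes {..<p}" "\<And>i. i < p \<Longrightarrow> s $ i = \<bar>x $ \<pi> i\<bar>"
    "dim_vec s = p" "nonincreasing s"
proof -
  let ?y = "vec p (\<lambda>i. (x $ i)\<^sup>2)"
  let ?l = "rev (sort (list_of_vec ?y))"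
  have s: "s = map_vec sqrt (vec_of_list ?l)"
    unfolding s_def sing_vals_def gram_rect_diag[OF U V pq] by (simp add: eig_vals_diagonalized[OF U])
  have "mset ?l = mset (list_of_vec ?y)" by simp
  then obtain \<pi> where \<pi>: "\<pi> permutes {..<length (list_of_vec ?y)}" "permute_list \<pi> (list_of_vec ?y) = ?l"
    by (metis mset_eq_permutation)
  have perm: "\<pi> permutes {..<p}" using \<pi>(1) by simp
  have len: "length ?l = p" by simp
  have si: "s $ i = \<bar>x $ \<pi> i\<bar>" if "i < p" for i
  proof -
    have "\<pi> i < p" using perm that by (metis lessThan_iff permutes_in_image)
    moreover have "?l ! i = list_of_vec ?y ! \<pi> i"
      unfolding \<pi>(2)[symmetric] using that \<pi>(1) by (intro permute_list_nth) auto
    ultimately have "vec_of_list ?l $ i = (x $ \<pi> i)\<^sup>2"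
      by (simp add: vec_of_list_index list_of_vec_index)
    then show ?thesis using that len by (simp add: s)
  qed
  have "nonincreasing s"
    unfolding nonincreasing_def s
    by (auto simp: vec_of_list_index rev_nth intro!: sorted_nth_mono)
  moreover have "dim_vec s = p" by (simp add: s)
  ultimately show thesis using that perm si by blast
qed

lemma sing_vals_nonincreasing:
  assumes U: "U \<in> unitaries K p" and V: "V \<in> unitaries K q" and pq: "p \<le> q"
    and x: "dim_vec x = p" "nonincreasing x" "\<And>i. i < p \<Longrightarrow> x $ i \<ge> 0"
  shows "sing_vals (U * rect_diag p q x * adj V) = x"
proof -
  have "nonincreasing (vec p (\<lambda>i. (x $ i)\<^sup>2))"
    using x by (auto simp: nonincreasing_def intro!: power_mono)
  then have "eig_vals (U * rect_diag p p (vec p (\<lambda>i. (x $ i)\<^sup>2)) * adj U) = vec p (\<lambda>i. (x $ i)\<^sup>2)"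
    by (intro eig_vals_nonincreasing[OF U]) auto
  then show ?thesis
    unfolding sing_vals_def gram_rect_diag[OF U V pq] using x by (intro eq_vecI) auto
qed

section \<open>Intertwining diagonal matrices\<close>

text \<open>With \<open>A = P'\<^sup>* P\<close> the hypothesis reads \<open>A\<^sub>i\<^sub>j x\<^sub>j = z\<^sub>i A\<^sub>i\<^sub>j\<close>, so \<open>A\<^sub>i\<^sub>j = 0\<close> unless \<open>x\<^sub>j = z\<^sub>i\<close>, and any
  other pair of diagonals that agrees at these places is intertwined as well.\<close>

lemma diag_intertwine:
  assumes P: "P \<in> unitaries K p" and P': "P' \<in> unitaries K p"
    and eq: "P * rect_diag p p x * adj P = P' * rect_diag p p z * adj P'"
    and yw: "\<And>i j. i < p \<Longrightarrow> j < p \<Longrightarrow> x $ j = z $ i \<Longrightarrow> y $ j = w $ i"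
  shows "P * rect_diag p p y * adj P = P' * rect_diag p p w * adj P'"
proof -
  define A where "A = adj P' * P"
  have dA: "dim_row A = p" "dim_col A = p" using P P' by (auto simp: A_def unitaries_dim)
  have "adj P' * (P * rect_diag p p x * adj P) * P
      = adj P' * (P' * rect_diag p p z * adj P') * P" by (simp add: eq)
  then have 1: "A * rect_diag p p x = rect_diag p p z * A"
    using P P' by (simp add: A_def mult_assoc_dim unitaries_simps)
  have "A * rect_diag p p y = rect_diag p p w * A"
  proof (rule eq_matI)
    fix i j assume "i < dim_row (rect_diag p p w * A)" "j < dim_col (rect_diag p p w * A)"
    then have ij: "i < p" "j < p" by (auto simp: dA)
    have "A $$ (i, j) * of_real (x $ j) = of_real (z $ i) * A $$ (i, j)"
      using arg_cong[OF 1, of "\<lambda>M. M $$ (i, j)"] ij dA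
      by (simp add: rect_diag_entries)
    then have "A $$ (i, j) = 0 \<or> x $ j = z $ i" by auto
    then show "(A * rect_diag p p y) $$ (i, j) = (rect_diag p p w * A) $$ (i, j)"
      using yw ij dA
      by (auto simp: rect_diag_entries)
  qed (auto simp: dA)
  then have "P' * (A * rect_diag p p y) * adj P = P' * (rect_diag p p w * A) * adj P"
    by simp
  then show ?thesis
    using P P' by (simp add: A_def mult_assoc_dim unitaries_simps)
qed

text \<open>The hypotheses say \<open>(a + b)(x - z) = 0\<close> and \<open>(a - b)(x + z) = 0\<close>; the conclusion is half the sum of
  the same two equations for \<open>y, w\<close>.\<close>

lemma intertwine_scalars:
  fixes a b :: complex and x z y w :: real
  assumes "a * x = z * b" "b * x = z * a" "x = z \<Longrightarrow> y = w" "x = - z \<Longrightarrow> y = - w"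
  shows "a * y = w * b"
proof -
  have "(a + b) * complex_of_real (x - z) = 0" "(a - b) * complex_of_real (x + z) = 0"
    using assms(1,2) by (simp_all add: algebra_simps)
  then have "a + b = 0 \<or> x - z = 0" "a - b = 0 \<or> x + z = 0"
    unfolding mult_eq_0_iff of_real_eq_0_iff by simp_all
  then have "a + b = 0 \<or> y - w = 0" "a - b = 0 \<or> y + w = 0"
    using assms(3,4) by (auto simp: eq_neg_iff_add_eq_0)
  then have "(a + b) * complex_of_real (y - w) = 0" "(a - b) * complex_of_real (y + w) = 0"
    unfolding mult_eq_0_iff of_real_eq_0_iff by simp_all
  then have "(a + b) * complex_of_real (y - w) + (a - b) * complex_of_real (y + w) = 0"
    by (simp only: add_0)
  then have "2 * (a * complex_of_real y) = 2 * (complex_of_real w * b)" by (simp add: algebra_simps)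
  then show ?thesis by simp
qed

text \<open>The rectangular analogue has two intertwiners \<open>A = U'\<^sup>* U\<close> and \<open>B = V'\<^sup>* V\<close>. Taking adjoints gives a second
  relation between them, and for each entry the two relations are those of \<open>intertwine_scalars\<close>. The sign case and the
  zero case reflect that singular values see only absolute values, and that rows of \<open>B\<close> may leak into
  the last \<open>q - p\<close> columns where \<open>z\<close> vanishes.\<close>

lemma rect_diag_intertwine:
  assumes U: "U \<in> unitaries K p" and U': "U' \<in> unitaries K p"
    and V: "V \<in> unitaries K q" and V': "V' \<in> unitaries K q" and pq: "p \<le> q"
    and eq: "U * rect_diag p q x * adj V = U' * rect_diag p q z * adj V'"
    and yw: "\<And>i j. i < p \<Longrightarrow> j < p \<Longrightarrow> x $ j = z $ i \<Longrightarrow> y $ j = w $ i"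
      "\<And>i j. i < p \<Longrightarrow> j < p \<Longrightarrow> x $ j = - z $ i \<Longrightarrow> y $ j = - w $ i"
      "\<And>i. i < p \<Longrightarrow> z $ i = 0 \<Longrightarrow> w $ i = 0"
  shows "U * rect_diag p q y * adj V = U' * rect_diag p q w * adj V'"
proof -
  define A where "A = adj U' * U"
  define B where "B = adj V' * V"
  have dA: "dim_row A = p" "dim_col A = p" "dim_row B = q" "dim_col B = q"
    using U U' V V' by (auto simp: A_def B_def unitaries_dim)
  have "adj U' * (U * rect_diag p q x * adj V) * V
      = adj U' * (U' * rect_diag p q z * adj V') * V" by (simp add: eq)
  then have 1: "A * rect_diag p q x = rect_diag p q z * B"
    using U U' V V' by (simp add: A_def B_def mult_assoc_dim unitaries_simps)
  have "adj V' * adj (U * rect_diag p q x * adj V) * U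
      = adj V' * adj (U' * rect_diag p q z * adj V') * U" by (simp add: eq)
  then have 2: "B * rect_diag q p x = rect_diag q p z * A"
    using U U' V V' by (simp add: A_def B_def mat_adjoint_mult mult_assoc_dim unitaries_simps)
  have "A * rect_diag p q y = rect_diag p q w * B"
  proof (rule eq_matI)
    fix i j assume "i < dim_row (rect_diag p q w * B)" "j < dim_col (rect_diag p q w * B)"
    then have ij: "i < p" "j < q" by (auto simp: dA)
    have e1: "(if j < p then A $$ (i, j) * of_real (x $ j) else 0) = of_real (z $ i) * B $$ (i, j)"
      using arg_cong[OF 1, of "\<lambda>M. M $$ (i, j)"] ij dA pq
      by (simp add: rect_diag_entries)
    show "(A * rect_diag p q y) $$ (i, j) = (rect_diag p q w * B) $$ (i, j)"
    proof (cases "j < p")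
      case True
      have e2: "B $$ (i, j) * of_real (x $ j) = of_real (z $ i) * A $$ (i, j)"
        using arg_cong[OF 2, of "\<lambda>M. M $$ (i, j)"] ij dA pq True
        by (simp add: rect_diag_entries)
      have "A $$ (i, j) * of_real (y $ j) = of_real (w $ i) * B $$ (i, j)"
        by (rule intertwine_scalars[OF e1[simplified True if_True] e2 yw(1,2)[OF ij(1) True]])
      then show ?thesis
        using True ij dA pq
        by (simp add: rect_diag_entries)
    next
      case False
      then have "z $ i = 0 \<or> B $$ (i, j) = 0" using e1 by auto
      then show ?thesis
        using False ij dA pq yw(3)
        by (auto simp: rect_diag_entries)
    qed
  qed (auto simp: dA)
  then have "U' * (A * rect_diag p q y) * adj V = U' * (rect_diag p q w * B) * adj V"
    by simp
  then show ?thesis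
    using U U' V V' by (simp add: A_def B_def mult_assoc_dim unitaries_simps)
qed

section \<open>Absolutely symmetric functions\<close>

lemma abs_symmetric_rearrange:
  assumes g: "abs_symmetric_on m D g" "x \<in> D" and x: "dim_vec x = m" and gx: "dim_vec (g x) = m"
    and \<pi>: "\<pi> permutes {..<m}" and e: "\<And>i. e i \<in> {1, - 1}"
  shows "g (vec m (\<lambda>i. e i * x $ \<pi> i)) = vec m (\<lambda>i. e i * g x $ \<pi> i)"
proof -
  define Q where "Q = mat m m (\<lambda>(i, j). if j = \<pi> i then e i else 0 :: real)"
  have \<pi>_lt: "\<pi> i < m" if "i < m" for i using \<pi> that by (metis lessThan_iff permutes_in_image)
  have Qy: "Q *\<^sub>v y = vec m (\<lambda>i. e i * y $ \<pi> i)" if "dim_vec y = m" for y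
  proof (rule eq_vecI)
    fix i assume "i < dim_vec (vec m (\<lambda>i. e i * y $ \<pi> i))"
    then have i: "i < m" by simp
    have "(Q *\<^sub>v y) $ i = (\<Sum>j<m. if j = \<pi> i then e i * y $ \<pi> i else 0)"
    proof -
      have "(Q *\<^sub>v y) $ i = (\<Sum>j<m. Q $$ (i, j) * y $ j)"
        using i that by (simp add: Q_def scalar_prod_def lessThan_atLeast0)
      also have "\<dots> = (\<Sum>j<m. if j = \<pi> i then e i * y $ \<pi> i else 0)"
        using i by (intro sum.cong) (auto simp: Q_def)
      finally show ?thesis .
    qed
    then show "(Q *\<^sub>v y) $ i = vec m (\<lambda>i. e i * y $ \<pi> i) $ i"
      using i \<pi>_lt by simp
  qed (simp add: Q_def)
  have e0: "e i \<noteq> 0" for i using e[of i] by auto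
  have "signed_perm_mat m Q"
    unfolding signed_perm_mat_def
  proof (intro conjI allI impI)
    show "Q \<in> carrier_mat m m" by (simp add: Q_def)
    show "elements_mat Q \<subseteq> {-1, 0, 1}"
      using e by (auto simp: Q_def elements_mat_def)
    show "\<exists>!j. j < m \<and> Q $$ (i, j) \<noteq> 0" if "i < m" for i
      using that \<pi>_lt e0 by (intro ex1I[of _ "\<pi> i"]) (auto simp: Q_def split: if_splits)
    show "\<exists>!i. i < m \<and> Q $$ (i, j) \<noteq> 0" if "j < m" for j
    proof (intro ex1I[of _ "inv_into UNIV \<pi> j"])
      have "inv_into UNIV \<pi> j < m" using \<pi> that by (metis lessThan_iff permutes_in_image permutes_inv)
      then show "inv_into UNIV \<pi> j < m \<and> Q $$ (inv_into UNIV \<pi> j, j) \<noteq> 0"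
        using that e0 permutes_inverses[OF \<pi>] by (auto simp: Q_def)
      show "i = inv_into UNIV \<pi> j" if "i < m \<and> Q $$ (i, j) \<noteq> 0" for i
        using that \<open>j < m\<close> permutes_inverses[OF \<pi>] by (auto simp: Q_def split: if_splits)
    qed
  qed
  then have "g (Q *\<^sub>v x) = Q *\<^sub>v g x" using g by (auto simp: abs_symmetric_on_def)
  then show ?thesis by (simp add: Qy x gx)
qed

text \<open>If \<open>x\<^sub>j = c x\<^sub>i\<close> with \<open>c = \<plusminus>1\<close>, then exchanging \<open>i\<close> and \<open>j\<close> and multiplying both entries by \<open>c\<close> fixes \<open>x\<close>.
  For \<open>i = j\<close> and \<open>c = - 1\<close> this is the fact that \<open>g\<close> preserves zeros.\<close>

lemma abs_symmetric_entries:
  assumes g: "abs_symmetric_on m D g" "x \<in> D" and x: "dim_vec x = m" and gx: "dim_vec (g x) = m"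
    and ij: "i < m" "j < m" and c: "c \<in> {1, - 1}" "x $ j = c * x $ i"
  shows "g x $ j = c * g x $ i"
proof -
  define \<pi> where "\<pi> = Transposition.transpose i j"
  define e where "e k = (if k = i \<or> k = j then c else 1 :: real)" for k
  have \<pi>: "\<pi> permutes {..<m}" unfolding \<pi>_def using ij by (intro permutes_swap_id) auto
  have "vec m (\<lambda>k. e k * x $ \<pi> k) = x"
    using x c by (intro eq_vecI) (auto simp: e_def \<pi>_def Transposition.transpose_def)
  moreover have "g (vec m (\<lambda>k. e k * x $ \<pi> k)) = vec m (\<lambda>k. e k * g x $ \<pi> k)"
    by (rule abs_symmetric_rearrange[OF g x gx \<pi>]) (use c in \<open>auto simp: e_def\<close>)
  ultimately have "g x = vec m (\<lambda>k. e k * g x $ \<pi> k)" by simp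
  then have "g x $ j = vec m (\<lambda>k. e k * g x $ \<pi> k) $ j" by simp
  also have "\<dots> = c * g x $ i" using ij by (simp add: e_def \<pi>_def)
  finally show ?thesis .
qed

section \<open>Compactness of the unitary group\<close>

lemma common_convergent_subsequence:
  fixes f :: "'k \<Rightarrow> nat \<Rightarrow> complex"
  assumes "finite I" "\<And>i. i \<in> I \<Longrightarrow> bounded (range (f i))"
  shows "\<exists>r. strict_mono r \<and> (\<forall>i\<in>I. convergent (\<lambda>k. f i (r k)))"
  using assms
proof (induction I rule: finite_induct)
  case empty
  show ?case by (intro exI[of _ id]) (simp add: strict_mono_def)
next
  case (insert a I)
  then obtain r where r: "strict_mono r" "\<And>i. i \<in> I \<Longrightarrow> convergent (\<lambda>k. f i (r k))" by auto
  have "bounded (range (f a \<circ> r))"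
    by (rule bounded_subset[OF insert.prems[of a]]) auto
  then obtain l r' where r': "strict_mono r'" "((f a \<circ> r) \<circ> r') \<longlonglongrightarrow> l"
    using bounded_imp_convergent_subsequence by blast
  have "convergent (\<lambda>k. f i ((r \<circ> r') k))" if "i \<in> insert a I" for i
  proof (cases "i = a")
    case True
    then show ?thesis using r'(2) by (auto simp: convergent_def o_def)
  next
    case False
    then have "convergent ((\<lambda>k. f i (r k)) \<circ> r')"
      using that r r' by (intro convergent_subseq_convergent) auto
    then show ?thesis by (simp add: o_def)
  qed
  then show ?case using r(1) r'(1) strict_mono_o by blast
qed

text \<open>The dimensions are demanded at every index, so that they need not be carried along as eventual facts.\<close>

definition entries_tendsto :: "(nat \<Rightarrow> complex mat) \<Rightarrow> complex mat \<Rightarrow> bool" where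
  "entries_tendsto F A \<longleftrightarrow> (\<forall>k. dim_row (F k) = dim_row A \<and> dim_col (F k) = dim_col A) \<and>
     (\<forall>i<dim_row A. \<forall>j<dim_col A. (\<lambda>k. F k $$ (i, j)) \<longlonglongrightarrow> A $$ (i, j))"

lemma entries_tendstoD:
  "entries_tendsto F A \<Longrightarrow> i < dim_row A \<Longrightarrow> j < dim_col A \<Longrightarrow> (\<lambda>k. F k $$ (i, j)) \<longlonglongrightarrow> A $$ (i, j)"
  by (simp add: entries_tendsto_def)

lemma entries_tendsto_dim:
  "entries_tendsto F A \<Longrightarrow> dim_row (F k) = dim_row A" "entries_tendsto F A \<Longrightarrow> dim_col (F k) = dim_col A"
  by (simp_all add: entries_tendsto_def)

lemma entries_tendsto_const: "entries_tendsto (\<lambda>k. A) A"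
  by (simp add: entries_tendsto_def)

lemma entries_tendsto_mult:
  assumes "entries_tendsto F A" "entries_tendsto G B" "dim_col A = dim_row B"
  shows "entries_tendsto (\<lambda>k. F k * G k) (A * B)"
  unfolding entries_tendsto_def
proof (intro conjI allI impI)
  fix i j assume "i < dim_row (A * B)" "j < dim_col (A * B)"
  then have ij: "i < dim_row A" "j < dim_col B" by auto
  have "(\<lambda>k. \<Sum>l<dim_col A. F k $$ (i, l) * G k $$ (l, j)) \<longlonglongrightarrow> (\<Sum>l<dim_col A. A $$ (i, l) * B $$ (l, j))"
    using assms ij by (intro tendsto_intros entries_tendstoD) auto
  then show "(\<lambda>k. (F k * G k) $$ (i, j)) \<longlonglongrightarrow> (A * B) $$ (i, j)"
    using ij assms by (simp add: mult_entry entries_tendsto_dim[OF assms(1)] entries_tendsto_dim[OF assms(2)])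
qed (auto simp: entries_tendsto_dim[OF assms(1)] entries_tendsto_dim[OF assms(2)])

lemma entries_tendsto_adjoint:
  "entries_tendsto F A \<Longrightarrow> entries_tendsto (\<lambda>k. adj (F k)) (adj A)"
  by (auto simp: entries_tendsto_def intro!: tendsto_intros)

lemma entries_tendsto_subseq:
  "entries_tendsto F A \<Longrightarrow> strict_mono r \<Longrightarrow> entries_tendsto (\<lambda>k. F (r k)) A"
  by (auto simp: entries_tendsto_def intro: LIMSEQ_subseq_LIMSEQ[unfolded o_def])

lemma entries_tendsto_unique:
  assumes "entries_tendsto F A" "entries_tendsto F B"
  shows "A = B"
proof (rule eq_matI)
  show d: "dim_row A = dim_row B" "dim_col A = dim_col B"
    using assms by (auto simp: entries_tendsto_def)
  show "A $$ (i, j) = B $$ (i, j)" if "i < dim_row B" "j < dim_col B" for i j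
    using entries_tendstoD[OF assms(1), of i j] entries_tendstoD[OF assms(2), of i j] that d
    by (intro LIMSEQ_unique) auto
qed

context base_field begin

lemma mats_limit:
  assumes "\<And>k. F k \<in> mats K p q" "entries_tendsto F A"
  shows "A \<in> mats K p q"
proof (rule matsI)
  show d: "dim_row A = p" "dim_col A = q"
    using assms mats_dim by (metis entries_tendsto_dim)+
  fix i j assume ij: "i < p" "j < q"
  then have "(\<lambda>k. F k $$ (i, j)) \<longlonglongrightarrow> A $$ (i, j)"
    using assms(2) d by (simp add: entries_tendstoD)
  then show "A $$ (i, j) \<in> K"
    by (rule K_limit[OF mats_entry[OF assms(1) ij]])
qed

lemma unitaries_subsequence:
  fixes Us :: "nat \<Rightarrow> complex mat"
  assumes "\<And>k. Us k \<in> unitaries K p"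
  obtains r U where "strict_mono r" "U \<in> unitaries K p" "entries_tendsto (\<lambda>k. Us (r k)) U"
proof -
  have "\<exists>r. strict_mono r \<and> (\<forall>ij\<in>{..<p} \<times> {..<p}. convergent (\<lambda>k. Us (r k) $$ ij))"
    by (rule common_convergent_subsequence[where f = "\<lambda>ij k. Us k $$ ij"])
      (auto intro!: boundedI[of _ 1] unitaries_entry_le_1[OF assms])
  then obtain r where r: "strict_mono r" "\<And>i j. i < p \<Longrightarrow> j < p \<Longrightarrow> convergent (\<lambda>k. Us (r k) $$ (i, j))"
    by auto
  define U where "U = mat p p (\<lambda>ij. lim (\<lambda>k. Us (r k) $$ ij))"
  have lim: "entries_tendsto (\<lambda>k. Us (r k)) U"
    using r(2) unitaries_dim[OF assms]
    by (auto simp: entries_tendsto_def U_def convergent_LIMSEQ_iff)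
  have "entries_tendsto (\<lambda>k. adj (Us (r k)) * Us (r k)) (adj U * U)"
    by (intro entries_tendsto_mult entries_tendsto_adjoint lim) (simp add: U_def)
  then have "adj U * U = 1\<^sub>m p"
    using entries_tendsto_unique[OF _ entries_tendsto_const] by (simp add: unitaries_left[OF assms])
  moreover have "U \<in> mats K p p" by (rule mats_limit[OF unitaries_mats[OF assms] lim])
  ultimately have "U \<in> unitaries K p" by (simp add: unitaries_def)
  then show thesis using r lim that by blast
qed

end

section \<open>Existence of singular value decompositions\<close>

text \<open>For \<open>K = \<real>\<close> the factors have to be real, so eigenvectors of the complex theory do not suffice. A variational
  argument is uniform in \<open>K\<close>: the functional \<open>\<Sum> c\<^sub>i Re((U\<^sup>* Z V)\<^sub>i\<^sub>i)\<close> with weights \<open>c\<^sub>1 > c\<^sub>2 > \<dots> > 0\<close> is maximised over the compact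
  set of unitary pairs. At a maximiser, rotations in coordinate planes force \<open>M C\<close> and \<open>C M\<close> to be
  Hermitian, where \<open>M = U\<^sup>* Z V\<close> and \<open>C\<close> is the diagonal matrix of weights; as the weights are distinct, \<open>M\<close> is
  diagonal, and comparison with phase changes shows that the diagonal is real and nonnegative.\<close>

definition plane_rotation :: "nat \<Rightarrow> nat \<Rightarrow> nat \<Rightarrow> real \<Rightarrow> complex \<Rightarrow> complex mat" where
  "plane_rotation p i j \<alpha> \<beta> = mat p p (\<lambda>(r, c).
     if r = i then (if c = i then complex_of_real \<alpha> else if c = j then \<beta> else 0)
     else if r = j then (if c = i then - cnj \<beta> else if c = j then complex_of_real \<alpha> else 0)
     else if r = c then 1 else 0)"

definition phase_change :: "nat \<Rightarrow> nat \<Rightarrow> complex \<Rightarrow> complex mat" where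
  "phase_change p i \<omega> = mat p p (\<lambda>(r, c). if r = c then (if r = i then \<omega> else 1) else 0)"

lemma sum_split_pair:
  fixes f :: "nat \<Rightarrow> 'a :: comm_monoid_add"
  assumes "i < p" "j < p" "i \<noteq> j"
  shows "(\<Sum>k<p. f k) = f i + f j + (\<Sum>k\<in>{..<p} - {i, j}. f k)"
proof -
  have "(\<Sum>k<p. f k) = f i + (\<Sum>k\<in>{..<p} - {i}. f k)"
    using assms by (intro sum.remove) auto
  also have "(\<Sum>k\<in>{..<p} - {i}. f k) = f j + (\<Sum>k\<in>{..<p} - {i} - {j}. f k)"
    using assms by (intro sum.remove) auto
  also have "{..<p} - {i} - {j} = {..<p} - {i, j}" by auto
  finally show ?thesis by (simp add: add.assoc)
qed

context base_field begin

lemma plane_rotation_unitary: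
  assumes ij: "i < p" "j < p" "i \<noteq> j" and ab: "\<alpha>\<^sup>2 + (cmod \<beta>)\<^sup>2 = 1" "\<beta> \<in> K"
  shows "plane_rotation p i j \<alpha> \<beta> \<in> unitaries K p"
proof (rule unitariesI)
  show "plane_rotation p i j \<alpha> \<beta> \<in> mats K p p"
    by (rule matsI) (use ab(2) in \<open>auto simp: plane_rotation_def\<close>)
  have one: "complex_of_real \<alpha> * complex_of_real \<alpha> + \<beta> * cnj \<beta> = 1"
    using arg_cong[OF ab(1), of complex_of_real]
    by (simp only: of_real_add complex_norm_square power2_eq_square of_real_mult of_real_1)
      (simp add: complex_norm_square[symmetric] power2_eq_square)
  fix r c assume rc: "r < p" "c < p"
  have "(\<Sum>k\<in>{..<p} - {i, j}. cnj (plane_rotation p i j \<alpha> \<beta> $$ (k, r)) * plane_rotation p i j \<alpha> \<beta> $$ (k, c))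
      = (\<Sum>k\<in>{..<p} - {i, j}. if k = r then (if r = c then 1 else 0) else 0)"
    using rc by (intro sum.cong) (auto simp: plane_rotation_def)
  also have "\<dots> = (if r = c \<and> r \<noteq> i \<and> r \<noteq> j then 1 else 0)"
    using rc by (auto simp: sum.delta)
  finally show "(\<Sum>k<p. cnj (plane_rotation p i j \<alpha> \<beta> $$ (k, r)) * plane_rotation p i j \<alpha> \<beta> $$ (k, c))
      = (if r = c then 1 else 0)"
    using one ij rc by (simp add: sum_split_pair[OF ij])
      (auto simp: plane_rotation_def algebra_simps)
qed

lemma phase_change_unitary:
  assumes "cmod \<omega> = 1" "\<omega> \<in> K"
  shows "phase_change p i \<omega> \<in> unitaries K p"
proof (rule unitariesI)
  show "phase_change p i \<omega> \<in> mats K p p"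
    by (rule matsI) (use assms in \<open>auto simp: phase_change_def\<close>)
  have one: "cnj \<omega> * \<omega> = 1"
    using assms(1) complex_norm_square[of \<omega>] by (simp add: mult.commute)
  fix r c assume rc: "r < p" "c < p"
  have "(\<Sum>k<p. cnj (phase_change p i \<omega> $$ (k, r)) * phase_change p i \<omega> $$ (k, c))
     = (\<Sum>k<p. if k = r then (if r = c then 1 else 0) else 0)"
    using rc one by (intro sum.cong) (auto simp: phase_change_def)
  then show "(\<Sum>k<p. cnj (phase_change p i \<omega> $$ (k, r)) * phase_change p i \<omega> $$ (k, c)) = (if r = c then 1 else 0)"
    using rc by simp
qed

text \<open>The plane rotation with \<open>\<alpha> = R / q\<close>, \<open>\<beta> = w\<^sup>* / q\<close> changes the real part of the trace on the plane from \<open>R\<close> to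
  \<open>q = sqrt (R\<^sup>2 + |w|\<^sup>2)\<close>, where \<open>w\<close> is the defect \<open>A\<^sub>j\<^sub>i - A\<^sub>i\<^sub>j\<^sup>*\<close>. Maximality forces \<open>w = 0\<close>.\<close>

lemma trace_maximal_hermitian:
  assumes A: "A \<in> mats K p p"
    and max: "\<And>P. P \<in> unitaries K p \<Longrightarrow> (\<Sum>i<p. Re ((P * A) $$ (i, i))) \<le> (\<Sum>i<p. Re (A $$ (i, i)))"
    and ij: "i < p" "j < p" "i \<noteq> j"
  shows "A $$ (j, i) = cnj (A $$ (i, j))"
proof (rule ccontr)
  define w where "w = A $$ (j, i) - cnj (A $$ (i, j))"
  define R where "R = Re (A $$ (i, i)) + Re (A $$ (j, j))"
  define q where "q = sqrt (R\<^sup>2 + (cmod w)\<^sup>2)"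
  define \<alpha> where "\<alpha> = R / q"
  define \<beta> where "\<beta> = cnj w / complex_of_real q"
  assume "A $$ (j, i) \<noteq> cnj (A $$ (i, j))"
  then have w: "cmod w > 0" by (simp add: w_def)
  then have "R\<^sup>2 + (cmod w)\<^sup>2 > 0" by (intro add_nonneg_pos) auto
  then have q2: "q\<^sup>2 = R\<^sup>2 + (cmod w)\<^sup>2" "q > 0"
    unfolding q_def by simp_all
  have norm1: "\<alpha>\<^sup>2 + (cmod \<beta>)\<^sup>2 = 1"
    using q2 w by (simp add: \<alpha>_def \<beta>_def norm_divide power_divide add_divide_distrib[symmetric])
  have "\<beta> \<in> K" using A ij by (simp add: \<beta>_def w_def mats_entry)
  then have P: "plane_rotation p i j \<alpha> \<beta> \<in> unitaries K p"
    using plane_rotation_unitary norm1 ij by blast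
  let ?P = "plane_rotation p i j \<alpha> \<beta>"
  have dP: "dim_row ?P = p" "dim_col ?P = p" and dA: "dim_row A = p" "dim_col A = p"
    using A by (auto simp: plane_rotation_def mats_dim)
  have rows: "(?P * A) $$ (r, r) = (\<Sum>k<p. ?P $$ (r, k) * A $$ (k, r))" if "r < p" for r
    using that dP dA by (simp add: mult_entry)
  have other: "(?P * A) $$ (r, r) = A $$ (r, r)" if "r \<in> {..<p} - {i, j}" for r
  proof -
    have "(\<Sum>k<p. ?P $$ (r, k) * A $$ (k, r)) = (\<Sum>k<p. if k = r then A $$ (r, r) else 0)"
      using that by (intro sum.cong) (auto simp: plane_rotation_def)
    then show ?thesis using that rows by simp
  qed
  have row_i: "(?P * A) $$ (i, i) = of_real \<alpha> * A $$ (i, i) + \<beta> * A $$ (j, i)"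
  proof -
    have "(\<Sum>k\<in>{..<p} - {i, j}. ?P $$ (i, k) * A $$ (k, i)) = 0"
      using ij by (intro sum.neutral) (auto simp: plane_rotation_def)
    then show ?thesis using rows[of i] ij
      by (simp add: sum_split_pair[OF ij]) (simp add: plane_rotation_def)
  qed
  have row_j: "(?P * A) $$ (j, j) = - cnj \<beta> * A $$ (i, j) + of_real \<alpha> * A $$ (j, j)"
  proof -
    have "(\<Sum>k\<in>{..<p} - {i, j}. ?P $$ (j, k) * A $$ (k, j)) = 0"
      using ij by (intro sum.neutral) (auto simp: plane_rotation_def)
    then show ?thesis using rows[of j] ij
      by (simp add: sum_split_pair[OF ij]) (simp add: plane_rotation_def)
  qed
  have "Re ((?P * A) $$ (i, i)) + Re ((?P * A) $$ (j, j)) \<le> R"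
    using max[OF P] other by (simp add: sum_split_pair[OF ij] R_def)
  moreover have "Re ((?P * A) $$ (i, i)) + Re ((?P * A) $$ (j, j)) = \<alpha> * R + Re (\<beta> * w)"
    unfolding row_i row_j w_def R_def by (simp add: algebra_simps)
  moreover have "\<beta> * w = complex_of_real ((cmod w)\<^sup>2 / q)"
    unfolding \<beta>_def of_real_divide complex_norm_square by (simp add: mult.commute)
  moreover have "\<alpha> * R + (cmod w)\<^sup>2 / q = q"
  proof -
    have "\<alpha> * R + (cmod w)\<^sup>2 / q = q\<^sup>2 / q"
      unfolding q2(1) \<alpha>_def by (simp add: add_divide_distrib power2_eq_square)
    then show ?thesis using q2(2) by (simp add: power2_eq_square)
  qed
  ultimately have "q \<le> R" by simp
  then have "q\<^sup>2 \<le> R\<^sup>2" using q2(2) by (intro power_mono) auto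
  then show False using q2 w by simp
qed

lemma trace_maximal_diagonal:
  assumes A: "A \<in> mats K p p"
    and max: "\<And>P. P \<in> unitaries K p \<Longrightarrow> (\<Sum>i<p. Re ((P * A) $$ (i, i))) \<le> (\<Sum>i<p. Re (A $$ (i, i)))"
    and i: "i < p"
  shows "A $$ (i, i) = of_real (cmod (A $$ (i, i)))"
proof (cases "A $$ (i, i) = 0")
  case False
  define a where "a = A $$ (i, i)"
  define \<omega> where "\<omega> = cnj a / complex_of_real (cmod a)"
  have "\<omega> \<in> K" using A i by (simp add: \<omega>_def a_def mats_entry)
  moreover have "cmod \<omega> = 1" using False by (simp add: \<omega>_def norm_divide a_def)
  ultimately have P: "phase_change p i \<omega> \<in> unitaries K p" by (rule phase_change_unitary[rotated])
  let ?P = "phase_change p i \<omega>"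
  have rows: "(?P * A) $$ (r, r) = (if r = i then \<omega> * a else A $$ (r, r))" if "r < p" for r
  proof -
    have "(?P * A) $$ (r, r) = (\<Sum>k<p. ?P $$ (r, k) * A $$ (k, r))"
      using that A by (subst mult_entry) (auto simp: mats_dim phase_change_def)
    also have "\<dots> = (\<Sum>k<p. if k = r then (if r = i then \<omega> * a else A $$ (r, r)) else 0)"
      using that by (intro sum.cong) (auto simp: phase_change_def a_def)
    finally show ?thesis using that by simp
  qed
  have "(\<Sum>r<p. Re ((?P * A) $$ (r, r))) = Re (\<omega> * a) + (\<Sum>r\<in>{..<p} - {i}. Re (A $$ (r, r)))"
    using i rows by (subst sum.remove[of _ i]) auto
  moreover have "(\<Sum>r<p. Re (A $$ (r, r))) = Re a + (\<Sum>r\<in>{..<p} - {i}. Re (A $$ (r, r)))"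
    using i by (subst sum.remove[of _ i]) (auto simp: a_def)
  ultimately have "Re (\<omega> * a) \<le> Re a" using max[OF P] by simp
  moreover have "\<omega> * a = complex_of_real (cmod a)"
  proof -
    have "\<omega> * a = complex_of_real ((cmod a)\<^sup>2) / complex_of_real (cmod a)"
      by (simp only: \<omega>_def complex_norm_square) (simp add: mult.commute)
    then show ?thesis by (simp add: power2_eq_square)
  qed
  ultimately have "cmod a \<le> Re a" by simp
  then have Re: "Re a = cmod a" using complex_Re_le_cmod[of a] by linarith
  then have "(Im a)\<^sup>2 = 0" using cmod_power2[of a] by simp
  then show ?thesis using Re by (simp add: a_def complex_eq_iff)
qed simp

lemma permute_columns_unitary:
  assumes U: "U \<in> unitaries K p" and \<pi>: "\<pi> permutes {..<p}"
  shows "mat p p (\<lambda>(i, j). U $$ (i, \<pi> j)) \<in> unitaries K p"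
proof (rule unitariesI)
  have lt: "\<pi> i < p" if "i < p" for i using \<pi> that by (metis lessThan_iff permutes_in_image)
  show "mat p p (\<lambda>(i, j). U $$ (i, \<pi> j)) \<in> mats K p p"
    using U lt by (intro matsI) (auto intro: mats_entry[OF unitaries_mats])
  fix i j assume ij: "i < p" "j < p"
  have "\<pi> i = \<pi> j \<longleftrightarrow> i = j" using permutes_inj[OF \<pi>] by (auto dest: injD)
  then show "(\<Sum>k<p. cnj (mat p p (\<lambda>(i, j). U $$ (i, \<pi> j)) $$ (k, i)) * mat p p (\<lambda>(i, j). U $$ (i, \<pi> j)) $$ (k, j))
      = (if i = j then 1 else 0)"
    using unitaries_left_entry[OF U lt[OF ij(1)] lt[OF ij(2)]] ij by simp
qed

lemma trace_functional_bound:
  assumes Z: "Z \<in> mats K m n" and U: "U \<in> unitaries K m" and V: "V \<in> unitaries K n"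
    and ij: "i < m" "j < n"
  shows "cmod ((adj U * Z * V) $$ (i, j)) \<le> (\<Sum>l<n. \<Sum>k<m. cmod (Z $$ (k, l)))"
proof -
  have "(adj U * Z * V) $$ (i, j) = (\<Sum>l<n. (\<Sum>k<m. cnj (U $$ (k, i)) * Z $$ (k, l)) * V $$ (l, j))"
    using Z U V ij by (simp add: mult_entry mats_dim unitaries_dim)
  then have "cmod ((adj U * Z * V) $$ (i, j)) \<le> (\<Sum>l<n. \<Sum>k<m. cmod (cnj (U $$ (k, i)) * Z $$ (k, l) * V $$ (l, j)))"
    by (simp only: sum_distrib_right) (rule order_trans[OF norm_sum sum_mono], rule norm_sum)
  also have "\<dots> \<le> (\<Sum>l<n. \<Sum>k<m. cmod (Z $$ (k, l)))"
  proof (intro sum_mono)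
    fix l k assume "l \<in> {..<n}" "k \<in> {..<m}"
    then have "cmod (U $$ (k, i)) * cmod (Z $$ (k, l)) * cmod (V $$ (l, j)) \<le> 1 * cmod (Z $$ (k, l)) * 1"
      using U V ij by (intro mult_mono unitaries_entry_le_1 mult_nonneg_nonneg) auto
    then show "cmod (cnj (U $$ (k, i)) * Z $$ (k, l) * V $$ (l, j)) \<le> cmod (Z $$ (k, l))"
      by (simp add: norm_mult)
  qed
  finally show ?thesis .
qed

text \<open>A maximising sequence has a convergent subsequence, and the functional is continuous.\<close>

lemma trace_functional_maximizer:
  fixes c :: "nat \<Rightarrow> real"
  assumes Z: "Z \<in> mats K m n" and mn: "m \<le> n" and c: "\<And>i. c i \<ge> 0"
  defines "f \<equiv> (\<lambda>U V. \<Sum>i<m. c i * Re ((adj U * Z * V) $$ (i, i)))"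
  obtains U V where "U \<in> unitaries K m" "V \<in> unitaries K n"
    "\<And>U' V'. U' \<in> unitaries K m \<Longrightarrow> V' \<in> unitaries K n \<Longrightarrow> f U' V' \<le> f U V"
proof -
  define S where "S = {f U V |U V. U \<in> unitaries K m \<and> V \<in> unitaries K n}"
  have bound: "f U V \<le> (\<Sum>i<m. c i * (\<Sum>l<n. \<Sum>k<m. cmod (Z $$ (k, l))))"
    if "U \<in> unitaries K m" "V \<in> unitaries K n" for U V
    unfolding f_def using c trace_functional_bound[OF Z that] mn
    by (intro sum_mono mult_left_mono order_trans[OF complex_Re_le_cmod]) auto
  then have bdd: "bdd_above S" unfolding S_def by (auto simp: bdd_above_def)
  have "1\<^sub>m p \<in> unitaries K p" for p
    by (rule unitariesI) (auto intro!: matsI simp: if_distrib sum.delta cong: if_cong)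
  then have ne: "S \<noteq> {}" by (auto simp: S_def)
  have "\<exists>U V. U \<in> unitaries K m \<and> V \<in> unitaries K n \<and> Sup S - 1 / Suc k < f U V" for k
    using less_cSup_iff[OF ne bdd, of "Sup S - 1 / Suc k"] by (auto simp: S_def)
  then obtain Us Vs where Us: "\<And>k. Us k \<in> unitaries K m" and Vs: "\<And>k. Vs k \<in> unitaries K n"
    and sup: "\<And>k. Sup S - 1 / Suc k < f (Us k) (Vs k)" by metis
  obtain r U where r: "strict_mono r" "U \<in> unitaries K m" "entries_tendsto (\<lambda>k. Us (r k)) U"
    using unitaries_subsequence[of Us, OF Us] by blast
  obtain r' V where r': "strict_mono r'" "V \<in> unitaries K n" "entries_tendsto (\<lambda>k. Vs (r (r' k))) V"
    using unitaries_subsequence[of "\<lambda>k. Vs (r k)", OF Vs] by blast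
  have U_lim: "entries_tendsto (\<lambda>k. Us (r (r' k))) U"
    using entries_tendsto_subseq[OF r(3) r'(1)] .
  have "entries_tendsto (\<lambda>k. adj (Us (r (r' k))) * Z * Vs (r (r' k))) (adj U * Z * V)"
    using r'(2) r(2) Z
    by (intro entries_tendsto_mult entries_tendsto_adjoint entries_tendsto_const U_lim r'(3))
      (auto simp: unitaries_dim mats_dim)
  then have lim: "(\<lambda>k. f (Us (r (r' k))) (Vs (r (r' k)))) \<longlonglongrightarrow> f U V"
    unfolding f_def using mn r(2) r'(2)
    by (intro tendsto_intros entries_tendstoD[of _ "adj U * Z * V"]) (auto simp: unitaries_dim)
  have "(\<lambda>k. 1 / real (Suc k)) \<longlonglongrightarrow> 0"
    using LIMSEQ_inverse_real_of_nat by (simp add: inverse_eq_divide)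
  then have "((\<lambda>k. 1 / real (Suc k)) \<circ> (r \<circ> r')) \<longlonglongrightarrow> 0"
    using r(1) r'(1) by (intro LIMSEQ_subseq_LIMSEQ strict_mono_o)
  then have "(\<lambda>k. Sup S - 1 / real (Suc (r (r' k)))) \<longlonglongrightarrow> Sup S - 0"
    by (intro tendsto_intros) (simp add: o_def)
  then have "Sup S - 0 \<le> f U V"
    by (rule LIMSEQ_le[OF _ lim]) (use sup in \<open>auto intro: less_imp_le\<close>)
  then have "f U' V' \<le> f U V" if "U' \<in> unitaries K m" "V' \<in> unitaries K n" for U' V'
  proof -
    have "f U' V' \<in> S" using that unfolding S_def by blast
    then have "f U' V' \<le> Sup S" by (rule cSup_upper[OF _ bdd])
    with \<open>Sup S - 0 \<le> f U V\<close> show ?thesis by simp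
  qed
  then show thesis using r(2) r'(2) that by blast
qed

text \<open>Left and right multiplication by unitary matrices give the two Hermitian relations
  \<open>M\<^sub>i\<^sub>j c\<^sub>j = M\<^sub>j\<^sub>i\<^sup>* c\<^sub>i\<close> and \<open>c\<^sub>i M\<^sub>i\<^sub>j = c\<^sub>j M\<^sub>j\<^sub>i\<^sup>*\<close>, with weight 0 beyond \<open>m\<close>. Together they give \<open>(c\<^sub>i\<^sup>2 - c\<^sub>j\<^sup>2) M\<^sub>i\<^sub>j = 0\<close>.\<close>

lemma diagonalization_exists:
  assumes Z: "Z \<in> mats K m n" and mn: "m \<le> n"
  obtains U V x where "U \<in> unitaries K m" "V \<in> unitaries K n" "dim_vec x = m"
    "\<And>i. i < m \<Longrightarrow> x $ i \<ge> 0" "Z = U * rect_diag m n x * adj V"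
proof -
  define c where "c i = real (m - i)" for i
  obtain U V where U: "U \<in> unitaries K m" and V: "V \<in> unitaries K n"
    and max: "\<And>U' V'. U' \<in> unitaries K m \<Longrightarrow> V' \<in> unitaries K n \<Longrightarrow>
      (\<Sum>i<m. c i * Re ((adj U' * Z * V') $$ (i, i)))
       \<le> (\<Sum>i<m. c i * Re ((adj U * Z * V) $$ (i, i)))"
    by (rule trace_functional_maximizer[OF Z mn, of c]) (auto simp: c_def)
  define M where "M = adj U * Z * V"
  have M: "M \<in> mats K m n" unfolding M_def using U V Z by (auto intro!: mats_intros)
  have dM: "dim_row M = m" "dim_col M = n" using M by (auto simp: mats_dim)
  define A where "A = mat m m (\<lambda>(k, i). M $$ (k, i) * of_real (c i))"
  define B where "B = mat n n (\<lambda>(i, l). if i < m then of_real (c i) * M $$ (i, l) else 0)"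
  have A: "A \<in> mats K m m" and B: "B \<in> mats K n n"
    using M mn by (auto simp: A_def B_def mats_entry intro!: matsI)
  have maxA: "(\<Sum>i<m. Re ((P * A) $$ (i, i))) \<le> (\<Sum>i<m. Re (A $$ (i, i)))" if P: "P \<in> unitaries K m" for P
  proof -
    have "adj (U * adj P) * Z * V = P * M"
      using U P Z V by (simp add: M_def mat_adjoint_mult mult_assoc_dim unitaries_dim mats_dim)
    then have "(\<Sum>i<m. c i * Re ((P * M) $$ (i, i))) \<le> (\<Sum>i<m. c i * Re (M $$ (i, i)))"
      using max[of "U * adj P" V] U V P by (simp add: M_def unitaries_mult unitaries_adjoint)
    moreover have "Re ((P * A) $$ (i, i)) = c i * Re ((P * M) $$ (i, i))" if "i < m" for i
    proof -
      have "(P * A) $$ (i, i) = (\<Sum>k<m. P $$ (i, k) * (M $$ (k, i) * of_real (c i)))"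
        using that P by (subst mult_entry) (auto simp: A_def unitaries_dim)
      also have "\<dots> = of_real (c i) * (\<Sum>k<m. P $$ (i, k) * M $$ (k, i))"
        by (simp add: sum_distrib_left mult_ac)
      also have "(\<Sum>k<m. P $$ (i, k) * M $$ (k, i)) = (P * M) $$ (i, i)"
        using that P dM mn by (subst mult_entry) (auto simp: unitaries_dim)
      finally show ?thesis by simp
    qed
    ultimately show ?thesis by (simp add: A_def mult.commute)
  qed
  have maxB: "(\<Sum>i<n. Re ((Q * B) $$ (i, i))) \<le> (\<Sum>i<n. Re (B $$ (i, i)))" if Q: "Q \<in> unitaries K n" for Q
  proof -
    have "adj U * Z * (V * Q) = M * Q"
      using U Q Z V by (simp add: M_def mult_assoc_dim unitaries_dim mats_dim)
    then have le: "(\<Sum>i<m. c i * Re ((M * Q) $$ (i, i))) \<le> (\<Sum>i<m. c i * Re (M $$ (i, i)))"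
      using max[of U "V * Q"] U V Q by (simp add: M_def unitaries_mult)
    have "(\<Sum>i<n. (Q * B) $$ (i, i)) = (\<Sum>i<n. \<Sum>k<n. Q $$ (i, k) * B $$ (k, i))"
      using Q by (intro sum.cong refl) (subst mult_entry; auto simp: B_def unitaries_dim)
    also have "\<dots> = (\<Sum>k<n. \<Sum>i<n. Q $$ (i, k) * B $$ (k, i))" by (rule sum.swap)
    also have "\<dots> = (\<Sum>k<m. \<Sum>i<n. Q $$ (i, k) * B $$ (k, i))"
      using mn by (intro sum.mono_neutral_right) (auto simp: B_def)
    also have "\<dots> = (\<Sum>k<m. of_real (c k) * (M * Q) $$ (k, k))"
    proof (intro sum.cong refl)
      fix k assume "k \<in> {..<m}"
      then show "(\<Sum>i<n. Q $$ (i, k) * B $$ (k, i)) = of_real (c k) * (M * Q) $$ (k, k)"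
        using Q dM mn by (subst mult_entry) (auto simp: B_def unitaries_dim sum_distrib_left mult_ac)
    qed
    finally have "Re (\<Sum>i<n. (Q * B) $$ (i, i)) = (\<Sum>i<m. c i * Re ((M * Q) $$ (i, i)))"
      by (simp add: Re_sum)
    moreover have "(\<Sum>i<n. Re (B $$ (i, i))) = (\<Sum>i<m. c i * Re (M $$ (i, i)))"
      using mn by (intro sum.mono_neutral_cong_right) (auto simp: B_def)
    ultimately show ?thesis using le by (simp add: Re_sum)
  qed
  have offdiag: "M $$ (i, j) = 0" if ij: "i < m" "j < n" "i \<noteq> j" for i j
  proof -
    have ci: "c i > 0" using ij by (simp add: c_def)
    have b: "of_real (c i) * M $$ (i, j) = (if j < m then of_real (c j) * cnj (M $$ (j, i)) else 0)"
      using trace_maximal_hermitian[OF B maxB, of j i] ij mn by (auto simp: B_def)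
    show ?thesis
    proof (cases "j < m")
      case True
      have a: "M $$ (i, j) * of_real (c j) = cnj (M $$ (j, i)) * of_real (c i)"
        using trace_maximal_hermitian[OF A maxA, of j i] ij True by (auto simp: A_def)
      have "of_real (c i) * of_real (c i) * M $$ (i, j)
          = of_real (c j) * (cnj (M $$ (j, i)) * of_real (c i))"
        using b True by (simp add: mult_ac)
      also have "\<dots> = of_real (c j) * of_real (c j) * M $$ (i, j)"
        unfolding a[symmetric] by (simp add: mult_ac)
      finally have "of_real (c i * c i - c j * c j) * M $$ (i, j) = 0"
        by (simp add: algebra_simps)
      moreover have "c i * c i - c j * c j \<noteq> 0"
      proof -
        have "c i - c j \<noteq> 0" "c i + c j > 0" using ij True by (auto simp: c_def)
        moreover have "c i * c i - c j * c j = (c i - c j) * (c i + c j)" by (simp add: algebra_simps)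
        ultimately show ?thesis by simp
      qed
      ultimately show ?thesis unfolding mult_eq_0_iff of_real_eq_0_iff by blast
    next
      case False
      then show ?thesis using b ci by simp
    qed
  qed
  define x where "x = vec m (\<lambda>i. cmod (M $$ (i, i)))"
  have diag: "M $$ (i, i) = of_real (x $ i)" if "i < m" for i
  proof -
    have ci: "c i > 0" using that by (simp add: c_def)
    have "M $$ (i, i) * of_real (c i) = of_real (x $ i) * of_real (c i)"
      using trace_maximal_diagonal[OF A maxA that] that ci by (simp add: A_def x_def norm_mult)
    then show ?thesis using ci by simp
  qed
  have "M = rect_diag m n x"
    using offdiag diag dM by (intro eq_matI) auto
  then have "U * rect_diag m n x * adj V = U * (adj U * Z * V) * adj V"
    by (simp add: M_def)
  also have "\<dots> = Z"
    using U V Z by (simp add: mult_assoc_dim unitaries_simps mats_dim)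
  finally show thesis using that[of U V x] U V by (simp add: x_def)
qed

text \<open>A diagonalisation becomes a singular value decomposition by permuting the columns of both factors.\<close>

theorem svd_exists:
  assumes Z: "Z \<in> mats K m n" and mn: "m \<le> n"
  shows "\<exists>UV. UV \<in> svd_pairs K Z"
proof -
  obtain U V x where U: "U \<in> unitaries K m" and V: "V \<in> unitaries K n" and x: "dim_vec x = m"
    "\<And>i. i < m \<Longrightarrow> x $ i \<ge> 0" and eq: "Z = U * rect_diag m n x * adj V"
    using diagonalization_exists[OF Z mn] by blast
  define s where "s = sing_vals Z"
  obtain \<pi> where \<pi>: "\<pi> permutes {..<m}" "\<And>i. i < m \<Longrightarrow> s $ i = \<bar>x $ \<pi> i\<bar>"
    using sing_vals_rearrangement[OF U V mn x(1)] unfolding eq s_def by metis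
  have \<pi>n: "\<pi> permutes {..<n}" using \<pi>(1) mn by (intro permutes_subset[OF \<pi>(1)]) auto
  have lt: "\<pi> i < m" if "i < m" for i using \<pi>(1) that by (metis lessThan_iff permutes_in_image)
  define U' where "U' = mat m m (\<lambda>(i, j). U $$ (i, \<pi> j))"
  define V' where "V' = mat n n (\<lambda>(i, j). V $$ (i, \<pi> j))"
  have U': "U' \<in> unitaries K m" and V': "V' \<in> unitaries K n"
    unfolding U'_def V'_def by (intro permute_columns_unitary U V \<pi>(1) \<pi>n)+
  have "Z = U' * rect_diag m n s * adj V'"
  proof (rule eq_matI)
    fix i j assume "i < dim_row (U' * rect_diag m n s * adj V')" "j < dim_col (U' * rect_diag m n s * adj V')"
    then have ij: "i < m" "j < n" using U' V' by (auto simp: unitaries_dim)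
    have "(U' * rect_diag m n s * adj V') $$ (i, j)
        = (\<Sum>k<m. U' $$ (i, k) * of_real (s $ k) * cnj (V' $$ (j, k)))"
      using ij U' V' mn by (intro rect_diag_product_entry) (auto simp: unitaries_dim)
    also have "\<dots> = (\<Sum>k<m. U $$ (i, \<pi> k) * of_real (x $ \<pi> k) * cnj (V $$ (j, \<pi> k)))"
      using ij mn lt x \<pi>(2) by (intro sum.cong) (auto simp: U'_def V'_def)
    also have "\<dots> = (\<Sum>k<m. U $$ (i, k) * of_real (x $ k) * cnj (V $$ (j, k)))"
      using sum.permute[OF \<pi>(1), of "\<lambda>k. U $$ (i, k) * of_real (x $ k) * cnj (V $$ (j, k))"]
      by (simp add: o_def)
    also have "\<dots> = Z $$ (i, j)"
      unfolding eq using ij U V mn by (intro rect_diag_product_entry[symmetric]) (auto simp: unitaries_dim)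
    finally show "Z $$ (i, j) = (U' * rect_diag m n s * adj V') $$ (i, j)" by simp
  qed (use U' V' Z in \<open>auto simp: unitaries_dim mats_dim\<close>)
  then have "(U', V') \<in> svd_pairs K Z"
    unfolding svd_pairs_def s_def using U' V' by (simp add: mats_dim[OF Z])
  then show ?thesis by blast
qed

lemma sing_vals_props:
  assumes Z: "Z \<in> mats K m n" and mn: "m \<le> n"
  shows "dim_vec (sing_vals Z) = m" "nonincreasing (sing_vals Z)" "\<And>i. i < m \<Longrightarrow> sing_vals Z $ i \<ge> 0"
proof -
  obtain U V x where U: "U \<in> unitaries K m" and V: "V \<in> unitaries K n" and x: "dim_vec x = m"
    and eq: "Z = U * rect_diag m n x * adj V"
    using diagonalization_exists[OF Z mn] by blast
  obtain \<pi> where \<pi>: "\<And>i. i < m \<Longrightarrow> sing_vals Z $ i = \<bar>x $ \<pi> i\<bar>"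
      "dim_vec (sing_vals Z) = m" "nonincreasing (sing_vals Z)"
    using sing_vals_rearrangement[OF U V mn x(1)] unfolding eq by metis
  then show "dim_vec (sing_vals Z) = m" "nonincreasing (sing_vals Z)" "\<And>i. i < m \<Longrightarrow> sing_vals Z $ i \<ge> 0"
    by auto
qed

end

section \<open>Difference quotients along a path of decompositions\<close>

lemma entries_tendsto_add:
  assumes "entries_tendsto F A" "entries_tendsto G B" "dim_row A = dim_row B" "dim_col A = dim_col B"
  shows "entries_tendsto (\<lambda>k. F k + G k) (A + B)"
  using assms by (auto simp: entries_tendsto_def intro!: tendsto_intros)

text \<open>The summand of the first divided directional difference that involves \<open>g\<close> only through its value \<open>d\<close> at \<open>s\<close>, for
  a direction \<open>M\<close> in singular coordinates. It is given by entries, since all arguments about it compare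
  entries.\<close>

definition div_diff_part :: "nat \<Rightarrow> real vec \<Rightarrow> real vec \<Rightarrow> complex mat \<Rightarrow> complex mat" where
  "div_diff_part n s d M = mat (dim_vec s) n (\<lambda>(i, j).
     if j < dim_vec s then
       complex_of_real (if s $ i \<noteq> s $ j then (d $ i - d $ j) / (s $ i - s $ j) else 0)
         * ((M $$ (i, j) + cnj (M $$ (j, i))) / 2)
       + complex_of_real (if s $ i + s $ j \<noteq> 0 then (d $ i + d $ j) / (s $ i + s $ j) else 0)
         * ((M $$ (i, j) - cnj (M $$ (j, i))) / 2)
     else of_real (if s $ i \<noteq> 0 then d $ i / s $ i else 0) * M $$ (i, j))"

text \<open>If \<open>w x = t z\<close>, then \<open>w / t = z / x\<close>. The factor \<open>c\<close> is a difference or sum of values of \<open>g\<close>, which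
  vanishes whenever the limit of the denominator does, so that the degenerate case contributes 0.\<close>

lemma quotient_limit:
  fixes w z :: "nat \<Rightarrow> complex" and x y t :: "nat \<Rightarrow> real"
  assumes eq: "\<And>k. w k * complex_of_real (x k) = complex_of_real (t k) * z k" and t: "\<And>k. t k > 0"
    and x: "x \<longlonglongrightarrow> x0" and z: "z \<longlonglongrightarrow> z0" and c: "x0 = 0 \<Longrightarrow> c = 0"
  shows "(\<lambda>k. w k * complex_of_real c / complex_of_real (t k))
    \<longlonglongrightarrow> complex_of_real (if x0 \<noteq> 0 then c / x0 else 0) * z0"
proof (cases "x0 = 0")
  case False
  have "(\<lambda>k. complex_of_real c / complex_of_real (x k) * z k) \<longlonglongrightarrow> complex_of_real c / complex_of_real x0 * z0"
    using False by (intro tendsto_intros x z) simp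
  moreover have "\<forall>\<^sub>F k in sequentially. x k \<noteq> 0"
    using tendsto_imp_eventually_ne[OF x False] .
  then have "\<forall>\<^sub>F k in sequentially. complex_of_real c / complex_of_real (x k) * z k
      = w k * complex_of_real c / complex_of_real (t k)"
  proof eventually_elim
    case (elim k)
    have "w k = complex_of_real (t k) * z k / complex_of_real (x k)"
      using eq[of k] elim by (simp add: field_simps)
    then show ?case using t[of k] by (simp add: field_simps)
  qed
  ultimately show ?thesis using False by (simp add: tendsto_cong[symmetric])
qed (use c in simp)

text \<open>A sequence \<open>X + t\<^sub>k H\<^sub>k\<close> with decompositions whose factors converge to those of \<open>X\<close>. Such
  sequences are what compactness provides.\<close>

locale svd_path = base_field K for K :: "complex set" +
  fixes m n :: nat and U V X H :: "complex mat" and s :: "real vec"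
    and t :: "nat \<Rightarrow> real" and Hs Us Vs :: "nat \<Rightarrow> complex mat" and ss :: "nat \<Rightarrow> real vec"
  assumes mn: "m \<le> n" and U: "U \<in> unitaries K m" and V: "V \<in> unitaries K n"
    and s: "dim_vec s = m" and X: "X = U * rect_diag m n s * adj V"
    and t_pos: "\<And>k. t k > 0" and t_0: "t \<longlonglongrightarrow> 0"
    and Us: "\<And>k. Us k \<in> unitaries K m" and Vs: "\<And>k. Vs k \<in> unitaries K n"
    and Hs: "\<And>k. Hs k \<in> mats K m n"
    and path: "\<And>k. X + of_real (t k) \<cdot>\<^sub>m Hs k = Us k * rect_diag m n (ss k) * adj (Vs k)"
    and Us_lim: "entries_tendsto Us U" and Vs_lim: "entries_tendsto Vs V"
    and Hs_lim: "entries_tendsto Hs H" and ss_lim: "\<And>i. i < m \<Longrightarrow> (\<lambda>k. ss k $ i) \<longlonglongrightarrow> s $ i"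
begin

text \<open>The moving singular bases in limiting coordinates. The right factors of \<open>a\<close> and \<open>b\<close> are the moving
  bases: with them the relations \<open>path_left\<close> and \<open>path_right\<close> are exact and linear in \<open>P\<close> and \<open>Q\<close>.\<close>

definition "P k = adj U * Us k"
definition "Q k = adj V * Vs k"
definition "a k = adj U * Hs k * Vs k"
definition "b k = adj V * adj (Hs k) * Us k"
definition "M = adj U * H * V"

lemma H: "dim_row H = m" "dim_col H = n"
  using Hs_lim Hs mats_dim by (metis entries_tendsto_dim)+

lemmas dims = unitaries_dim[OF U] unitaries_dim[OF V] unitaries_dim[OF Us] unitaries_dim[OF Vs]
  mats_dim[OF Hs] H

lemma dim_PQ [simp]: "dim_row (P k) = m" "dim_col (P k) = m" "dim_row (Q k) = n" "dim_col (Q k) = n"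
  "dim_row (a k) = m" "dim_col (a k) = n" "dim_row (b k) = n" "dim_col (b k) = m"
  "dim_row M = m" "dim_col M = n"
  by (simp_all add: P_def Q_def a_def b_def M_def dims)

lemma P_lim: "entries_tendsto P (1\<^sub>m m)" and Q_lim: "entries_tendsto Q (1\<^sub>m n)"
proof -
  have "entries_tendsto P (adj U * U)" "entries_tendsto Q (adj V * V)"
    unfolding P_def Q_def by (intro entries_tendsto_mult entries_tendsto_const Us_lim Vs_lim; simp add: dims)+
  then show "entries_tendsto P (1\<^sub>m m)" "entries_tendsto Q (1\<^sub>m n)"
    by (simp_all add: unitaries_left[OF U] unitaries_left[OF V])
qed

lemma a_lim: "entries_tendsto a M"
  unfolding a_def M_def
  by (intro entries_tendsto_mult entries_tendsto_const Hs_lim Vs_lim) (simp_all add: dims)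

lemma b_lim: "entries_tendsto b (adj M)"
proof -
  have "entries_tendsto b (adj V * adj H * U)"
    unfolding b_def
    by (intro entries_tendsto_mult entries_tendsto_const entries_tendsto_adjoint Hs_lim Us_lim) (simp_all add: dims)
  moreover have "adj M = adj V * adj H * U"
    unfolding M_def by (simp add: dim_algebra dims)
  ultimately show ?thesis by simp
qed

text \<open>\<open>U\<^sup>* X\<^sub>k V\<^sub>k\<close>, computed from \<open>X\<^sub>k = U\<^sub>k [Diag(s\<^sub>k) 0] V\<^sub>k\<^sup>*\<close> and from \<open>X\<^sub>k = X + t\<^sub>k H\<^sub>k\<close>. The adjoint
  equation is \<open>path_right\<close>.\<close>

lemma path_left: "P k * rect_diag m n (ss k) = rect_diag m n s * Q k + of_real (t k) \<cdot>\<^sub>m a k"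
proof -
  have "adj U * (X + of_real (t k) \<cdot>\<^sub>m Hs k) * Vs k = P k * rect_diag m n (ss k)"
    unfolding path P_def by (simp add: mult_assoc_dim dims unitaries_simps[OF Vs])
  moreover have "adj U * (X + of_real (t k) \<cdot>\<^sub>m Hs k) * Vs k
      = rect_diag m n s * Q k + of_real (t k) \<cdot>\<^sub>m a k"
    unfolding X Q_def a_def by (simp add: dim_algebra dims unitaries_simps[OF U])
  ultimately show ?thesis by simp
qed

lemma path_right: "Q k * rect_diag n m (ss k) = rect_diag n m s * P k + of_real (t k) \<cdot>\<^sub>m b k"
proof -
  have "adj V * adj (X + of_real (t k) \<cdot>\<^sub>m Hs k) * Us k = Q k * rect_diag n m (ss k)"
    unfolding path Q_def by (simp add: dim_algebra dims unitaries_simps[OF Us])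
  moreover have "adj V * adj (X + of_real (t k) \<cdot>\<^sub>m Hs k) * Us k
      = rect_diag n m s * P k + of_real (t k) \<cdot>\<^sub>m b k"
    unfolding X P_def b_def by (simp add: dim_algebra dims unitaries_simps[OF V])
  ultimately show ?thesis by simp
qed

lemma entry_left:
  assumes "i < m" "j < m"
  shows "P k $$ (i, j) * of_real (ss k $ j)
    = of_real (s $ i) * Q k $$ (i, j) + of_real (t k) * a k $$ (i, j)"
  using arg_cong[OF path_left[of k], of "\<lambda>A. A $$ (i, j)"] assms mn
  by (simp add: rect_diag_entries)

lemma entry_left_tail:
  assumes "i < m" "m \<le> j" "j < n"
  shows "of_real (s $ i) * Q k $$ (i, j) + of_real (t k) * a k $$ (i, j) = 0"
  using arg_cong[OF path_left[of k], of "\<lambda>A. A $$ (i, j)"] assms mn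
  by (simp add: rect_diag_entries)

lemma entry_right:
  assumes "i < m" "j < m"
  shows "Q k $$ (i, j) * of_real (ss k $ j)
    = of_real (s $ i) * P k $$ (i, j) + of_real (t k) * b k $$ (i, j)"
  using arg_cong[OF path_right[of k], of "\<lambda>A. A $$ (i, j)"] assms mn
  by (simp add: rect_diag_entries)

text \<open>Adding and subtracting the two relations decouples \<open>P + Q\<close> from \<open>P - Q\<close>.\<close>

lemma entry_sum:
  assumes "i < m" "j < m"
  shows "(P k $$ (i, j) + Q k $$ (i, j)) * of_real (ss k $ j - s $ i)
    = of_real (t k) * (a k $$ (i, j) + b k $$ (i, j))"
  using entry_left[OF assms, of k] entry_right[OF assms, of k] by (simp add: algebra_simps)

lemma entry_diff:
  assumes "i < m" "j < m"
  shows "(P k $$ (i, j) - Q k $$ (i, j)) * of_real (ss k $ j + s $ i)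
    = of_real (t k) * (a k $$ (i, j) - b k $$ (i, j))"
  using entry_left[OF assms, of k] entry_right[OF assms, of k] by (simp add: algebra_simps)

lemma entry_limits:
  assumes "i < m" "j < n"
  shows "(\<lambda>k. a k $$ (i, j)) \<longlonglongrightarrow> M $$ (i, j)"
    and "j < m \<Longrightarrow> (\<lambda>k. b k $$ (i, j)) \<longlonglongrightarrow> cnj (M $$ (j, i))"
    and "j < m \<Longrightarrow> (\<lambda>k. P k $$ (i, j)) \<longlonglongrightarrow> (if i = j then 1 else 0)"
    and "(\<lambda>k. Q k $$ (i, j)) \<longlonglongrightarrow> (if i = j then 1 else 0)"
  using entries_tendstoD[OF a_lim, of i j] entries_tendstoD[OF b_lim, of i j]
    entries_tendstoD[OF P_lim, of i j] entries_tendstoD[OF Q_lim, of i j] assms mn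
  by simp_all

text \<open>At a diagonal entry \<open>P + Q \<rightarrow> 2\<close>, so \<open>entry_sum\<close> can be solved for the difference quotient of the
  singular value.\<close>

lemma sing_val_derivative:
  assumes i: "i < m"
  shows "(\<lambda>k. (ss k $ i - s $ i) / t k) \<longlonglongrightarrow> Re (M $$ (i, i))"
proof -
  have in': "i < n" using i mn by simp
  let ?S = "\<lambda>k. P k $$ (i, i) + Q k $$ (i, i)"
  have S: "?S \<longlonglongrightarrow> 1 + 1"
    using entry_limits(3,4)[OF i in'] i by (intro tendsto_add) simp_all
  have "(\<lambda>k. (a k $$ (i, i) + b k $$ (i, i)) / ?S k) \<longlonglongrightarrow> (M $$ (i, i) + cnj (M $$ (i, i))) / (1 + 1)"
    by (intro tendsto_divide tendsto_add S entry_limits(1,2) i in') simp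
  also have "(M $$ (i, i) + cnj (M $$ (i, i))) / (1 + 1) = of_real (Re (M $$ (i, i)))"
    by (simp add: complex_add_cnj)
  finally have lim: "(\<lambda>k. (a k $$ (i, i) + b k $$ (i, i)) / ?S k) \<longlonglongrightarrow> of_real (Re (M $$ (i, i)))" .
  have "\<forall>\<^sub>F k in sequentially. ?S k \<noteq> 0"
    by (rule tendsto_imp_eventually_ne[OF S]) simp
  then have "\<forall>\<^sub>F k in sequentially. (a k $$ (i, i) + b k $$ (i, i)) / ?S k = of_real ((ss k $ i - s $ i) / t k)"
  proof eventually_elim
    case (elim k)
    then show ?case using entry_sum[OF i i, of k] t_pos[of k] by (simp add: field_simps)
  qed
  then have "(\<lambda>k. complex_of_real ((ss k $ i - s $ i) / t k)) \<longlonglongrightarrow> complex_of_real (Re (M $$ (i, i)))"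
    using lim by (rule Lim_transform_eventually[rotated])
  then show ?thesis by (simp only: tendsto_of_real_iff)
qed

text \<open>For \<open>s\<^sub>i = s\<^sub>j\<close> the left side of \<open>entry_sum\<close>, divided by \<open>t\<close>, is \<open>(P + Q)\<^sub>i\<^sub>j \<rightarrow> 0\<close> times the convergent
  difference quotient of \<open>s\<^sub>j\<close>. So the limiting bases already diagonalise the Hermitian parts of the blocks of the direction.\<close>

lemma block_offdiagonal:
  assumes ij: "i < m" "j < m" "i \<noteq> j" and sij: "s $ i = s $ j"
  shows "M $$ (i, j) + cnj (M $$ (j, i)) = 0"
proof -
  have jn: "j < n" using ij mn by simp
  have "(\<lambda>k. (P k $$ (i, j) + Q k $$ (i, j)) * of_real ((ss k $ j - s $ j) / t k))
      \<longlonglongrightarrow> (0 + 0) * of_real (Re (M $$ (j, j)))"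
    using entry_limits(3,4)[OF ij(1) jn] ij
    by (intro tendsto_mult tendsto_add tendsto_of_real sing_val_derivative) simp_all
  moreover have "(P k $$ (i, j) + Q k $$ (i, j)) * of_real ((ss k $ j - s $ j) / t k)
      = a k $$ (i, j) + b k $$ (i, j)" for k
    using entry_sum[OF ij(1,2), of k] t_pos[of k] sij by (simp add: field_simps)
  ultimately have "(\<lambda>k. a k $$ (i, j) + b k $$ (i, j)) \<longlonglongrightarrow> 0" by simp
  moreover have "(\<lambda>k. a k $$ (i, j) + b k $$ (i, j)) \<longlonglongrightarrow> M $$ (i, j) + cnj (M $$ (j, i))"
    by (intro tendsto_add entry_limits ij jn)
  ultimately show ?thesis by (rule LIMSEQ_unique[symmetric])
qed

text \<open>When \<open>s\<^sub>i = s\<^sub>j = 0\<close>, the relation \<open>entry_left\<close> no longer involves \<open>Q\<close>, and it yields the full entry of \<open>M\<close> instead of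
  its Hermitian part. Columns beyond \<open>m\<close> behave as if they had singular value 0.\<close>

lemma zero_block:
  assumes ij: "i < m" "j < n" and si: "s $ i = 0" and sj: "j < m \<Longrightarrow> s $ j = 0"
  shows "M $$ (i, j) = (if i = j then of_real (Re (M $$ (i, i))) else 0)"
proof (cases "j < m")
  case True
  have "(\<lambda>k. P k $$ (i, j) * of_real ((ss k $ j - s $ j) / t k))
      \<longlonglongrightarrow> (if i = j then 1 else 0) * of_real (Re (M $$ (j, j)))"
    using True by (intro tendsto_mult tendsto_of_real sing_val_derivative entry_limits(3)[OF ij])
  moreover have "P k $$ (i, j) * of_real ((ss k $ j - s $ j) / t k) = a k $$ (i, j)" for k
    using entry_left[OF ij(1) True, of k] t_pos[of k] si sj True by (simp add: field_simps)
  ultimately have "(\<lambda>k. a k $$ (i, j)) \<longlonglongrightarrow> (if i = j then 1 else 0) * of_real (Re (M $$ (j, j)))"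
    by simp
  then have "M $$ (i, j) = (if i = j then 1 else 0) * of_real (Re (M $$ (j, j)))"
    using LIMSEQ_unique entry_limits(1)[OF ij] by blast
  then show ?thesis by auto
next
  case False
  have "a k $$ (i, j) = 0" for k
    using entry_left_tail[of i j k] False ij t_pos[of k] si by simp
  then have "M $$ (i, j) = 0"
    using entry_limits(1)[OF ij] by (simp add: LIMSEQ_const_iff)
  then show ?thesis using False ij by auto
qed

lemma derivative_monotone:
  assumes ss: "\<And>k. nonincreasing (ss k)" "\<And>k. dim_vec (ss k) = m"
    and ij: "i \<le> j" "j < m" and sij: "s $ i = s $ j"
  shows "Re (M $$ (j, j)) \<le> Re (M $$ (i, i))"
proof (rule LIMSEQ_le[OF sing_val_derivative sing_val_derivative])
  have "(ss k $ j - s $ j) / t k \<le> (ss k $ i - s $ i) / t k" for k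
    using ss ij sij t_pos[of k] by (intro divide_right_mono) (auto simp: nonincreasing_def)
  then show "\<exists>N. \<forall>k\<ge>N. (ss k $ j - s $ j) / t k \<le> (ss k $ i - s $ i) / t k" by blast
qed (use ij in auto)

lemma derivative_nonneg:
  assumes ss: "\<And>k i. i < m \<Longrightarrow> ss k $ i \<ge> 0" and i: "i < m" "s $ i = 0"
  shows "0 \<le> Re (M $$ (i, i))"
proof (rule LIMSEQ_le_const[OF sing_val_derivative])
  have "0 \<le> (ss k $ i - s $ i) / t k" for k
    using ss[OF i(1), of k] i t_pos[of k] by simp
  then show "\<exists>N. \<forall>k\<ge>N. 0 \<le> (ss k $ i - s $ i) / t k" by blast
qed (use i in auto)

text \<open>Written in terms of \<open>P \<plusminus> Q\<close>, the entry \<open>P\<^sub>i\<^sub>j d\<^sub>j - d\<^sub>i Q\<^sub>i\<^sub>j\<close> is half of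
  \<open>(P + Q)\<^sub>i\<^sub>j (d\<^sub>j - d\<^sub>i) + (P - Q)\<^sub>i\<^sub>j (d\<^sub>j + d\<^sub>i)\<close>, to which \<open>quotient_limit\<close> applies.\<close>

lemma commutator_limit:
  assumes d: "\<And>i j c. i < m \<Longrightarrow> j < m \<Longrightarrow> c \<in> {1, - 1} \<Longrightarrow> s $ j = c * s $ i \<Longrightarrow> d $ j = c * d $ i"
  shows "entries_tendsto (\<lambda>k. of_real (1 / t k) \<cdot>\<^sub>m (P k * rect_diag m n d - rect_diag m n d * Q k))
    (div_diff_part n s d M)"
  unfolding entries_tendsto_def
proof (intro conjI allI impI)
  fix i j assume "i < dim_row (div_diff_part n s d M)" "j < dim_col (div_diff_part n s d M)"
  then have ij: "i < m" "j < n" by (auto simp: div_diff_part_def s)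
  let ?R = "\<lambda>k. of_real (1 / t k) \<cdot>\<^sub>m (P k * rect_diag m n d - rect_diag m n d * Q k)"
  have R: "?R k $$ (i, j) = of_real (1 / t k) *
      ((if j < m then P k $$ (i, j) * of_real (d $ j) else 0) - of_real (d $ i) * Q k $$ (i, j))" for k
    using ij mn by (simp add: rect_diag_entries)
  show "(\<lambda>k. ?R k $$ (i, j)) \<longlonglongrightarrow> div_diff_part n s d M $$ (i, j)"
  proof (cases "j < m")
    case True
    have 1: "(\<lambda>k. (P k $$ (i, j) + Q k $$ (i, j)) * of_real (d $ j - d $ i) / of_real (t k))
        \<longlonglongrightarrow> complex_of_real (if s $ j - s $ i \<noteq> 0 then (d $ j - d $ i) / (s $ j - s $ i) else 0)
           * (M $$ (i, j) + cnj (M $$ (j, i)))"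
      by (rule quotient_limit[OF entry_sum[OF ij(1) True] t_pos])
        (use d[of i j 1] ij True in \<open>auto intro!: tendsto_intros ss_lim entry_limits\<close>)
    have 2: "(\<lambda>k. (P k $$ (i, j) - Q k $$ (i, j)) * of_real (d $ j + d $ i) / of_real (t k))
        \<longlonglongrightarrow> complex_of_real (if s $ j + s $ i \<noteq> 0 then (d $ j + d $ i) / (s $ j + s $ i) else 0)
           * (M $$ (i, j) - cnj (M $$ (j, i)))"
      by (rule quotient_limit[OF entry_diff[OF ij(1) True] t_pos])
        (use d[of i j "- 1"] ij True in \<open>auto intro!: tendsto_intros ss_lim entry_limits simp: eq_neg_iff_add_eq_0\<close>)
    \<comment> \<open>The two halves are the relations for the sum and the difference of the moving bases.\<close>
    have "?R k $$ (i, j) = ((P k $$ (i, j) + Q k $$ (i, j)) * of_real (d $ j - d $ i) / of_real (t k)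
        + (P k $$ (i, j) - Q k $$ (i, j)) * of_real (d $ j + d $ i) / of_real (t k)) / 2" for k
      unfolding R using True t_pos[of k] by (simp add: field_simps)
    moreover have "div_diff_part n s d M $$ (i, j)
       = (complex_of_real (if s $ j - s $ i \<noteq> 0 then (d $ j - d $ i) / (s $ j - s $ i) else 0)
           * (M $$ (i, j) + cnj (M $$ (j, i)))
         + complex_of_real (if s $ j + s $ i \<noteq> 0 then (d $ j + d $ i) / (s $ j + s $ i) else 0)
           * (M $$ (i, j) - cnj (M $$ (j, i)))) / 2"
    proof -
      have "(d $ j - d $ i) / (s $ j - s $ i) = (d $ i - d $ j) / (s $ i - s $ j)"
        by (metis minus_diff_eq minus_divide_divide)
      then have "(if s $ i \<noteq> s $ j then (d $ i - d $ j) / (s $ i - s $ j) else 0)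
          = (if s $ j - s $ i \<noteq> 0 then (d $ j - d $ i) / (s $ j - s $ i) else 0)"
        "(if s $ i + s $ j \<noteq> 0 then (d $ i + d $ j) / (s $ i + s $ j) else 0)
          = (if s $ j + s $ i \<noteq> 0 then (d $ j + d $ i) / (s $ j + s $ i) else 0)"
        by (simp_all add: add.commute)
      moreover have "div_diff_part n s d M $$ (i, j)
        = complex_of_real (if s $ i \<noteq> s $ j then (d $ i - d $ j) / (s $ i - s $ j) else 0)
            * ((M $$ (i, j) + cnj (M $$ (j, i))) / 2)
          + complex_of_real (if s $ i + s $ j \<noteq> 0 then (d $ i + d $ j) / (s $ i + s $ j) else 0)
            * ((M $$ (i, j) - cnj (M $$ (j, i))) / 2)"
        using ij True by (simp add: div_diff_part_def s)
      moreover have "x * (y / 2) + u * (z / 2) = (x * y + u * z) / 2" for x y u z :: complex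
        by (simp add: add_divide_distrib)
      ultimately show ?thesis by (simp only:)
    qed
    ultimately show ?thesis
      by (simp only:) (intro tendsto_divide tendsto_add 1 2 tendsto_const; simp)
  next
    case False
    have "(\<lambda>k. - Q k $$ (i, j) * of_real (d $ i) / of_real (t k))
        \<longlonglongrightarrow> of_real (if s $ i \<noteq> 0 then d $ i / s $ i else 0) * M $$ (i, j)"
    proof (rule quotient_limit[of _ "\<lambda>k. s $ i" _ "\<lambda>k. a k $$ (i, j)"])
      show "- Q k $$ (i, j) * of_real (s $ i) = of_real (t k) * a k $$ (i, j)" for k
        using entry_left_tail[of i j k] False ij by (simp add: add_eq_0_iff mult.commute)
      show "s $ i = 0 \<Longrightarrow> d $ i = 0" using d[of i i "- 1"] ij by simp
    qed (use t_pos ij entry_limits in auto)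
    moreover have "?R k $$ (i, j) = - Q k $$ (i, j) * of_real (d $ i) / of_real (t k)" for k
      unfolding R using False by simp
    ultimately show ?thesis using False ij by (simp add: div_diff_part_def s)
  qed
qed (auto simp: div_diff_part_def s)

text \<open>In the limiting bases the difference quotient splits into \<open>P [Diag((d\<^sub>k - d) / t) 0] Q\<^sup>*\<close>, where the values of \<open>g\<close> move, and
  \<open>(P [Diag(d) 0] - [Diag(d) 0] Q) Q\<^sup>* / t\<close>, where the bases move.\<close>

theorem spectral_limit:
  assumes d: "\<And>i j c. i < m \<Longrightarrow> j < m \<Longrightarrow> c \<in> {1, - 1} \<Longrightarrow> s $ j = c * s $ i \<Longrightarrow> d $ j = c * d $ i"
    and ds: "\<And>i. i < m \<Longrightarrow> (\<lambda>k. (ds k $ i - d $ i) / t k) \<longlonglongrightarrow> p $ i"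
  shows "entries_tendsto (\<lambda>k. of_real (1 / t k) \<cdot>\<^sub>m
      (Us k * rect_diag m n (ds k) * adj (Vs k) - U * rect_diag m n d * adj V))
    (U * (div_diff_part n s d M + rect_diag m n p) * adj V)"
proof -
  define E where "E k = rect_diag m n (vec m (\<lambda>i. (ds k $ i - d $ i) / t k))" for k
  define R where "R k = of_real (1 / t k) \<cdot>\<^sub>m (P k * rect_diag m n d - rect_diag m n d * Q k)" for k
  have dE: "dim_row (E k) = m" "dim_col (E k) = n" for k by (simp_all add: E_def)
  have E_lim: "entries_tendsto E (rect_diag m n p)"
    unfolding entries_tendsto_def
  proof (intro conjI allI impI)
    fix i j assume "i < dim_row (rect_diag m n p)" "j < dim_col (rect_diag m n p)"
    then have ij: "i < m" "j < n" by auto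
    have "(\<lambda>k. complex_of_real (if i = j then (ds k $ i - d $ i) / t k else 0))
        \<longlonglongrightarrow> complex_of_real (if i = j then p $ i else 0)"
      using ds[OF ij(1)] by (intro tendsto_of_real, cases "i = j") simp_all
    then show "(\<lambda>k. E k $$ (i, j)) \<longlonglongrightarrow> rect_diag m n p $$ (i, j)"
      using ij by (cases "i = j") (simp_all add: E_def)
  qed (simp_all add: dE)
  have R_lim: "entries_tendsto R (div_diff_part n s d M)"
    unfolding R_def by (rule commutator_limit[OF d])
  have dim_diff: "dim_row (div_diff_part n s d M) = m" "dim_col (div_diff_part n s d M) = n"
    by (simp_all add: div_diff_part_def s)
  have "entries_tendsto (\<lambda>k. U * (R k * adj (Q k) + P k * E k * adj (Q k)) * adj V)
      (U * (div_diff_part n s d M * adj (1\<^sub>m n) + 1\<^sub>m m * rect_diag m n p * adj (1\<^sub>m n)) * adj V)"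
    by (intro entries_tendsto_mult entries_tendsto_add entries_tendsto_const entries_tendsto_adjoint
        R_lim E_lim P_lim Q_lim) (simp_all add: dims dim_diff)
  moreover have "adj (1\<^sub>m n) = (1\<^sub>m n :: complex mat)" by (rule eq_matI) auto
  moreover have "U * (R k * adj (Q k) + P k * E k * adj (Q k)) * adj V
     = of_real (1 / t k) \<cdot>\<^sub>m
        (Us k * rect_diag m n (ds k) * adj (Vs k) - U * rect_diag m n d * adj V)" for k
  proof -
    have R: "U * R k * adj (Q k) * adj V = of_real (1 / t k) \<cdot>\<^sub>m
        (Us k * rect_diag m n d * adj (Vs k) - U * rect_diag m n d * adj V)"
      unfolding R_def P_def Q_def
      by (simp add: dim_algebra dims unitaries_simps[OF U] unitaries_simps[OF V] unitaries_simps[OF Vs])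
    have E: "U * P k * E k * adj (Q k) * adj V = Us k * E k * adj (Vs k)"
      unfolding P_def Q_def
      by (simp add: dim_algebra dims dE unitaries_simps[OF U] unitaries_simps[OF V])
    have "E k = of_real (1 / t k) \<cdot>\<^sub>m (rect_diag m n (ds k) - rect_diag m n d)"
      unfolding E_def by (rule eq_matI) auto
    then have E': "Us k * E k * adj (Vs k) = of_real (1 / t k) \<cdot>\<^sub>m
        (Us k * rect_diag m n (ds k) * adj (Vs k) - Us k * rect_diag m n d * adj (Vs k))"
      by (simp add: dim_algebra dims)
    have "U * (R k * adj (Q k) + P k * E k * adj (Q k)) * adj V
       = U * R k * adj (Q k) * adj V + U * P k * E k * adj (Q k) * adj V"
      by (simp add: dim_algebra dims dE R_def)
    then show ?thesis unfolding R E E'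
      by (intro eq_matI) (auto simp: dims algebra_simps)
  qed
  ultimately show ?thesis
    by (simp add: dim_diff)
qed

end

section \<open>Index blocks\<close>

lemma pick_interval: "k < e - l \<Longrightarrow> pick {l..<e} k = l + (k :: nat)"
proof (induction k)
  case 0
  then show ?case by (auto intro!: Least_equality)
next
  case (Suc k)
  then show ?case by (auto intro!: Least_equality)
qed

lemma sum_offset:
  fixes l e :: nat
  shows "(\<Sum>k<e - l. f (l + k)) = (\<Sum>k\<in>{l..<e}. f k)"
  by (rule sum.reindex_bij_witness[of _ "\<lambda>k. k - l" "\<lambda>k. l + k"]) auto

lemma col_sub_interval:
  assumes "e \<le> dim_col Y"
  shows "col_sub Y {l..<e} = mat (dim_row Y) (e - l) (\<lambda>(i, j). Y $$ (i, l + j))"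
proof -
  have "{j. j < dim_col Y \<and> j \<in> {l..<e}} = {l..<e}" using assms by auto
  then show ?thesis
    by (intro eq_matI) (auto simp: col_sub_def submatrix_def pick_UNIV pick_interval)
qed

lemma subvec_interval: "subvec x {l..<e} = vec (e - l) (\<lambda>k. x $ (l + k))"
  by (intro eq_vecI) (auto simp: subvec_def pick_interval)

lemma hcat_entry:
  assumes "i < dim_row P" "dim_row Q = dim_row P" "j < dim_col P + dim_col Q"
  shows "hcat P Q $$ (i, j) = (if j < dim_col P then P $$ (i, j) else Q $$ (i, j - dim_col P))"
  using assms by (simp add: hcat_def)

lemma dim_hcat [simp]: "dim_row (hcat P Q) = dim_row P" "dim_col (hcat P Q) = dim_col P + dim_col Q"
  by (simp_all add: hcat_def)

text \<open>Compressing to contiguous sets of columns only shifts the indices of \<open>U\<^sup>* H V\<close>.\<close>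

lemma compression_entry:
  fixes U H V :: "complex mat"
  assumes "dim_row U = dim_row H" "dim_row V = dim_col H" "e \<le> dim_col U" "e' \<le> dim_col V"
    and "i < e - l" "j < e' - l'"
  shows "(adj (col_sub U {l..<e}) * H * col_sub V {l'..<e'}) $$ (i, j)
    = (adj U * H * V) $$ (l + i, l' + j)"
  using assms by (simp add: col_sub_interval mult_entry)

text \<open>As the singular values are ordered, the blocks \<open>a\<^sub>1, \<dots>, a\<^sub>r\<close> are adjacent intervals. This is what makes
  concatenation of vectors and block diagonal assembly of matrices the identity on indices.\<close>

fun consecutive :: "nat \<Rightarrow> nat set list \<Rightarrow> nat \<Rightarrow> bool" where
  "consecutive l [] e \<longleftrightarrow> l = e"
| "consecutive l (J # Js) e \<longleftrightarrow> (\<exists>l' \<ge> l. J = {l..<l'} \<and> consecutive l' Js e)"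

lemma consecutive_le: "consecutive l Js e \<Longrightarrow> l \<le> e"
  by (induction Js arbitrary: l) force+

lemma consecutive_subset: "consecutive l Js e \<Longrightarrow> J \<in> set Js \<Longrightarrow> J \<subseteq> {l..<e}"
proof (induction Js arbitrary: l)
  case (Cons J' Js)
  then obtain l' where l': "l \<le> l'" "J' = {l..<l'}" "consecutive l' Js e" by auto
  have "l' \<le> e" using consecutive_le[OF l'(3)] .
  then have "{l'..<e} \<subseteq> {l..<e}" "{l..<l'} \<subseteq> {l..<e}" using l'(1) by auto
  moreover have "J = {l..<l'} \<or> J \<subseteq> {l'..<e}"
    using Cons.IH[OF l'(3)] Cons.prems(2) l'(2) by auto
  ultimately show ?case by blast
qed simp

lemma consecutive_interval: "consecutive l Js e \<Longrightarrow> J \<in> set Js \<Longrightarrow> \<exists>l' e'. J = {l'..<e'} \<and> l' \<le> e' \<and> e' \<le> e"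
proof (induction Js arbitrary: l)
  case (Cons J' Js)
  then obtain l' where l': "l \<le> l'" "J' = {l..<l'}" "consecutive l' Js e" by auto
  have "l' \<le> e" using consecutive_le[OF l'(3)] .
  then show ?case using Cons.IH[OF l'(3)] Cons.prems(2) l'(1,2) by auto
qed simp

lemma initial_segment:
  fixes l e :: nat
  assumes J: "J \<subseteq> {l..<e}" and down: "\<And>i j. j \<in> J \<Longrightarrow> l \<le> i \<Longrightarrow> i \<le> j \<Longrightarrow> i \<in> J"
  shows "\<exists>l'\<ge>l. J = {l..<l'}"
proof (cases "J = {}")
  case False
  have "finite J" using J finite_subset by blast
  then have "Max J \<in> J" "\<And>i. i \<in> J \<Longrightarrow> i \<le> Max J" using False by auto
  then have "J = {l..<Suc (Max J)}" using J down by (auto simp: less_Suc_eq_le)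
  moreover have "l \<le> Max J" using \<open>Max J \<in> J\<close> J by auto
  ultimately show ?thesis by (meson le_SucI)
qed auto

text \<open>By induction on the list of values: the level set of the largest value is an initial segment of the
  remaining interval, because \<open>s\<close> is non-increasing.\<close>

lemma level_sets_consecutive:
  assumes s: "nonincreasing s" and vs: "sorted_wrt (>) vs" and "l \<le> e"
    and "{i. i < dim_vec s \<and> s $ i \<in> set vs} = {l..<e}"
  shows "consecutive l (map (\<lambda>nu. {i. i < dim_vec s \<and> s $ i = nu}) vs) e"
  using assms(2-)
proof (induction vs arbitrary: l)
  case Nil
  then show ?case by auto
next
  case (Cons v vs)
  let ?J = "{i. i < dim_vec s \<and> s $ i = v}"
  have sub: "?J \<subseteq> {l..<e}" using Cons.prems(3) by auto
  have "\<exists>l'\<ge>l. ?J = {l..<l'}"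
  proof (rule initial_segment[OF sub])
    fix i j assume j: "j \<in> ?J" and ij: "l \<le> i" "i \<le> j"
    have "i \<in> {l..<e}" using sub j ij by auto
    then have i: "i < dim_vec s" "s $ i \<in> set (v # vs)" using Cons.prems(3) by blast+
    have "v \<le> s $ i" using s j ij by (auto simp: nonincreasing_def)
    moreover have "s $ i \<le> v" using i(2) Cons.prems(1) by auto
    ultimately show "i \<in> ?J" using i by simp
  qed
  then obtain l' where l': "l \<le> l'" "?J = {l..<l'}" by blast
  have "{i. i < dim_vec s \<and> s $ i \<in> set vs} = {i. i < dim_vec s \<and> s $ i \<in> set (v # vs)} - ?J"
    using Cons.prems(1) by auto
  also have "\<dots> = {l..<e} - {l..<l'}" using Cons.prems(3) l'(2) by simp
  also have "\<dots> = {max l l'..<e}" using l'(1) by auto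
  finally have rest: "{i. i < dim_vec s \<and> s $ i \<in> set vs} = {l'..<e}" using l'(1) by simp
  have "l' \<le> e"
  proof (cases "l = l'")
    case False
    then have "l' - 1 \<in> ?J" unfolding l'(2) using l'(1) by auto
    then have "l' - 1 \<in> {l..<e}" using sub by blast
    then show ?thesis by auto
  qed (use Cons.prems(2) in simp)
  then have "consecutive l' (map (\<lambda>nu. {i. i < dim_vec s \<and> s $ i = nu}) vs) e"
    using Cons.IH[of l'] Cons.prems(1) rest by simp
  then show ?case using l' by auto
qed

lemma a_set_interval:
  assumes s: "nonincreasing s"
  shows "a_set s = {0..<card (a_set s)}"
proof -
  have "\<exists>l'\<ge>0. a_set s = {0..<l'}"
  proof (rule initial_segment)
    show "a_set s \<subseteq> {0..<dim_vec s}" by (auto simp: a_set_def)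
    show "i \<in> a_set s" if "j \<in> a_set s" "i \<le> j" for i j
    proof -
      have "s $ j \<le> s $ i" "0 < s $ j" "i < dim_vec s"
        using s that by (auto simp: a_set_def nonincreasing_def)
      then show ?thesis by (simp add: a_set_def)
    qed
  qed
  then obtain l' where "a_set s = {0..<l'}" by blast
  then show ?thesis by simp
qed

lemma a_set_le: "card (a_set s) \<le> dim_vec s"
  using card_mono[of "{..<dim_vec s}" "a_set s"] by (auto simp: a_set_def)

lemma a_blocks_consecutive:
  assumes s: "nonincreasing s"
  shows "consecutive 0 (a_blocks s) (card (a_set s))"
  unfolding a_blocks_def
proof (rule level_sets_consecutive[OF s])
  let ?S = "(\<lambda>i. s $ i) ` a_set s"
  have fin: "finite ?S" by (auto simp: a_set_def)
  show "sorted_wrt (>) (rev (sorted_list_of_set ?S))"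
    using strict_sorted_list_of_set[of ?S] by (simp add: sorted_wrt_rev)
  have "{i. i < dim_vec s \<and> s $ i \<in> set (rev (sorted_list_of_set ?S))} = a_set s"
    using fin by (auto simp: a_set_def)
  then show "{i. i < dim_vec s \<and> s $ i \<in> set (rev (sorted_list_of_set ?S))} = {0..<card (a_set s)}"
    using a_set_interval[OF s] by simp
qed simp

lemma b_set_interval:
  assumes s: "nonincreasing s" and nonneg: "\<And>i. i < dim_vec s \<Longrightarrow> s $ i \<ge> 0"
  shows "b_set s = {card (a_set s)..<dim_vec s}"
proof -
  have "b_set s = {0..<dim_vec s} - a_set s"
    using nonneg by (fastforce simp: b_set_def a_set_def)
  also have "\<dots> = {0..<dim_vec s} - {0..<card (a_set s)}" using a_set_interval[OF s] by simp
  finally show ?thesis by auto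
qed

lemma a_blocks_level:
  assumes "J \<in> set (a_blocks s)" "i \<in> J"
  shows "k < dim_vec s \<Longrightarrow> k \<in> J \<longleftrightarrow> s $ k = s $ i" "s $ i > 0" "i < dim_vec s"
  using assms by (auto simp: a_blocks_def a_set_def)

lemma a_blocks_cover:
  assumes "i \<in> a_set s" "j < dim_vec s" "s $ j = s $ i"
  shows "\<exists>J\<in>set (a_blocks s). i \<in> J \<and> j \<in> J"
proof -
  have "finite ((\<lambda>i. s $ i) ` a_set s)" by (auto simp: a_set_def)
  then show ?thesis using assms
    by (intro bexI[of _ "{k. k < dim_vec s \<and> s $ k = s $ i}"]) (auto simp: a_blocks_def a_set_def)
qed

lemma concat_consecutive:
  assumes "consecutive l Js e"
  shows "concat (map (\<lambda>J. list_of_vec (subvec h J)) Js) = map (\<lambda>i. h $ i) [l..<e]"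
  using assms
proof (induction Js arbitrary: l)
  case (Cons J Js)
  then obtain l' where l': "l \<le> l'" "J = {l..<l'}" "consecutive l' Js e" by auto
  have "list_of_vec (subvec h J) = map (\<lambda>i. h $ i) [l..<l']"
    unfolding l'(2) subvec_interval by (rule nth_equalityI) (auto simp: list_of_vec_index)
  moreover have "[l..<e] = [l..<l'] @ [l'..<e]"
    using upt_add_eq_append[OF l'(1), of "e - l'"] consecutive_le[OF l'(3)] by simp
  ultimately show ?case using Cons.IH[OF l'(3)] by simp
qed simp

text \<open>A block diagonal matrix is recovered from its diagonal blocks when these are indexed by adjacent
  intervals.\<close>

lemma diag_block_mat_consecutive:
  assumes "consecutive l Js e"
    and "\<And>i j. l \<le> i \<Longrightarrow> i < e \<Longrightarrow> l \<le> j \<Longrightarrow> j < e \<Longrightarrow> (\<And>J. J \<in> set Js \<Longrightarrow> \<not> (i \<in> J \<and> j \<in> J)) \<Longrightarrow> f i j = 0"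
  shows "diag_block_mat (map (\<lambda>J. mat (card J) (card J) (\<lambda>(q, r). f (pick J q) (pick J r))) Js)
     = mat (e - l) (e - l) (\<lambda>(i, j). f (l + i) (l + j))"
  using assms
proof (induction Js arbitrary: l)
  case Nil
  then show ?case by (intro eq_matI) auto
next
  case (Cons J Js)
  then obtain l' where l': "l \<le> l'" "J = {l..<l'}" "consecutive l' Js e" by auto
  have l'e: "l' \<le> e" using consecutive_le[OF l'(3)] .
  have sub: "J' \<subseteq> {l'..<e}" if "J' \<in> set Js" for J' using consecutive_subset[OF l'(3) that] .
  have IH: "diag_block_mat (map (\<lambda>J. mat (card J) (card J) (\<lambda>(q, r). f (pick J q) (pick J r))) Js)
     = mat (e - l') (e - l') (\<lambda>(i, j). f (l' + i) (l' + j))"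
  proof (rule Cons.IH[OF l'(3)])
    fix i j assume ij: "l' \<le> i" "i < e" "l' \<le> j" "j < e" and none: "\<And>J. J \<in> set Js \<Longrightarrow> \<not> (i \<in> J \<and> j \<in> J)"
    show "f i j = 0"
      by (rule Cons.prems(2)) (use ij l' none in auto)
  qed
  have off: "f i j = 0" "f j i = 0" if ij: "l \<le> i" "i < l'" "l' \<le> j" "j < e" for i j
  proof -
    have none: "\<not> (i \<in> J' \<and> j \<in> J')" if "J' \<in> set (J # Js)" for J'
    proof (cases "J' = J")
      case False
      then have "J' \<subseteq> {l'..<e}" using that sub by auto
      then show ?thesis using ij(2) by fastforce
    qed (use ij l'(2) in auto)
    have le: "l \<le> i" "i < e" "l \<le> j" "j < e" using ij l'(1) l'e by auto
    show "f i j = 0" using none by (rule Cons.prems(2)[OF le])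
    show "f j i = 0" using none by (intro Cons.prems(2)[OF le(3,4,1,2)]) blast
  qed
  show ?case
    unfolding list.map diag_block_mat.simps IH Let_def l'(2)
    by (rule eq_matI) (use l'(1) l'e off in \<open>auto simp: pick_interval add.commute\<close>)
qed

definition diag_block :: "complex mat \<Rightarrow> nat \<Rightarrow> nat \<Rightarrow> complex mat" where
  "diag_block P l e = mat (e - l) (e - l) (\<lambda>(q, r). P $$ (l + q, l + r))"

lemma dim_diag_block [simp]: "dim_row (diag_block P l e) = e - l" "dim_col (diag_block P l e) = e - l"
  by (simp_all add: diag_block_def)

lemma diag_block_product_entry:
  assumes "q < e - l" "r < e' - l" "e \<le> e'"
  shows "(diag_block P l e * rect_diag (e - l) (e' - l) (subvec p {l..<e}) * adj (diag_block Q l e')) $$ (q, r)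
    = (\<Sum>k\<in>{l..<e}. P $$ (l + q, k) * of_real (p $ k) * cnj (Q $$ (l + r, k)))"
proof -
  have "(diag_block P l e * rect_diag (e - l) (e' - l) (subvec p {l..<e}) * adj (diag_block Q l e')) $$ (q, r)
    = (\<Sum>k<e - l. P $$ (l + q, l + k) * of_real (p $ (l + k)) * cnj (Q $$ (l + r, l + k)))"
    using assms by (subst rect_diag_product_entry) (auto simp: diag_block_def subvec_interval)
  also have "\<dots> = (\<Sum>k\<in>{l..<e}. P $$ (l + q, k) * of_real (p $ k) * cnj (Q $$ (l + r, k)))"
    by (rule sum_offset)
  finally show ?thesis .
qed

lemma diag_block_unitary:
  assumes P: "P \<in> unitaries K p" and e: "e \<le> p"
    and zero: "\<And>i k. i < p \<Longrightarrow> k < p \<Longrightarrow> i \<notin> {l..<e} \<Longrightarrow> k \<in> {l..<e} \<Longrightarrow> P $$ (i, k) = 0"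
  shows "diag_block P l e \<in> unitaries K (e - l)"
proof (rule unitariesI)
  show "diag_block P l e \<in> mats K (e - l) (e - l)"
    using e by (intro matsI) (auto simp: diag_block_def intro: mats_entry[OF unitaries_mats[OF P]])
  fix i j assume ij: "i < e - l" "j < e - l"
  then have "(\<Sum>k<e - l. cnj (diag_block P l e $$ (k, i)) * diag_block P l e $$ (k, j))
      = (\<Sum>k<e - l. cnj (P $$ (l + k, l + i)) * P $$ (l + k, l + j))"
    by (intro sum.cong) (auto simp: diag_block_def)
  also have "\<dots> = (\<Sum>k\<in>{l..<e}. cnj (P $$ (k, l + i)) * P $$ (k, l + j))"
    by (rule sum_offset)
  also have "\<dots> = (\<Sum>k<p. cnj (P $$ (k, l + i)) * P $$ (k, l + j))"
    using e ij zero by (intro sum.mono_neutral_left) auto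
  also have "\<dots> = (if i = j then 1 else 0)"
    using unitaries_left_entry[OF P, of "l + i" "l + j"] ij e by simp
  finally show "(\<Sum>k<e - l. cnj (diag_block P l e $$ (k, i)) * diag_block P l e $$ (k, j)) = (if i = j then 1 else 0)" .
qed

section \<open>Change of singular basis\<close>

text \<open>\<open>A\<close> and \<open>B\<close> are the transition matrices between two pairs of singular bases of the same
  matrix, whose singular values are \<open>s\<close>.\<close>

locale svd_basis_change = base_field K for K :: "complex set" +
  fixes m n :: nat and A B :: "complex mat" and s :: "real vec"
  assumes mn: "m \<le> n" and A: "A \<in> unitaries K m" and B: "B \<in> unitaries K n"
    and s: "dim_vec s = m" and s_mono: "nonincreasing s" and s_nonneg: "\<And>i. i < m \<Longrightarrow> s $ i \<ge> 0"
    and AB: "A * rect_diag m n s = rect_diag m n s * B"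
    and BA: "B * rect_diag n m s = rect_diag n m s * A"
begin

text \<open>Indices from \<open>m\<close> on, which only \<open>B\<close> has, take part in the block of the singular value 0.\<close>

definition "s_ext i = (if i < m then s $ i else 0)"

lemma AB_entries:
  assumes "i < m" "j < m"
  shows "A $$ (i, j) * of_real (s $ j) = of_real (s $ i) * B $$ (i, j)"
    and "B $$ (i, j) * of_real (s $ j) = of_real (s $ i) * A $$ (i, j)"
  using arg_cong[OF AB, of "\<lambda>M. M $$ (i, j)"] arg_cong[OF BA, of "\<lambda>M. M $$ (i, j)"] assms mn
  by (simp_all add: rect_diag_entries unitaries_dim[OF A] unitaries_dim[OF B])

lemma AB_zero:
  assumes "i < m" "j < m" "s $ i \<noteq> s $ j"
  shows "A $$ (i, j) = 0" "B $$ (i, j) = 0"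
proof -
  have "(A $$ (i, j) + B $$ (i, j)) * of_real (s $ j - s $ i) = 0"
    "(A $$ (i, j) - B $$ (i, j)) * of_real (s $ j + s $ i) = 0"
    using AB_entries[OF assms(1,2)] by (simp_all add: algebra_simps)
  moreover have "s $ j - s $ i \<noteq> 0" "s $ j + s $ i \<noteq> 0"
    using assms s_nonneg[OF assms(1)] s_nonneg[OF assms(2)] by auto
  ultimately have "A $$ (i, j) + B $$ (i, j) = 0" "A $$ (i, j) - B $$ (i, j) = 0"
    unfolding mult_eq_0_iff of_real_eq_0_iff by simp_all
  then show "A $$ (i, j) = 0" "B $$ (i, j) = 0" by auto
qed

lemma A_zero: "i < m \<Longrightarrow> j < m \<Longrightarrow> s_ext i \<noteq> s_ext j \<Longrightarrow> A $$ (i, j) = 0"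
  using AB_zero by (simp add: s_ext_def)

lemma B_zero:
  assumes "i < n" "j < n" "s_ext i \<noteq> s_ext j"
  shows "B $$ (i, j) = 0"
proof -
  consider "i < m" "j < m" | "i < m" "j \<ge> m" | "i \<ge> m" "j < m" | "i \<ge> m" "j \<ge> m" by linarith
  then show ?thesis
  proof cases
    case 1
    then show ?thesis using AB_zero assms by (simp add: s_ext_def)
  next
    case 2
    then show ?thesis using arg_cong[OF AB, of "\<lambda>M. M $$ (i, j)"] assms mn
      by (simp add: s_ext_def rect_diag_entries unitaries_dim[OF A] unitaries_dim[OF B])
  next
    case 3
    then show ?thesis using arg_cong[OF BA, of "\<lambda>M. M $$ (i, j)"] assms mn
      by (simp add: s_ext_def rect_diag_entries unitaries_dim[OF A] unitaries_dim[OF B])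
  qed (use assms in \<open>simp add: s_ext_def\<close>)
qed

lemma A_eq_B:
  assumes "i < m" "j < m" "s $ i \<noteq> 0 \<or> s $ j \<noteq> 0"
  shows "A $$ (i, j) = B $$ (i, j)"
proof (cases "s $ i = s $ j")
  case True
  then show ?thesis using AB_entries(1)[OF assms(1,2)] assms by (simp add: mult.commute)
qed (use AB_zero assms in simp)

lemma conj_entry:
  assumes M: "dim_row M = m" "dim_col M = n" and ij: "i < m" "j < n"
  shows "(A * M * adj B) $$ (i, j) = (\<Sum>k<m. \<Sum>l<n. A $$ (i, k) * M $$ (k, l) * cnj (B $$ (j, l)))"
proof -
  have "(A * M * adj B) $$ (i, j) = (\<Sum>l<n. \<Sum>k<m. A $$ (i, k) * M $$ (k, l) * cnj (B $$ (j, l)))"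
    using assms by (simp add: mult_entry unitaries_dim[OF A] unitaries_dim[OF B] sum_distrib_right)
  also have "\<dots> = (\<Sum>k<m. \<Sum>l<n. A $$ (i, k) * M $$ (k, l) * cnj (B $$ (j, l)))"
    by (rule sum.swap)
  finally show ?thesis .
qed

text \<open>Every entry of the divided difference part has the form \<open>c\<^sub>1 M\<^sub>i\<^sub>j + c\<^sub>2 M\<^sub>j\<^sub>i\<^sup>*\<close>, with coefficients that depend only on
  the singular values at \<open>i\<close> and \<open>j\<close>, and \<open>c\<^sub>2 = 0\<close> when one of them is 0. Block diagonality of \<open>A\<close> and \<open>B\<close>
  moves \<open>c\<^sub>1\<close> through the conjugation. For the second term \<open>A\<close> and \<open>B\<close> exchange their roles, which does no harm
  because they agree on the blocks where \<open>c\<^sub>2\<close> can be nonzero.\<close>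

lemma div_diff_part_conj:
  assumes d: "\<And>i j c. i < m \<Longrightarrow> j < m \<Longrightarrow> c \<in> {1, - 1} \<Longrightarrow> s $ j = c * s $ i \<Longrightarrow> d $ j = c * d $ i"
    and M: "dim_row M = m" "dim_col M = n"
  shows "div_diff_part n s d (A * M * adj B) = A * div_diff_part n s d M * adj B"
proof -
  define dx where "dx i = (if i < m then d $ i else 0)" for i
  define e1 where "e1 i j = (if s_ext i \<noteq> s_ext j then (dx i - dx j) / (s_ext i - s_ext j) else 0)" for i j
  define e2 where "e2 i j = (if s_ext i + s_ext j \<noteq> 0 then (dx i + dx j) / (s_ext i + s_ext j) else 0)" for i j
  define c1 where "c1 i j = (e1 i j + e2 i j) / 2" for i j
  define c2 where "c2 i j = (e1 i j - e2 i j) / 2" for i j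
  have d0: "d $ i = 0" if "i < m" "s $ i = 0" for i using d[of i i "- 1"] that by simp
  \<comment> \<open>The value of \<open>g\<close>, extended by 0, depends only on the singular value, extended by 0.\<close>
  have dx: "dx i = dx j" if "s_ext i = s_ext j" for i j
    using that d[of i j 1] d0 by (auto simp: dx_def s_ext_def split: if_splits)
  have c1_cong: "c1 i j = c1 k l" and c2_cong: "c2 i j = c2 k l" if "s_ext i = s_ext k" "s_ext j = s_ext l" for i j k l
    using that dx[OF that(1)] dx[OF that(2)] by (simp_all add: c1_def c2_def e1_def e2_def)
  have dx0: "dx i = 0" if "s_ext i = 0" for i using that d0 by (auto simp: dx_def s_ext_def split: if_splits)
  have c2_zero: "c2 i j = 0" if "s_ext i = 0 \<or> s_ext j = 0" for i j
    using that dx0[of i] dx0[of j] by (auto simp: c2_def e1_def e2_def)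
  have entry: "div_diff_part n s d W $$ (i, j) = of_real (c1 i j) * W $$ (i, j)
      + of_real (c2 i j) * (if j < m then cnj (W $$ (j, i)) else 0)"
    if "i < m" "j < n" for W i j
  proof (cases "j < m")
    case True
    have "div_diff_part n s d W $$ (i, j) = of_real (e1 i j) * ((W $$ (i, j) + cnj (W $$ (j, i))) / 2)
        + of_real (e2 i j) * ((W $$ (i, j) - cnj (W $$ (j, i))) / 2)"
      using that True by (simp add: div_diff_part_def s e1_def e2_def s_ext_def dx_def)
    then show ?thesis using True by (simp add: c1_def c2_def field_simps)
  next
    case False
    have "e1 i j = e2 i j" "e1 i j = (if s $ i \<noteq> 0 then d $ i / s $ i else 0)"
      using False that by (auto simp: e1_def e2_def s_ext_def dx_def)
    then show ?thesis using False that by (simp add: div_diff_part_def s c1_def c2_def)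
  qed
  let ?W = "A * M * adj B"
  have dims: "dim_row (div_diff_part n s d M) = m" "dim_col (div_diff_part n s d M) = n"
    by (simp_all add: div_diff_part_def s)
  show ?thesis
  proof (rule eq_matI)
    fix i j assume "i < dim_row (A * div_diff_part n s d M * adj B)"
      "j < dim_col (A * div_diff_part n s d M * adj B)"
    then have ij: "i < m" "j < n" by (simp_all add: unitaries_dim[OF A] unitaries_dim[OF B])
    have first: "of_real (c1 i j) * ?W $$ (i, j)
      = (\<Sum>k<m. \<Sum>l<n. A $$ (i, k) * (of_real (c1 k l) * M $$ (k, l)) * cnj (B $$ (j, l)))"
      unfolding conj_entry[OF M ij] sum_distrib_left
    proof (intro sum.cong refl)
      fix k l assume kl: "k \<in> {..<m}" "l \<in> {..<n}"
      show "of_real (c1 i j) * (A $$ (i, k) * M $$ (k, l) * cnj (B $$ (j, l)))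
        = A $$ (i, k) * (of_real (c1 k l) * M $$ (k, l)) * cnj (B $$ (j, l))"
        using A_zero[of i k] B_zero[of j l] c1_cong[of i k j l] kl ij
        by (cases "s_ext i = s_ext k \<and> s_ext j = s_ext l") auto
    qed
    have second: "of_real (c2 i j) * (if j < m then cnj (?W $$ (j, i)) else 0)
      = (\<Sum>k<m. \<Sum>l<n. A $$ (i, k) * (of_real (c2 k l) * (if l < m then cnj (M $$ (l, k)) else 0)) * cnj (B $$ (j, l)))"
    proof (cases "s_ext i = 0 \<or> s_ext j = 0")
      case True
      have "A $$ (i, k) * (of_real (c2 k l) * (if l < m then cnj (M $$ (l, k)) else 0)) * cnj (B $$ (j, l)) = 0"
        if kl: "k < m" "l < n" for k l
        using A_zero[of i k] B_zero[of j l] c2_zero[of k l] kl ij True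
        by (cases "s_ext i = s_ext k \<and> s_ext j = s_ext l") auto
      then have "(\<Sum>k<m. \<Sum>l<n. A $$ (i, k) * (of_real (c2 k l) * (if l < m then cnj (M $$ (l, k)) else 0)) * cnj (B $$ (j, l))) = 0"
        by (intro sum.neutral ballI) auto
      then show ?thesis using c2_zero[OF True] by simp
    next
      case False
      then have j: "j < m" and si: "s $ i \<noteq> 0" and sj: "s $ j \<noteq> 0" using ij by (auto simp: s_ext_def split: if_splits)
      have i_n: "i < n" using ij mn by simp
      have "of_real (c2 i j) * cnj (?W $$ (j, i))
          = (\<Sum>l<m. \<Sum>k<n. of_real (c2 i j) * (cnj (A $$ (j, l)) * cnj (M $$ (l, k)) * B $$ (i, k)))"
        by (simp add: conj_entry[OF M j i_n] sum_distrib_left)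
      also have "\<dots> = (\<Sum>l<m. \<Sum>k<m. of_real (c2 i j) * (cnj (A $$ (j, l)) * cnj (M $$ (l, k)) * B $$ (i, k)))"
      proof (rule sum.cong[OF refl], rule sum.mono_neutral_right)
        show "\<forall>k\<in>{..<n} - {..<m}. of_real (c2 i j) * (cnj (A $$ (j, l)) * cnj (M $$ (l, k)) * B $$ (i, k)) = 0" for l
        proof
          fix k assume k: "k \<in> {..<n} - {..<m}"
          then have "s_ext i \<noteq> s_ext k" using False by (simp add: s_ext_def)
          then have "B $$ (i, k) = 0" using B_zero[OF i_n, of k] k by simp
          then show "of_real (c2 i j) * (cnj (A $$ (j, l)) * cnj (M $$ (l, k)) * B $$ (i, k)) = 0" by simp
        qed
      qed (use mn in auto)
      also have "\<dots> = (\<Sum>k<m. \<Sum>l<m. of_real (c2 i j) * (cnj (A $$ (j, l)) * cnj (M $$ (l, k)) * B $$ (i, k)))"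
        by (rule sum.swap)
      also have "\<dots> = (\<Sum>k<m. \<Sum>l<m. A $$ (i, k) * (of_real (c2 k l) * cnj (M $$ (l, k))) * cnj (B $$ (j, l)))"
      proof (intro sum.cong refl)
        fix k l assume kl: "k \<in> {..<m}" "l \<in> {..<m}"
        have "A $$ (i, k) = B $$ (i, k)" "A $$ (j, l) = B $$ (j, l)"
          using kl si sj ij j by (auto intro!: A_eq_B)
        then show "of_real (c2 i j) * (cnj (A $$ (j, l)) * cnj (M $$ (l, k)) * B $$ (i, k))
          = A $$ (i, k) * (of_real (c2 k l) * cnj (M $$ (l, k))) * cnj (B $$ (j, l))"
          using A_zero[of i k] A_zero[of j l] c2_cong[of i k j l] kl ij j
          by (cases "s_ext i = s_ext k \<and> s_ext j = s_ext l") auto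
      qed
      also have "\<dots> = (\<Sum>k<m. \<Sum>l<n. A $$ (i, k) * (of_real (c2 k l) * (if l < m then cnj (M $$ (l, k)) else 0)) * cnj (B $$ (j, l)))"
        using mn by (intro sum.cong refl sum.mono_neutral_cong_left) auto
      finally show ?thesis using j by simp
    qed
    have "(A * div_diff_part n s d M * adj B) $$ (i, j)
      = (\<Sum>k<m. \<Sum>l<n. A $$ (i, k) * div_diff_part n s d M $$ (k, l) * cnj (B $$ (j, l)))"
      by (rule conj_entry[OF dims ij])
    also have "\<dots> = (\<Sum>k<m. \<Sum>l<n. A $$ (i, k) * (of_real (c1 k l) * M $$ (k, l)) * cnj (B $$ (j, l)))
      + (\<Sum>k<m. \<Sum>l<n. A $$ (i, k) * (of_real (c2 k l) * (if l < m then cnj (M $$ (l, k)) else 0)) * cnj (B $$ (j, l)))"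
      unfolding sum.distrib[symmetric]
      by (intro sum.cong refl) (simp only: entry lessThan_iff algebra_simps)
    also have "\<dots> = div_diff_part n s d ?W $$ (i, j)"
      unfolding entry[OF ij] first second ..
    finally show "div_diff_part n s d ?W $$ (i, j) = (A * div_diff_part n s d M * adj B) $$ (i, j)" ..
  qed (simp_all add: div_diff_part_def s unitaries_dim[OF A] unitaries_dim[OF B])
qed

end

context svd_basis_change
begin

section \<open>The block form of the directional derivative\<close>

abbreviation "rk \<equiv> card (a_set s)"

lemma rk_le: "rk \<le> m"
  using a_set_le[of s] s by simp

lemma a_set_iff: "i < m \<Longrightarrow> i < rk \<longleftrightarrow> s $ i > 0"
  using a_set_interval[OF s_mono] s by (fastforce simp: a_set_def)

lemma s_ext_zero_iff: "s_ext i = 0 \<longleftrightarrow> rk \<le> i"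
  using a_set_iff[of i] s_nonneg[of i] rk_le by (auto simp: s_ext_def not_less)

lemma b_set_eq: "b_set s = {rk..<m}"
  using b_set_interval[OF s_mono] s_nonneg s by simp

lemma block_interval:
  assumes "J \<in> set (a_blocks s)"
  obtains l e where "J = {l..<e}" "l \<le> e" "e \<le> rk"
  using consecutive_interval[OF a_blocks_consecutive[OF s_mono] assms] by blast

lemma block_level:
  assumes "J \<in> set (a_blocks s)" "i \<in> J"
  shows "i < m" "s $ i > 0" "k < n \<Longrightarrow> k \<in> J \<longleftrightarrow> s_ext k = s_ext i" "k \<in> J \<Longrightarrow> k < m"
proof -
  show "i < m" "s $ i > 0" using a_blocks_level(2,3)[OF assms] s by auto
  show "k < m" if "k \<in> J" using a_blocks_level(3)[OF assms(1) that] s by simp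
  then show "k \<in> J \<longleftrightarrow> s_ext k = s_ext i" if "k < n"
    using a_blocks_level(1)[OF assms, of k] a_blocks_level(3)[OF assms(1), of k] a_blocks_level(2,3)[OF assms] s
    by (cases "k < m") (auto simp: s_ext_def)
qed

lemma conj_entry_block:
  assumes M: "dim_row M = m" "dim_col M = n" and J: "J \<in> set (a_blocks s)" and ij: "i \<in> J" "j \<in> J"
  shows "(A * M * adj B) $$ (i, j) = (\<Sum>k\<in>J. \<Sum>l\<in>J. A $$ (i, k) * M $$ (k, l) * cnj (A $$ (j, l)))"
proof -
  have lt: "k < m" if "k \<in> J" for k using block_level(4)[OF J ij(1) that] .
  have i: "i < m" and jm: "j < m" using lt ij by auto
  have j: "j < m" "j < n" using jm mn by auto
  have "(A * M * adj B) $$ (i, j) = (\<Sum>k<m. \<Sum>l<n. A $$ (i, k) * M $$ (k, l) * cnj (B $$ (j, l)))"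
    by (rule conj_entry[OF M i j(2)])
  also have "\<dots> = (\<Sum>k\<in>J. \<Sum>l<n. A $$ (i, k) * M $$ (k, l) * cnj (B $$ (j, l)))"
  proof (rule sum.mono_neutral_right)
    show "\<forall>k\<in>{..<m} - J. (\<Sum>l<n. A $$ (i, k) * M $$ (k, l) * cnj (B $$ (j, l))) = 0"
    proof
      fix k assume k: "k \<in> {..<m} - J"
      then have "A $$ (i, k) = 0" using block_level(3)[OF J ij(1), of k] A_zero[OF i, of k] mn by auto
      then show "(\<Sum>l<n. A $$ (i, k) * M $$ (k, l) * cnj (B $$ (j, l))) = 0" by simp
    qed
  qed (use lt in auto)
  also have "\<dots> = (\<Sum>k\<in>J. \<Sum>l\<in>J. A $$ (i, k) * M $$ (k, l) * cnj (A $$ (j, l)))"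
  proof (rule sum.cong[OF refl], rule sum.mono_neutral_cong_right)
    show "J \<subseteq> {..<n}" using lt mn by fastforce
    show "\<forall>l\<in>{..<n} - J. A $$ (i, k) * M $$ (k, l) * cnj (B $$ (j, l)) = 0" for k
      using block_level(3)[OF J ij(2)] B_zero[OF j(2)] by fastforce
    show "A $$ (i, k) * M $$ (k, l) * cnj (B $$ (j, l)) = A $$ (i, k) * M $$ (k, l) * cnj (A $$ (j, l))"
      if "l \<in> J" for k l
      using A_eq_B[OF j(1) lt[OF that]] block_level(2)[OF J ij(2)] by simp
  qed auto
  finally show ?thesis .
qed

lemma diag_entry:
  assumes ij: "i < m" "j < n"
  shows "(A * rect_diag m n p * adj B) $$ (i, j) = (\<Sum>k<m. A $$ (i, k) * of_real (p $ k) * cnj (B $$ (j, k)))"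
  using ij mn by (intro rect_diag_product_entry) (auto simp: unitaries_dim[OF A] unitaries_dim[OF B])

lemma diag_entry_zero:
  assumes ij: "i < m" "j < n" "s_ext i \<noteq> s_ext j"
  shows "(A * rect_diag m n p * adj B) $$ (i, j) = 0"
  unfolding diag_entry[OF ij(1,2)]
proof (intro sum.neutral ballI)
  fix k assume k: "k \<in> {..<m}"
  show "A $$ (i, k) * of_real (p $ k) * cnj (B $$ (j, k)) = 0"
    using A_zero[of i k] B_zero[of j k] ij k mn by (cases "s_ext i = s_ext k") auto
qed

lemma diag_entry_block:
  assumes J: "J \<in> set (a_blocks s)" and ij: "i \<in> J" "j \<in> J"
  shows "(A * rect_diag m n p * adj B) $$ (i, j) = (\<Sum>k\<in>J. A $$ (i, k) * of_real (p $ k) * cnj (A $$ (j, k)))"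
proof -
  have lt: "k < m" if "k \<in> J" for k using block_level(4)[OF J ij(1) that] .
  have i: "i < m" and jm: "j < m" using lt ij by auto
  have j: "j < m" "j < n" using jm mn by auto
  show ?thesis
    unfolding diag_entry[OF i j(2)]
  proof (intro sum.mono_neutral_cong_right ballI)
    show "J \<subseteq> {..<m}" using lt by auto
    show "A $$ (i, k) * of_real (p $ k) * cnj (B $$ (j, k)) = 0" if "k \<in> {..<m} - J" for k
      using block_level(3)[OF J ij(1), of k] A_zero[OF i, of k] that mn by auto
    show "A $$ (i, k) * of_real (p $ k) * cnj (B $$ (j, k)) = A $$ (i, k) * of_real (p $ k) * cnj (A $$ (j, k))"
      if "k \<in> J" for k
      using A_eq_B[OF j(1) lt[OF that]] block_level(2)[OF J ij(2)] by simp
  qed simp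
qed

lemma diag_entry_tail:
  assumes ij: "rk \<le> i" "i < m" "rk \<le> j" "j < n"
  shows "(A * rect_diag m n p * adj B) $$ (i, j)
    = (\<Sum>k\<in>{rk..<m}. A $$ (i, k) * of_real (p $ k) * cnj (B $$ (j, k)))"
  unfolding diag_entry[OF ij(2,4)]
proof (intro sum.mono_neutral_right ballI)
  fix k assume k: "k \<in> {..<m} - {rk..<m}"
  then have "s_ext i \<noteq> s_ext k" using s_ext_zero_iff[of i] s_ext_zero_iff[of k] ij by auto
  then show "A $$ (i, k) * of_real (p $ k) * cnj (B $$ (j, k)) = 0"
    using A_zero[of i k] k ij by auto
qed auto

lemma diag_block_A_unitary:
  assumes "J \<in> set (a_blocks s)" "J = {l..<e}" "e \<le> rk"
  shows "diag_block A l e \<in> unitaries K (e - l)"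
proof (rule diag_block_unitary[OF A])
  fix i k assume "i < m" "k < m" "i \<notin> {l..<e}" "k \<in> {l..<e}"
  then show "A $$ (i, k) = 0"
    using block_level(3)[OF assms(1), of k i] assms(2) mn by (intro A_zero) auto
qed (use assms rk_le in auto)

lemma diag_block_tail_unitary:
  "diag_block A rk m \<in> unitaries K (m - rk)" "diag_block B rk n \<in> unitaries K (n - rk)"
proof -
  show "diag_block A rk m \<in> unitaries K (m - rk)"
  proof (rule diag_block_unitary[OF A])
    show "A $$ (i, k) = 0" if "i < m" "k < m" "i \<notin> {rk..<m}" "k \<in> {rk..<m}" for i k
      using that s_ext_zero_iff[of i] s_ext_zero_iff[of k] by (intro A_zero) auto
  qed simp
  show "diag_block B rk n \<in> unitaries K (n - rk)"
  proof (rule diag_block_unitary[OF B])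
    show "B $$ (i, k) = 0" if "i < n" "k < n" "i \<notin> {rk..<n}" "k \<in> {rk..<n}" for i k
      using that s_ext_zero_iff[of i] s_ext_zero_iff[of k] by (intro B_zero) auto
  qed simp
qed

lemma diag_block_A_product:
  assumes J: "J \<in> set (a_blocks s)" "J = {l..<e}" "e \<le> rk"
  shows "diag_block A l e * rect_diag (e - l) (e - l) (subvec p J) * adj (diag_block A l e)
    = mat (e - l) (e - l) (\<lambda>(q, r). (A * rect_diag m n p * adj B) $$ (l + q, l + r))"
  unfolding J(2)
  by (rule eq_matI) (use diag_entry_block[OF J(1)] J(2) in \<open>auto simp: diag_block_product_entry\<close>)

lemma diag_block_tail_product:
  "diag_block A rk m * rect_diag (m - rk) (n - rk) (subvec p {rk..<m}) * adj (diag_block B rk n)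
    = mat (m - rk) (n - rk) (\<lambda>(q, r). (A * rect_diag m n p * adj B) $$ (rk + q, rk + r))"
  by (rule eq_matI) (use mn in \<open>auto simp: diag_block_product_entry diag_entry_tail\<close>)

end

text \<open>\<open>M\<close> is the direction in singular bases that diagonalise the Hermitian parts of its blocks and its
  block at the singular value 0, as the limiting bases of \<open>svd_path\<close> do, and \<open>U\<^sup>* H V\<close> is the same direction in arbitrary singular bases.\<close>

locale adapted_direction = svd_basis_change K m n A B s
  for K m n A B s +
  fixes M :: "complex mat" and h :: "real vec" and U V H :: "complex mat"
  assumes M: "dim_row M = m" "dim_col M = n"
    and h: "dim_vec h = m" "\<And>i. i < m \<Longrightarrow> h $ i = Re (M $$ (i, i))"
    and M_off: "\<And>i j. i < m \<Longrightarrow> j < m \<Longrightarrow> i \<noteq> j \<Longrightarrow> s $ i = s $ j \<Longrightarrow> M $$ (i, j) + cnj (M $$ (j, i)) = 0"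
    and M_zero: "\<And>i j. i < m \<Longrightarrow> j < n \<Longrightarrow> s $ i = 0 \<Longrightarrow> (j < m \<Longrightarrow> s $ j = 0) \<Longrightarrow>
        M $$ (i, j) = (if i = j then of_real (h $ i) else 0)"
    and h_mono: "\<And>i j. i \<le> j \<Longrightarrow> j < m \<Longrightarrow> s $ i = s $ j \<Longrightarrow> h $ j \<le> h $ i"
    and h_nonneg: "\<And>i. i < m \<Longrightarrow> s $ i = 0 \<Longrightarrow> 0 \<le> h $ i"
    and UVH: "dim_row U = m" "dim_col U = m" "dim_row V = n" "dim_col V = n" "dim_row H = m" "dim_col H = n"
      "adj U * H * V = A * M * adj B"
begin

text \<open>Inside a block of a positive singular value \<open>A\<close> and \<open>B\<close> agree, so passing to the Hermitian part commutes with
  the change of basis, and the Hermitian part of the block of \<open>M\<close> is \<open>Diag(h)\<close>.\<close>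

lemma herm_block:
  assumes J: "J \<in> set (a_blocks s)" "J = {l..<e}" "e \<le> rk"
  shows "herm_part (adj (col_sub U J) * H * col_sub V J)
    = diag_block A l e * rect_diag (e - l) (e - l) (subvec h J) * adj (diag_block A l e)"
  unfolding diag_block_A_product[OF J]
proof (rule eq_matI)
  let ?R = "mat (e - l) (e - l) (\<lambda>(q, r). (A * rect_diag m n h * adj B) $$ (l + q, l + r))"
  let ?Y = "adj (col_sub U J) * H * col_sub V J"
  have em: "e \<le> m" "e \<le> n" using J(3) rk_le mn by auto
  have dY: "dim_row ?Y = e - l" "dim_col ?Y = e - l"
    using em UVH by (auto simp: J(2) col_sub_interval)
  show "dim_row (herm_part ?Y) = dim_row ?R"
    "dim_col (herm_part ?Y) = dim_col ?R"
    using dY by (auto simp: herm_part_def simp del: index_mult_mat)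
  fix q r assume "q < dim_row ?R"
    "r < dim_col ?R"
  then have qr: "q < e - l" "r < e - l" by auto
  define i where "i = l + q"
  define j where "j = l + r"
  have ij: "i \<in> J" "j \<in> J" using qr by (auto simp: J(2) i_def j_def)
  have Y: "?Y $$ (q, r) = (A * M * adj B) $$ (l + q, l + r)" if "q < e - l" "r < e - l" for q r
    unfolding UVH(7)[symmetric] J(2) using that em UVH by (intro compression_entry) auto
  have "herm_part ?Y $$ (q, r) = (?Y $$ (q, r) + cnj (?Y $$ (r, q))) / 2"
    using qr dY by (simp add: herm_part_def del: index_mult_mat)
  also have "?Y $$ (q, r) = (\<Sum>k\<in>J. \<Sum>l\<in>J. A $$ (i, k) * M $$ (k, l) * cnj (A $$ (j, l)))"
    unfolding Y[OF qr] i_def[symmetric] j_def[symmetric] by (rule conj_entry_block[OF M J(1) ij])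
  also have "?Y $$ (r, q) = (\<Sum>k\<in>J. \<Sum>l\<in>J. A $$ (j, k) * M $$ (k, l) * cnj (A $$ (i, l)))"
    unfolding Y[OF qr(2,1)] i_def[symmetric] j_def[symmetric] by (rule conj_entry_block[OF M J(1) ij(2,1)])
  also have "cnj (\<Sum>k\<in>J. \<Sum>l\<in>J. A $$ (j, k) * M $$ (k, l) * cnj (A $$ (i, l)))
     = (\<Sum>l\<in>J. \<Sum>k\<in>J. cnj (A $$ (j, l)) * cnj (M $$ (l, k)) * A $$ (i, k))"
    by simp
  also have "\<dots> = (\<Sum>k\<in>J. \<Sum>l\<in>J. cnj (A $$ (j, l)) * cnj (M $$ (l, k)) * A $$ (i, k))"
    by (rule sum.swap)
  also have "(\<Sum>k\<in>J. \<Sum>l\<in>J. A $$ (i, k) * M $$ (k, l) * cnj (A $$ (j, l))) + \<dots>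
     = (\<Sum>k\<in>J. \<Sum>l\<in>J. if l = k then A $$ (i, k) * of_real (2 * h $ k) * cnj (A $$ (j, k)) else 0)"
    unfolding sum.distrib[symmetric]
  proof (intro sum.cong refl)
    fix k l assume kl: "k \<in> J" "l \<in> J"
    have lt: "k < m" "l < m" using block_level(4)[OF J(1) ij(1)] kl by auto
    have "s_ext l = s_ext k" using block_level(3)[OF J(1) kl(1), of l] kl lt mn by auto
    then have "M $$ (k, l) + cnj (M $$ (l, k)) = (if l = k then of_real (2 * h $ k) else 0)"
      using M_off[OF lt] lt h(2)[OF lt(1)] by (auto simp: s_ext_def complex_add_cnj)
    then have "A $$ (i, k) * (M $$ (k, l) + cnj (M $$ (l, k))) * cnj (A $$ (j, l))
       = (if l = k then A $$ (i, k) * of_real (2 * h $ k) * cnj (A $$ (j, k)) else 0)"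
      by simp
    then show "A $$ (i, k) * M $$ (k, l) * cnj (A $$ (j, l)) + cnj (A $$ (j, l)) * cnj (M $$ (l, k)) * A $$ (i, k)
       = (if l = k then A $$ (i, k) * of_real (2 * h $ k) * cnj (A $$ (j, k)) else 0)"
      by (simp only: algebra_simps)
  qed
  also have "\<dots> = (\<Sum>k\<in>J. A $$ (i, k) * of_real (2 * h $ k) * cnj (A $$ (j, k)))"
    using J(2) by (intro sum.cong refl) simp
  also have "\<dots> / 2 = (\<Sum>k\<in>J. A $$ (i, k) * of_real (h $ k) * cnj (A $$ (j, k)))"
    unfolding sum_divide_distrib by (intro sum.cong) auto
  also have "\<dots> = (A * rect_diag m n h * adj B) $$ (l + q, l + r)"
    unfolding i_def[symmetric] j_def[symmetric] by (rule diag_entry_block[OF J(1) ij, symmetric])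
  finally show "herm_part ?Y $$ (q, r)
     = ?R $$ (q, r)"
    using qr by simp
qed

text \<open>In the block of the singular value 0 the change of basis is \<open>A\<^sub>b\<^sub>b\<close> on the left and a larger unitary block of \<open>B\<close> on the
  right, and the block of \<open>M\<close> is \<open>[Diag(h\<^sub>b) 0]\<close>.\<close>

lemma tail_block:
  "adj (col_sub U {rk..<m}) * H * hcat (col_sub V {rk..<m}) (col_sub V {m..<n})
    = diag_block A rk m * rect_diag (m - rk) (n - rk) (subvec h {rk..<m}) * adj (diag_block B rk n)"
  unfolding diag_block_tail_product
proof (rule eq_matI)
  let ?R = "mat (m - rk) (n - rk) (\<lambda>(q, r). (A * rect_diag m n h * adj B) $$ (rk + q, rk + r))"
  have "hcat (col_sub V {rk..<m}) (col_sub V {m..<n}) = col_sub V {rk..<n}"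
  proof (rule eq_matI)
    show d: "dim_row (hcat (col_sub V {rk..<m}) (col_sub V {m..<n})) = dim_row (col_sub V {rk..<n})"
      "dim_col (hcat (col_sub V {rk..<m}) (col_sub V {m..<n})) = dim_col (col_sub V {rk..<n})"
      using mn rk_le UVH by (auto simp: col_sub_interval)
    show "hcat (col_sub V {rk..<m}) (col_sub V {m..<n}) $$ (i, j) = col_sub V {rk..<n} $$ (i, j)"
      if "i < dim_row (col_sub V {rk..<n})" "j < dim_col (col_sub V {rk..<n})" for i j
      using that mn rk_le UVH by (subst hcat_entry) (auto simp: col_sub_interval add.commute)
  qed
  moreover have "(adj (col_sub U {rk..<m}) * H * col_sub V {rk..<n}) $$ (q, r)
      = (A * rect_diag m n h * adj B) $$ (rk + q, rk + r)" if qr: "q < m - rk" "r < n - rk" for q r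
  proof -
    have ij: "rk + q < m" "rk + r < n" using qr by auto
    have "(adj (col_sub U {rk..<m}) * H * col_sub V {rk..<n}) $$ (q, r) = (A * M * adj B) $$ (rk + q, rk + r)"
      unfolding UVH(7)[symmetric] using qr UVH by (intro compression_entry) auto
    also have "\<dots> = (\<Sum>k<m. \<Sum>l<n. A $$ (rk + q, k) * M $$ (k, l) * cnj (B $$ (rk + r, l)))"
      by (rule conj_entry[OF M ij])
    also have "\<dots> = (\<Sum>k<m. \<Sum>l<n. if l = k then A $$ (rk + q, k) * of_real (h $ k) * cnj (B $$ (rk + r, k)) else 0)"
    proof (intro sum.cong refl)
      fix k l assume kl: "k \<in> {..<m}" "l \<in> {..<n}"
      have "A $$ (rk + q, k) = 0 \<or> s_ext k = 0" "B $$ (rk + r, l) = 0 \<or> s_ext l = 0"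
        using A_zero[of "rk + q" k] B_zero[of "rk + r" l] s_ext_zero_iff[of "rk + q"] s_ext_zero_iff[of "rk + r"] kl ij
        by fastforce+
      moreover have "A $$ (rk + q, k) = 0 \<or> B $$ (rk + r, k) = 0 \<or> s_ext k = 0"
        using calculation(1) by blast
      moreover have "B $$ (rk + r, k) = 0 \<or> s_ext k = 0"
        using B_zero[of "rk + r" k] s_ext_zero_iff[of "rk + r"] kl ij mn by fastforce
      moreover have "M $$ (k, l) = (if k = l then of_real (h $ k) else 0)" if "s_ext k = 0" "s_ext l = 0"
      proof -
        have "s $ k = 0" "l < m \<Longrightarrow> s $ l = 0" using that kl by (simp_all add: s_ext_def)
        then show ?thesis using M_zero[of k l] kl by blast
      qed
      ultimately show "A $$ (rk + q, k) * M $$ (k, l) * cnj (B $$ (rk + r, l))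
          = (if l = k then A $$ (rk + q, k) * of_real (h $ k) * cnj (B $$ (rk + r, k)) else 0)"
        by auto
    qed
    also have "\<dots> = (\<Sum>k<m. A $$ (rk + q, k) * of_real (h $ k) * cnj (B $$ (rk + r, k)))"
      using mn by (intro sum.cong refl) simp
    also have "\<dots> = (A * rect_diag m n h * adj B) $$ (rk + q, rk + r)"
      by (rule diag_entry[OF ij, symmetric])
    finally show ?thesis .
  qed
  ultimately show "(adj (col_sub U {rk..<m}) * H * hcat (col_sub V {rk..<m}) (col_sub V {m..<n})) $$ (q, r)
      = ?R $$ (q, r)"
    if "q < dim_row ?R"
       "r < dim_col ?R" for q r
    using that by simp
qed (use mn rk_le UVH in \<open>auto simp: col_sub_interval\<close>)

lemma subvec_block_nonincreasing:
  assumes J: "J \<in> set (a_blocks s)" "J = {l..<e}" "e \<le> rk"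
  shows "nonincreasing (subvec h J)"
  unfolding nonincreasing_def J(2) subvec_interval
proof (intro allI impI)
  fix q r assume qr: "q \<le> r" "r < dim_vec (vec (e - l) (\<lambda>k. h $ (l + k)))"
  have in_J: "l + q \<in> J" "l + r \<in> J" using qr by (auto simp: J(2))
  have "s_ext (l + r) = s_ext (l + q)" "l + q < m" "l + r < m"
    using block_level(3)[OF J(1) in_J(1), of "l + r"] block_level(4)[OF J(1) in_J(1)] in_J mn by fastforce+
  then have "h $ (l + r) \<le> h $ (l + q)" using qr by (intro h_mono) (auto simp: s_ext_def)
  then show "vec (e - l) (\<lambda>k. h $ (l + k)) $ r \<le> vec (e - l) (\<lambda>k. h $ (l + k)) $ q"
    using qr by simp
qed

lemma eig_vals_block:
  assumes J: "J \<in> set (a_blocks s)"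
  shows "eig_vals (herm_part (adj (col_sub U J) * H * col_sub V J)) = subvec h J"
proof -
  obtain l e where J': "J = {l..<e}" "l \<le> e" "e \<le> rk" using block_interval[OF J] .
  show ?thesis
    unfolding herm_block[OF J J'(1,3)]
    by (rule eig_vals_nonincreasing[OF diag_block_A_unitary[OF J J'(1,3)] _ subvec_block_nonincreasing[OF J J'(1,3)]])
      (simp add: subvec_def J'(1))
qed

lemma s_zero_tail: "rk \<le> i \<Longrightarrow> i < m \<Longrightarrow> s $ i = 0"
  using s_ext_zero_iff[of i] by (simp add: s_ext_def)

lemma sing_vals_tail:
  "sing_vals (diag_block A rk m * rect_diag (m - rk) (n - rk) (subvec h {rk..<m}) * adj (diag_block B rk n))
    = subvec h {rk..<m}"
proof (rule sing_vals_nonincreasing[OF diag_block_tail_unitary])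
  show "nonincreasing (subvec h {rk..<m})"
    unfolding nonincreasing_def subvec_interval
    using s_zero_tail by (auto intro!: h_mono)
qed (use mn s_zero_tail h_nonneg in \<open>auto simp: subvec_interval\<close>)

lemma kappa_D_map: "kappa (D_map m n s U V H) = h"
proof -
  have "concat (map (\<lambda>Wl. list_of_vec (eig_vals Wl)) (fst (D_map m n s U V H)))
    = concat (map (\<lambda>J. list_of_vec (subvec h J)) (a_blocks s))"
    unfolding D_map_def by (simp add: o_def eig_vals_block cong: map_cong)
  also have "\<dots> = map (\<lambda>i. h $ i) [0..<rk]"
    by (rule concat_consecutive[OF a_blocks_consecutive[OF s_mono]])
  finally have 1: "concat (map (\<lambda>Wl. list_of_vec (eig_vals Wl)) (fst (D_map m n s U V H))) = map (\<lambda>i. h $ i) [0..<rk]" .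
  have "list_of_vec (sing_vals (snd (D_map m n s U V H))) = list_of_vec (subvec h {rk..<m})"
    unfolding D_map_def snd_conv b_set_eq tail_block sing_vals_tail ..
  also have "\<dots> = map (\<lambda>i. h $ i) [rk..<m]"
    unfolding subvec_interval by (rule nth_equalityI) (auto simp: list_of_vec_index)
  finally have 2: "list_of_vec (sing_vals (snd (D_map m n s U V H))) = map (\<lambda>i. h $ i) [rk..<m]" .
  have "map (\<lambda>i. h $ i) [0..<rk] @ map (\<lambda>i. h $ i) [rk..<m] = map (\<lambda>i. h $ i) [0..<m]"
    using upt_add_eq_append[of 0 rk "m - rk"] rk_le by (simp flip: map_append)
  also have "\<dots> = list_of_vec h"
    by (rule nth_equalityI) (auto simp: h list_of_vec_index)
  finally show ?thesis unfolding kappa_def 1 2 by (simp add: vec_list)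
qed

text \<open>The blocks of \<open>A\<close> and \<open>B\<close> provide one decomposition of each component of \<open>D(H)\<close>; by the intertwining
  lemmas, the arbitrary decompositions chosen in the definition of \<open>\<Phi>\<close> give the same value, because \<open>p\<close> inherits
  equal, opposite and vanishing entries from \<open>h\<close> inside each block.\<close>

theorem Phi_hat_conj:
  assumes phi: "phi h = p"
    and p: "\<And>i j c. i < m \<Longrightarrow> j < m \<Longrightarrow> c \<in> {1, - 1} \<Longrightarrow> s $ j = c * s $ i \<Longrightarrow> h $ j = c * h $ i \<Longrightarrow> p $ j = c * p $ i"
  shows "Phi_hat K n s phi (D_map m n s U V H) = A * rect_diag m n p * adj B"
proof -
  let ?W = "D_map m n s U V H"
  let ?f = "\<lambda>i j. (A * rect_diag m n p * adj B) $$ (i, j)"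
  have eig: "(let P = (SOME P. P \<in> eig_bases K Wl) in
        P * rect_diag (card J) (card J) (subvec p J) * adj P)
      = mat (card J) (card J) (\<lambda>(q, r). ?f (pick J q) (pick J r))"
    if J: "J \<in> set (a_blocks s)" and Wl: "Wl = herm_part (adj (col_sub U J) * H * col_sub V J)" for J Wl
  proof -
    obtain l e where J': "J = {l..<e}" "l \<le> e" "e \<le> rk" using block_interval[OF J] .
    let ?Q = "diag_block A l e"
    have Q: "?Q \<in> unitaries K (e - l)" using diag_block_A_unitary[OF J J'(1,3)] .
    have Wl': "Wl = ?Q * rect_diag (e - l) (e - l) (subvec h J) * adj ?Q"
      unfolding Wl by (rule herm_block[OF J J'(1,3)])
    have ev: "eig_vals Wl = subvec h J" unfolding Wl by (rule eig_vals_block[OF J])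
    have dW: "dim_row Wl = e - l" unfolding Wl' by simp
    have "?Q \<in> eig_bases K Wl" unfolding eig_bases_def using Q Wl' ev dW by simp
    then have ex: "(SOME P. P \<in> eig_bases K Wl) \<in> eig_bases K Wl" by (rule someI)
    define P where "P = (SOME P. P \<in> eig_bases K Wl)"
    have "P \<in> eig_bases K Wl" unfolding P_def by (rule ex)
    then have P: "P \<in> unitaries K (e - l)"
      "Wl = P * rect_diag (e - l) (e - l) (subvec h J) * adj P"
      unfolding eig_bases_def ev dW by auto
    have "P * rect_diag (e - l) (e - l) (subvec p J) * adj P
        = ?Q * rect_diag (e - l) (e - l) (subvec p J) * adj ?Q"
    proof (rule diag_intertwine[OF P(1) Q])
      show "P * rect_diag (e - l) (e - l) (subvec h J) * adj P
        = ?Q * rect_diag (e - l) (e - l) (subvec h J) * adj ?Q"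
        using P(2) Wl' by simp
      fix i j assume ij: "i < e - l" "j < e - l" and eq: "subvec h J $ j = subvec h J $ i"
      have in_J: "l + i \<in> J" "l + j \<in> J" using ij by (auto simp: J'(1))
      have "s_ext (l + j) = s_ext (l + i)" "l + i < m" "l + j < m"
        using block_level(3)[OF J in_J(1), of "l + j"] block_level(4)[OF J in_J(1)] in_J mn by fastforce+
      then show "subvec p J $ j = subvec p J $ i"
        using p[of "l + i" "l + j" 1] eq ij by (simp add: s_ext_def J'(1) subvec_interval)
    qed
    also have "\<dots> = mat (e - l) (e - l) (\<lambda>(q, r). ?f (l + q) (l + r))"
      by (rule diag_block_A_product[OF J J'(1,3)])
    also have "\<dots> = mat (card J) (card J) (\<lambda>(q, r). ?f (pick J q) (pick J r))"
      by (rule eq_matI) (auto simp: J'(1) pick_interval)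
    finally show ?thesis using P_def J'(1) by simp
  qed
  have "map2 (\<lambda>J Wl. let P = (SOME P. P \<in> eig_bases K Wl) in
              P * rect_diag (card J) (card J) (subvec p J) * adj P) (a_blocks s) (fst ?W)
     = map (\<lambda>J. mat (card J) (card J) (\<lambda>(q, r). ?f (pick J q) (pick J r))) (a_blocks s)"
    unfolding D_map_def fst_conv
    by (rule nth_equalityI) (auto intro!: eig)
  then have blocks: "fst (Phi_comps K s phi ?W)
      = map (\<lambda>J. mat (card J) (card J) (\<lambda>(q, r). ?f (pick J q) (pick J r))) (a_blocks s)"
    unfolding Phi_comps_def kappa_D_map phi by simp
  have diag: "diag_block_mat (fst (Phi_comps K s phi ?W)) = mat (rk - 0) (rk - 0) (\<lambda>(i, j). ?f (0 + i) (0 + j))"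
    unfolding blocks
  proof (rule diag_block_mat_consecutive[OF a_blocks_consecutive[OF s_mono]])
    fix i j assume ij: "i < rk" "j < rk" and none: "\<And>J. J \<in> set (a_blocks s) \<Longrightarrow> \<not> (i \<in> J \<and> j \<in> J)"
    have lt: "i < m" "j < m" using ij rk_le by auto
    have "s $ j \<noteq> s $ i"
      using a_blocks_cover[of i s j] none lt ij a_set_iff[of i] s by (auto simp: a_set_def)
    then show "?f i j = 0" using lt mn by (intro diag_entry_zero) (auto simp: s_ext_def)
  qed
  define M0N0 where "M0N0 = (SOME MN. MN \<in> svd_pairs K (snd ?W))"
  let ?QA = "diag_block A rk m" and ?QB = "diag_block B rk n"
  have snd_W: "snd ?W = ?QA * rect_diag (m - rk) (n - rk) (subvec h {rk..<m}) * adj ?QB"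
    unfolding D_map_def snd_conv b_set_eq tail_block ..
  have sv: "sing_vals (snd ?W) = subvec h {rk..<m}" unfolding snd_W by (rule sing_vals_tail)
  have dW: "dim_row (snd ?W) = m - rk" "dim_col (snd ?W) = n - rk" unfolding snd_W by simp_all
  have "(?QA, ?QB) \<in> svd_pairs K (snd ?W)"
    unfolding svd_pairs_def sv dW using diag_block_tail_unitary snd_W by simp
  then have "M0N0 \<in> svd_pairs K (snd ?W)" unfolding M0N0_def by (rule someI)
  then obtain M0 N0 where MN: "M0N0 = (M0, N0)" "M0 \<in> unitaries K (m - rk)" "N0 \<in> unitaries K (n - rk)"
    "snd ?W = M0 * rect_diag (m - rk) (n - rk) (subvec h {rk..<m}) * adj N0"
    unfolding svd_pairs_def sv dW by auto
  have card_b: "card (b_set s) = m - rk" unfolding b_set_eq by simp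
  have mnb: "m - rk \<le> n - rk" using mn by simp
  let ?N1 = "col_sub N0 {..<m - rk}" and ?p = "subvec p {rk..<m}" and ?h = "subvec h {rk..<m}"
  have "M0 * rect_diag (m - rk) (m - rk) ?p * adj ?N1
     = M0 * rect_diag (m - rk) (n - rk) ?p * adj N0"
  proof -
    have N1: "?N1 = mat (n - rk) (m - rk) (\<lambda>(i, j). N0 $$ (i, j))"
      using col_sub_interval[of "m - rk" N0 0] mnb unitaries_dim[OF MN(3)] by (simp add: lessThan_atLeast0)
    have dN1: "dim_row ?N1 = n - rk" "dim_col ?N1 = m - rk"
      unfolding N1 by simp_all
    show ?thesis
    proof (rule eq_matI)
      fix i j assume "i < dim_row (M0 * rect_diag (m - rk) (n - rk) ?p * adj N0)"
        "j < dim_col (M0 * rect_diag (m - rk) (n - rk) ?p * adj N0)"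
      then have ij: "i < m - rk" "j < n - rk"
        using unitaries_dim[OF MN(2)] unitaries_dim[OF MN(3)] by simp_all
      have "(M0 * rect_diag (m - rk) (m - rk) ?p * adj ?N1) $$ (i, j)
        = (\<Sum>k<m - rk. M0 $$ (i, k) * of_real (?p $ k) * cnj (?N1 $$ (j, k)))"
        using ij dN1 unitaries_dim[OF MN(2)] by (intro rect_diag_product_entry) auto
      also have "\<dots> = (\<Sum>k<m - rk. M0 $$ (i, k) * of_real (?p $ k) * cnj (N0 $$ (j, k)))"
        unfolding N1 using ij by (intro sum.cong) auto
      also have "\<dots> = (M0 * rect_diag (m - rk) (n - rk) ?p * adj N0) $$ (i, j)"
        using ij mnb unitaries_dim[OF MN(2)] unitaries_dim[OF MN(3)]
        by (intro rect_diag_product_entry[symmetric]) auto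
      finally show "(M0 * rect_diag (m - rk) (m - rk) ?p * adj ?N1) $$ (i, j)
        = (M0 * rect_diag (m - rk) (n - rk) ?p * adj N0) $$ (i, j)" .
    qed (use dN1 unitaries_dim[OF MN(3)] in auto)
  qed
  also have "\<dots> = ?QA * rect_diag (m - rk) (n - rk) ?p * adj ?QB"
  proof (rule rect_diag_intertwine[OF MN(2) diag_block_tail_unitary(1) MN(3) diag_block_tail_unitary(2) mnb])
    show "M0 * rect_diag (m - rk) (n - rk) ?h * adj N0
      = ?QA * rect_diag (m - rk) (n - rk) ?h * adj ?QB"
      using MN(4) snd_W by simp
    show "?p $ j = ?p $ i"
      if "i < m - rk" "j < m - rk" "?h $ j = ?h $ i" for i j
      using p[of "rk + i" "rk + j" 1] s_zero_tail that by (simp add: subvec_interval)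
    show "?p $ j = - ?p $ i"
      if "i < m - rk" "j < m - rk" "?h $ j = - ?h $ i" for i j
      using p[of "rk + i" "rk + j" "- 1"] s_zero_tail that by (simp add: subvec_interval)
    show "?p $ i = 0" if "i < m - rk" "?h $ i = 0" for i
      using p[of "rk + i" "rk + i" "- 1"] s_zero_tail that by (simp add: subvec_interval)
  qed
  also have "\<dots> = mat (m - rk) (n - rk) (\<lambda>(q, r). ?f (rk + q) (rk + r))"
    by (rule diag_block_tail_product)
  finally have tail: "snd (Phi_comps K s phi ?W) = mat (m - rk) (n - rk) (\<lambda>(q, r). ?f (rk + q) (rk + r))"
    unfolding Phi_comps_def kappa_D_map phi snd_conv M0N0_def[symmetric] MN(1) Let_def split_conv b_set_eq card_atLeastLessThan .
  have dcol: "dim_row (A * rect_diag m n p * adj B) = m" "dim_col (A * rect_diag m n p * adj B) = n"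
    by (simp_all add: unitaries_dim[OF A] unitaries_dim[OF B])
  have off: "?f i j = 0" if "i < m" "j < n" "(i < rk) \<noteq> (j < rk)" for i j
    using that s_ext_zero_iff[of i] s_ext_zero_iff[of j] by (intro diag_entry_zero) auto
  have "Phi_hat K n s phi ?W = four_block_mat (diag_block_mat (fst (Phi_comps K s phi ?W))) (0\<^sub>m rk (n - rk))
      (0\<^sub>m (m - rk) rk) (snd (Phi_comps K s phi ?W))"
    unfolding Phi_hat_def Let_def split_beta card_b ..
  also have "\<dots> = four_block_mat (mat rk rk (\<lambda>(i, j). ?f i j)) (0\<^sub>m rk (n - rk)) (0\<^sub>m (m - rk) rk)
      (mat (m - rk) (n - rk) (\<lambda>(q, r). ?f (rk + q) (rk + r)))"
    unfolding diag tail by simp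
  also have "\<dots> = A * rect_diag m n p * adj B"
  proof (rule eq_matI)
    fix i j assume "i < dim_row (A * rect_diag m n p * adj B)" "j < dim_col (A * rect_diag m n p * adj B)"
    then have ij: "i < m" "j < n" unfolding dcol .
    show "four_block_mat (mat rk rk (\<lambda>(i, j). ?f i j)) (0\<^sub>m rk (n - rk)) (0\<^sub>m (m - rk) rk)
      (mat (m - rk) (n - rk) (\<lambda>(q, r). ?f (rk + q) (rk + r))) $$ (i, j) = ?f i j"
      using ij rk_le mn off[OF ij] by (auto simp del: index_mult_mat)
  qed (use rk_le mn dcol in \<open>auto simp del: index_mult_mat\<close>)
  finally show ?thesis .
qed

end

section \<open>Differentiability of spectral operators\<close>

lemma hcat_hadamard_eq_div_diff_part:
  assumes d: "dim_row U = m" "dim_col U = m" "dim_row V = n" "dim_col V = n" "dim_row H = m" "dim_col H = n"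
    and s: "dim_vec s = m" and mn: "m \<le> n"
  defines "A1 \<equiv> adj U * H * col_sub V {..<m}" and "A2 \<equiv> adj U * H * col_sub V {m..<n}"
  shows "hcat (hadamard_prod (E1_mat g s) (herm_part A1) + hadamard_prod (E2_mat g s) (skew_part A1))
           (hadamard_prod (F_mat n g s) A2)
    = div_diff_part n s (g s) (adj U * H * V)" (is "?L = ?R")
proof -
  let ?W = "adj U * H * V"
  have c1: "col_sub V {..<m} = mat n m (\<lambda>(i, j). V $$ (i, j))"
    using col_sub_interval[of m V 0] d mn by (simp add: lessThan_atLeast0)
  have c2: "col_sub V {m..<n} = mat n (n - m) (\<lambda>(i, j). V $$ (i, m + j))"
    using col_sub_interval[of n V m] d by simp
  have dA: "dim_row A1 = m" "dim_col A1 = m" "dim_row A2 = m" "dim_col A2 = n - m"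
    by (simp_all add: A1_def A2_def c1 c2 d)
  have e1: "A1 $$ (i, j) = ?W $$ (i, j)" if "i < m" "j < m" for i j
    unfolding A1_def c1 using that d mn by (simp add: mult_entry)
  have e2: "A2 $$ (i, j) = ?W $$ (i, m + j)" if "i < m" "j < n - m" for i j
    unfolding A2_def c2 using that d mn by (simp add: mult_entry)
  show ?thesis
  proof (rule eq_matI)
    fix i j assume "i < dim_row ?R" "j < dim_col ?R"
    then have ij: "i < m" "j < n" by (simp_all add: div_diff_part_def s)
    show "?L $$ (i, j) = ?R $$ (i, j)"
    proof (cases "j < m")
      case True
      have h: "herm_part A1 $$ (i, j) = (?W $$ (i, j) + cnj (?W $$ (j, i))) / 2"
        "skew_part A1 $$ (i, j) = (?W $$ (i, j) - cnj (?W $$ (j, i))) / 2"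
        using ij True by (simp_all add: herm_part_def skew_part_def dA e1 del: index_mult_mat)
      have dh: "dim_row (herm_part A1) = m" "dim_col (herm_part A1) = m" "dim_row (skew_part A1) = m" "dim_col (skew_part A1) = m"
        by (simp_all add: herm_part_def skew_part_def dA)
      have "?L $$ (i, j) = of_real (E1_mat g s $$ (i, j)) * herm_part A1 $$ (i, j)
          + of_real (E2_mat g s $$ (i, j)) * skew_part A1 $$ (i, j)"
        using ij True by (subst hcat_entry) (simp_all add: hadamard_prod_def dh dA)
      also have "\<dots> = ?R $$ (i, j)"
        unfolding h using ij True by (simp add: E1_mat_def E2_mat_def div_diff_part_def s del: index_mult_mat)
      finally show ?thesis .
    next
      case False
      have "?L $$ (i, j) = of_real (F_mat n g s $$ (i, j - m)) * A2 $$ (i, j - m)"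
        using ij False by (subst hcat_entry) (simp_all add: hadamard_prod_def skew_part_def dA)
      also have "\<dots> = ?R $$ (i, j)"
        using ij False e2[of i "j - m"] by (simp add: F_mat_def div_diff_part_def s del: index_mult_mat)
      finally show ?thesis .
    qed
  qed (use mn in \<open>simp_all add: div_diff_part_def s hadamard_prod_def skew_part_def dA\<close>)
qed

lemma limitin_mat_iff:
  assumes "\<And>k. F k \<in> mats K m n"
  shows "limitin (eucl_topology (mat_eucl K m n)) F L sequentially \<longleftrightarrow> L \<in> mats K m n \<and> entries_tendsto F L"
proof (cases "L \<in> mats K m n")
  case True
  have d: "dim_row (F k) = m" "dim_col (F k) = n" for k using mats_dim[OF assms[of k]] by simp_all
  show ?thesis
    unfolding mat_space.limitin_iff entries_tendsto_def mats_dim[OF True] d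
    using True assms by (auto simp: always_eventually)
qed (simp add: mat_space.limitin_iff)

lemma diff_quot_mat:
  "diff_quot (mat_eucl K m n) (mat_eucl K m n) G X t H
    = of_real (1 / t) \<cdot>\<^sub>m (G (X + of_real t \<cdot>\<^sub>m H) - G X)"
  by (simp add: diff_quot_def)

lemma diff_quot_vec:
  "diff_quot (vec_eucl m) (vec_eucl m) g x t h = (1 / t) \<cdot>\<^sub>v (g (x + t \<cdot>\<^sub>v h) - g x)"
  by (simp add: diff_quot_def)

context base_field begin

lemma svd_pairsD:
  assumes "(U, V) \<in> svd_pairs K Z" "Z \<in> mats K m n"
  shows "U \<in> unitaries K m" "V \<in> unitaries K n" "Z = U * rect_diag m n (sing_vals Z) * adj V"
  using assms by (auto simp: svd_pairs_def mats_dim[OF assms(2)])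

lemma spectral_op_some:
  assumes "Z \<in> mats K m n" "m \<le> n"
  obtains U V where "(U, V) \<in> svd_pairs K Z" "spectral_op K g Z = U * rect_diag m n (g (sing_vals Z)) * adj V"
proof -
  obtain U V where UV: "(SOME UV. UV \<in> svd_pairs K Z) = (U, V)" by (cases "SOME UV. UV \<in> svd_pairs K Z")
  have "(SOME UV. UV \<in> svd_pairs K Z) \<in> svd_pairs K Z"
    using svd_exists[OF assms] by (rule someI_ex)
  then have "(U, V) \<in> svd_pairs K Z" by (simp add: UV)
  moreover have "spectral_op K g Z = U * rect_diag m n (g (sing_vals Z)) * adj V"
    unfolding spectral_op_def UV using assms by (simp add: mats_dim)
  ultimately show thesis by (rule that)
qed

lemma spectral_op_mats:
  assumes "Z \<in> mats K m n" "m \<le> n"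
  shows "spectral_op K g Z \<in> mats K m n"
proof -
  obtain U V where UV: "(U, V) \<in> svd_pairs K Z"
    and op: "spectral_op K g Z = U * rect_diag m n (g (sing_vals Z)) * adj V"
    by (rule spectral_op_some[OF assms])
  show ?thesis unfolding op
    using svd_pairsD(1,2)[OF UV assms(1)] by (auto intro!: mats_intros)
qed

end

locale spectral_setting = base_field K for K :: "complex set" +
  fixes m n :: nat and D :: "real vec set" and g :: "real vec \<Rightarrow> real vec"
  assumes mn: "m \<le> n"
    and D_open: "openin (eucl_topology (vec_eucl m)) D"
    and g: "g \<in> carrier_vec m \<rightarrow> carrier_vec m"
    and g_sym: "abs_symmetric_on m D g"
begin

abbreviation "TM \<equiv> eucl_topology (mat_eucl K m n)"
abbreviation "TV \<equiv> eucl_topology (vec_eucl m)"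
abbreviation "quot_G X \<equiv> (\<lambda>(t, h'). diff_quot (mat_eucl K m n) (mat_eucl K m n) (spectral_op K g) X t h')"
abbreviation "quot_g x \<equiv> (\<lambda>(t, h'). diff_quot (vec_eucl m) (vec_eucl m) g x t h')"

lemma D_carrier: "D \<subseteq> carrier_vec m"
  using openin_subset[OF D_open] unfolding vec_space.topology_eq vec_space.M.topspace_mtopology by simp

lemma dim_g [simp]: "dim_vec x = m \<Longrightarrow> dim_vec (g x) = m"
  using funcset_mem[OF g, of x] carrier_vecI[of x m] by auto

lemma g_entries:
  assumes "x \<in> D" "i < m" "j < m" "c \<in> {1, - 1}" "x $ j = c * x $ i"
  shows "g x $ j = c * g x $ i"
  using abs_symmetric_entries[OF g_sym assms(1) _ _ assms(2-)] D_carrier assms(1) by auto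

text \<open>By \<open>sing_vals_rearrangement\<close>, \<open>y\<close> is a signed rearrangement of the singular values, so \<open>g(y)\<close> is the same
  rearrangement of \<open>g\<close> at the singular values, and the intertwining lemma compares the two decompositions.\<close>

lemma spectral_op_diagonalized:
  assumes U: "U \<in> unitaries K m" and V: "V \<in> unitaries K n" and y: "dim_vec y = m"
    and D: "sing_vals (U * rect_diag m n y * adj V) \<in> D"
  shows "spectral_op K g (U * rect_diag m n y * adj V) = U * rect_diag m n (g y) * adj V"
proof -
  define Y where "Y = U * rect_diag m n y * adj V"
  define s where "s = sing_vals Y"
  have Y: "Y \<in> mats K m n" unfolding Y_def using U V by (auto intro!: mats_intros)
  obtain U' V' where UV': "(U', V') \<in> svd_pairs K Y" "spectral_op K g Y = U' * rect_diag m n (g s) * adj V'"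
    unfolding s_def by (rule spectral_op_some[OF Y mn, of g])
  note svd = svd_pairsD[OF UV'(1) Y, folded s_def]
  have sD: "s \<in> D" using D by (simp add: s_def Y_def)
  then have s: "dim_vec s = m" using D_carrier by auto
  obtain \<pi> where \<pi>: "\<pi> permutes {..<m}" "\<And>i. i < m \<Longrightarrow> s $ i = \<bar>y $ \<pi> i\<bar>"
    by (rule sing_vals_rearrangement[OF U V mn y]) (auto simp: s_def Y_def)
  define \<rho> where "\<rho> = inv_into UNIV \<pi>"
  define e where "e j = (if y $ j \<ge> 0 then 1 else - 1 :: real)" for j
  have \<rho>: "\<rho> permutes {..<m}" unfolding \<rho>_def by (rule permutes_inv[OF \<pi>(1)])
  have \<rho>_lt: "\<rho> j < m" if "j < m" for j using \<rho> that by (metis lessThan_iff permutes_in_image)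
  have yj: "y $ j = e j * s $ \<rho> j" if "j < m" for j
  proof -
    have "\<pi> (\<rho> j) = j" unfolding \<rho>_def using permutes_inverses(1)[OF \<pi>(1)] .
    then show ?thesis using \<pi>(2)[OF \<rho>_lt[OF that]] by (simp add: e_def)
  qed
  have "y = vec m (\<lambda>j. e j * s $ \<rho> j)" by (rule eq_vecI) (use yj y in auto)
  moreover have "g (vec m (\<lambda>j. e j * s $ \<rho> j)) = vec m (\<lambda>j. e j * g s $ \<rho> j)"
    by (rule abs_symmetric_rearrange[OF g_sym sD s _ \<rho>]) (use s in \<open>auto simp: e_def\<close>)
  ultimately have gy: "g y $ j = e j * g s $ \<rho> j" if "j < m" for j
    using that by simp
  have "U * rect_diag m n (g y) * adj V = U' * rect_diag m n (g s) * adj V'"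
  proof (rule rect_diag_intertwine[OF U svd(1) V svd(2) mn])
    show "U * rect_diag m n y * adj V = U' * rect_diag m n s * adj V'"
      using svd(3) by (simp add: Y_def)
    show "g y $ j = g s $ i" if ij: "i < m" "j < m" and eq: "y $ j = s $ i" for i j
    proof -
      have "s $ i = e j * s $ \<rho> j" using eq yj[OF ij(2)] by simp
      moreover have "e j \<in> {1, - 1}" by (simp add: e_def)
      ultimately have "g s $ i = e j * g s $ \<rho> j" using g_entries[OF sD \<rho>_lt[OF ij(2)] ij(1)] by blast
      then show ?thesis using gy[OF ij(2)] by simp
    qed
    show "g y $ j = - g s $ i" if ij: "i < m" "j < m" and eq: "y $ j = - s $ i" for i j
    proof -
      have "s $ i = (- e j) * s $ \<rho> j" using eq yj[OF ij(2)] by simp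
      moreover have "- e j \<in> {1, - 1}" by (simp add: e_def)
      ultimately have "g s $ i = (- e j) * g s $ \<rho> j" using g_entries[OF sD \<rho>_lt[OF ij(2)] ij(1)] by blast
      then show ?thesis using gy[OF ij(2)] by simp
    qed
    show "g s $ i = 0" if "i < m" "s $ i = 0" for i
      using g_entries[OF sD that(1) that(1), of "- 1"] that by simp
  qed
  then show ?thesis using UV'(2) by (simp add: Y_def)
qed

lemma spectral_op_svd:
  assumes X: "X \<in> mats K m n" and UV: "U \<in> unitaries K m" "V \<in> unitaries K n"
    "X = U * rect_diag m n (sing_vals X) * adj V" and D: "sing_vals X \<in> D"
  shows "spectral_op K g X = U * rect_diag m n (g (sing_vals X)) * adj V"
proof -
  have "sing_vals (U * rect_diag m n (sing_vals X) * adj V) \<in> D" using D UV(3)[symmetric] by simp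
  from spectral_op_diagonalized[OF UV(1,2) sing_vals_props(1)[OF X mn] this] show ?thesis
    using UV(3)[symmetric] by simp
qed

text \<open>Symmetries of \<open>s\<close> that also fix \<open>h\<close> fix every point \<open>s + t h\<close> of the ray, so the difference quotients
  already have the symmetry. Openness of \<open>D\<close> keeps the ray in \<open>D\<close> for small \<open>t\<close>.\<close>

lemma derivative_symmetric:
  assumes s: "s \<in> D" and h: "dim_vec h = m" and p: "has_dir_deriv (vec_eucl m) (vec_eucl m) g s h p"
    and ij: "i < m" "j < m" "c \<in> {1, - 1}" "s $ j = c * s $ i" "h $ j = c * h $ i"
  shows "p $ j = c * p $ i"
proof -
  have sm: "dim_vec s = m" using s D_carrier by auto
  define x where "x t = s + t \<cdot>\<^sub>v h" for t
  have lim: "((\<lambda>t. diff_quot (vec_eucl m) (vec_eucl m) g s t h $ k) \<longlongrightarrow> p $ k) (at_right 0)" if "k < m" for k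
    using p that by (auto simp: has_dir_deriv_def vec_space.limitin_iff)
  have "limitin TV x s (at_right 0)"
    unfolding vec_space.limitin_iff
  proof (intro conjI ballI)
    show "s \<in> points (vec_eucl m)" using sm by auto
    show "\<forall>\<^sub>F t in at_right 0. x t \<in> points (vec_eucl m)"
      using sm h by (intro always_eventually) (auto simp: x_def intro!: carrier_vecI)
    fix k assume k: "k \<in> {..<m}"
    have "((\<lambda>t. s $ k + t * h $ k) \<longlongrightarrow> s $ k + 0 * h $ k) (at_right 0)"
      by (intro tendsto_intros)
    then show "((\<lambda>t. x t $ k) \<longlongrightarrow> s $ k) (at_right 0)"
      using k sm h by (simp add: x_def)
  qed
  then have "\<forall>\<^sub>F t in at_right 0. x t \<in> D" using D_open s by (auto simp: limitin_def)
  then have "\<forall>\<^sub>F t in at_right 0. diff_quot (vec_eucl m) (vec_eucl m) g s t h $ j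
      = c * diff_quot (vec_eucl m) (vec_eucl m) g s t h $ i"
  proof eventually_elim
    case (elim t)
    have dx: "dim_vec (x t) = m" using h by (simp add: x_def)
    have "x t $ j = c * x t $ i" using ij h sm by (simp add: x_def algebra_simps)
    then have "g (x t) $ j = c * g (x t) $ i" by (rule g_entries[OF elim ij(1-3)])
    moreover have "g s $ j = c * g s $ i" by (rule g_entries[OF s ij(1-4)])
    ultimately show ?case using ij(1,2) dx sm
      by (simp add: diff_quot_vec x_def[symmetric] algebra_simps)
  qed
  then have "((\<lambda>t. diff_quot (vec_eucl m) (vec_eucl m) g s t h $ j) \<longlongrightarrow> c * p $ i) (at_right 0)"
    by (rule tendsto_cong[THEN iffD2]) (intro tendsto_intros lim ij)
  then show ?thesis using lim[OF ij(2)] tendsto_unique trivial_limit_at_right_real by blast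
qed

lemma dir_deriv_hadamard:
  assumes g': "hadamard_dir_differentiable (vec_eucl m) (vec_eucl m) g s" and h: "h \<in> carrier_vec m"
  shows "limitin TV (quot_g s)
      (dir_deriv (vec_eucl m) (vec_eucl m) g s h) (at_right 0 \<times>\<^sub>F nhdsin TV h)"
    and "has_dir_deriv (vec_eucl m) (vec_eucl m) g s h (dir_deriv (vec_eucl m) (vec_eucl m) g s h)"
proof -
  obtain L where L: "limitin TV (quot_g s) L
      (at_right 0 \<times>\<^sub>F nhdsin TV h)"
    using g' h unfolding hadamard_dir_differentiable_def by auto
  have dd: "has_dir_deriv (vec_eucl m) (vec_eucl m) g s h L"
    using vec_space.limitin_fixed_direction[OF L] h by (simp add: has_dir_deriv_def)
  have "dir_deriv (vec_eucl m) (vec_eucl m) g s h = L"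
    unfolding dir_deriv_def
  proof (rule the_equality, rule dd)
    show "L' = L" if "has_dir_deriv (vec_eucl m) (vec_eucl m) g s h L'" for L'
      using that dd vec_space.limitin_unique trivial_limit_at_right_real unfolding has_dir_deriv_def by blast
  qed
  then show "limitin TV (quot_g s)
      (dir_deriv (vec_eucl m) (vec_eucl m) g s h) (at_right 0 \<times>\<^sub>F nhdsin TV h)"
    "has_dir_deriv (vec_eucl m) (vec_eucl m) g s h (dir_deriv (vec_eucl m) (vec_eucl m) g s h)"
    using L dd by simp_all
qed

text \<open>Once the unitary factors converge, so do the singular values, because \<open>[Diag(s\<^sub>k) 0] = U\<^sub>k\<^sup>* X\<^sub>k V\<^sub>k\<close>. The limit is
  again ordered and nonnegative, hence it is \<open>\<sigma>(X)\<close>; no continuity of singular values is presupposed.\<close>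

lemma path_subsequence:
  assumes X: "X \<in> mats K m n"
    and t: "\<And>k. t k > 0" "t \<longlonglongrightarrow> 0"
    and Hs: "\<And>k. Hs k \<in> mats K m n" "entries_tendsto Hs H"
  obtains r Us Vs U V where "strict_mono r"
    "svd_path K m n U V X H (sing_vals X) (\<lambda>k. t (r k)) (\<lambda>k. Hs (r k)) Us Vs
       (\<lambda>k. sing_vals (X + of_real (t (r k)) \<cdot>\<^sub>m Hs (r k)))"
    "\<And>k. spectral_op K g (X + of_real (t (r k)) \<cdot>\<^sub>m Hs (r k))
       = Us k * rect_diag m n (g (sing_vals (X + of_real (t (r k)) \<cdot>\<^sub>m Hs (r k)))) * adj (Vs k)"
proof -
  define Xs where "Xs k = X + of_real (t k) \<cdot>\<^sub>m Hs k" for k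
  define ss where "ss k = sing_vals (Xs k)" for k
  have Xs: "Xs k \<in> mats K m n" for k
    unfolding Xs_def using X Hs by (intro mats_add mats_smult) auto
  have dX: "dim_row X = m" "dim_col X = n" using X by (simp_all add: mats_dim)
  have dH: "dim_row H = m" "dim_col H = n" using Hs mats_dim by (metis entries_tendsto_dim)+
  have "\<exists>U V. (U, V) \<in> svd_pairs K (Xs k) \<and> spectral_op K g (Xs k) = U * rect_diag m n (g (ss k)) * adj V" for k
    using spectral_op_some[OF Xs mn, of k g] unfolding ss_def by metis
  then obtain Us Vs where UVs: "\<And>k. (Us k, Vs k) \<in> svd_pairs K (Xs k)"
    "\<And>k. spectral_op K g (Xs k) = Us k * rect_diag m n (g (ss k)) * adj (Vs k)" by metis
  note svds = svd_pairsD[OF UVs(1) Xs, folded ss_def]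
  note ss = sing_vals_props[OF Xs mn, folded ss_def]
  obtain r1 U where r1: "strict_mono r1" "U \<in> unitaries K m" "entries_tendsto (\<lambda>k. Us (r1 k)) U"
    using unitaries_subsequence[of Us m, OF svds(1)] .
  obtain r2 V where r2: "strict_mono r2" "V \<in> unitaries K n" "entries_tendsto (\<lambda>k. Vs (r1 (r2 k))) V"
    using unitaries_subsequence[of "\<lambda>k. Vs (r1 k)" n, OF svds(2)] .
  define r where "r k = r1 (r2 k)" for k
  have r: "strict_mono r" using r1(1) r2(1) by (auto simp: r_def strict_mono_def)
  have U_lim: "entries_tendsto (\<lambda>k. Us (r k)) U"
    unfolding r_def by (rule entries_tendsto_subseq[OF r1(3) r2(1)])
  have V_lim: "entries_tendsto (\<lambda>k. Vs (r k)) V" using r2(3) by (simp add: r_def)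
  have "entries_tendsto Xs X"
    unfolding entries_tendsto_def
  proof (intro conjI allI impI)
    fix i j assume ij: "i < dim_row X" "j < dim_col X"
    have "(\<lambda>k. X $$ (i, j) + of_real (t k) * Hs k $$ (i, j))
        \<longlonglongrightarrow> X $$ (i, j) + of_real 0 * H $$ (i, j)"
      using ij dX dH by (intro tendsto_intros t(2) entries_tendstoD[OF Hs(2)]) auto
    then show "(\<lambda>k. Xs k $$ (i, j)) \<longlonglongrightarrow> X $$ (i, j)"
      using ij dX mats_dim[OF Hs(1)] by (simp add: Xs_def)
  qed (simp_all add: mats_dim[OF Xs] dX)
  then have X_lim: "entries_tendsto (\<lambda>k. Xs (r k)) X" using r by (rule entries_tendsto_subseq)
  define S where "S = adj U * X * V"
  have dS: "dim_row S = m" "dim_col S = n" by (simp_all add: S_def unitaries_dim[OF r1(2)] unitaries_dim[OF r2(2)])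
  have "entries_tendsto (\<lambda>k. adj (Us (r k)) * Xs (r k) * Vs (r k)) S"
    unfolding S_def
    by (intro entries_tendsto_mult entries_tendsto_adjoint U_lim V_lim X_lim)
      (simp_all add: unitaries_dim[OF r1(2)] unitaries_dim[OF r2(2)] dX)
  moreover have "adj (Us k) * Xs k * Vs k = rect_diag m n (ss k)" for k
    by (subst svds(3)) (simp add: mult_assoc_dim unitaries_simps[OF svds(1)] unitaries_simps[OF svds(2)])
  ultimately have S_lim: "entries_tendsto (\<lambda>k. rect_diag m n (ss (r k))) S" by simp
  define s where "s = vec m (\<lambda>i. Re (S $$ (i, i)))"
  have s: "dim_vec s = m" by (simp add: s_def)
  have ss_lim: "(\<lambda>k. ss (r k) $ i) \<longlonglongrightarrow> s $ i" if "i < m" for i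
  proof -
    have "(\<lambda>k. Re (rect_diag m n (ss (r k)) $$ (i, i))) \<longlonglongrightarrow> Re (S $$ (i, i))"
      using that mn dS by (intro tendsto_Re entries_tendstoD[OF S_lim]) auto
    then show ?thesis using that mn by (simp add: s_def)
  qed
  have "entries_tendsto (\<lambda>k. rect_diag m n (ss (r k))) (rect_diag m n s)"
    using ss_lim by (auto simp: entries_tendsto_def intro!: tendsto_of_real)
  then have S: "S = rect_diag m n s" by (rule entries_tendsto_unique[OF S_lim])
  have X_eq: "X = U * rect_diag m n s * adj V"
    unfolding S[symmetric] S_def
    by (simp add: mult_assoc_dim unitaries_simps[OF r1(2)] unitaries_simps[OF r2(2)] dX)
  have "nonincreasing s"
    unfolding nonincreasing_def
  proof (intro allI impI)
    fix i j assume ij: "i \<le> j" "j < dim_vec s"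
    show "s $ j \<le> s $ i"
      by (rule LIMSEQ_le[OF ss_lim ss_lim]) (use ij s ss in \<open>auto simp: nonincreasing_def\<close>)
  qed
  moreover have "s $ i \<ge> 0" if "i < m" for i
    by (rule LIMSEQ_le_const[OF ss_lim[OF that]]) (use ss(3) that in auto)
  ultimately have sX: "sing_vals X = s"
    unfolding X_eq by (intro sing_vals_nonincreasing[OF r1(2) r2(2) mn s])
  have Hr: "entries_tendsto (\<lambda>k. Hs (r k)) H" using Hs(2) r by (rule entries_tendsto_subseq)
  have tr: "(\<lambda>k. t (r k)) \<longlonglongrightarrow> 0" using LIMSEQ_subseq_LIMSEQ[OF t(2) r] by (simp add: o_def)
  have "svd_path K m n U V X H (sing_vals X) (\<lambda>k. t (r k)) (\<lambda>k. Hs (r k)) (\<lambda>k. Us (r k)) (\<lambda>k. Vs (r k)) (\<lambda>k. ss (r k))"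
    unfolding sX
  proof unfold_locales
    show "X + of_real (t (r k)) \<cdot>\<^sub>m Hs (r k) = Us (r k) * rect_diag m n (ss (r k)) * adj (Vs (r k))" for k
      using svds(3)[of "r k"] by (simp add: Xs_def)
  qed (use mn r1(2) r2(2) s X_eq t(1) tr svds(1,2) Hs(1) U_lim V_lim Hr ss_lim in auto)
  then show thesis
    using UVs(2) r by (intro that[of r]) (auto simp: ss_def Xs_def)
qed

text \<open>The limit found along a subsequence is expressed in limiting bases \<open>U'\<close>, \<open>V'\<close>. In the
  given bases it is the formula of the theorem, and so it is the same for all subsequences.\<close>

lemma limit_in_fixed_basis:
  assumes X: "X \<in> mats K m n" and UV: "(U, V) \<in> svd_pairs K X" and sD: "sing_vals X \<in> D"
    and svd: "U' \<in> unitaries K m" "V' \<in> unitaries K n" "X = U' * rect_diag m n (sing_vals X) * adj V'"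
    and H: "dim_row H = m" "dim_col H = n"
  defines "s \<equiv> sing_vals X" and "M \<equiv> adj U' * H * V'"
  defines "phi \<equiv> dir_deriv (vec_eucl m) (vec_eucl m) g s"
  defines "h \<equiv> vec m (\<lambda>i. Re (M $$ (i, i)))"
  assumes M_off: "\<And>i j. i < m \<Longrightarrow> j < m \<Longrightarrow> i \<noteq> j \<Longrightarrow> s $ i = s $ j \<Longrightarrow> M $$ (i, j) + cnj (M $$ (j, i)) = 0"
    and M_zero: "\<And>i j. i < m \<Longrightarrow> j < n \<Longrightarrow> s $ i = 0 \<Longrightarrow> (j < m \<Longrightarrow> s $ j = 0) \<Longrightarrow>
        M $$ (i, j) = (if i = j then of_real (Re (M $$ (i, i))) else 0)"
    and mono: "\<And>i j. i \<le> j \<Longrightarrow> j < m \<Longrightarrow> s $ i = s $ j \<Longrightarrow> Re (M $$ (j, j)) \<le> Re (M $$ (i, i))"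
    and nonneg: "\<And>i. i < m \<Longrightarrow> s $ i = 0 \<Longrightarrow> 0 \<le> Re (M $$ (i, i))"
    and p: "has_dir_deriv (vec_eucl m) (vec_eucl m) g s h (phi h)"
  shows "U' * (div_diff_part n s (g s) M + rect_diag m n (phi h)) * adj V'
    = U * div_dir_diff K m n g U V X H * adj V"
proof -
  note UV' = svd_pairsD[OF UV X]
  note s_props = sing_vals_props[OF X mn, folded s_def]
  define A where "A = adj U * U'"
  define B where "B = adj V * V'"
  note dims = unitaries_dim[OF UV'(1)] unitaries_dim[OF UV'(2)] unitaries_dim[OF svd(1)] unitaries_dim[OF svd(2)] H
  note simps = unitaries_simps[OF UV'(1)] unitaries_simps[OF UV'(2)] unitaries_simps[OF svd(1)] unitaries_simps[OF svd(2)]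
  have eq: "U' * rect_diag m n s * adj V' = U * rect_diag m n s * adj V"
    using svd(3) UV'(3) by (simp add: s_def)
  have "adj U * (U' * rect_diag m n s * adj V') * V'
      = adj U * (U * rect_diag m n s * adj V) * V'" by (simp only: eq)
  then have AB: "A * rect_diag m n s = rect_diag m n s * B"
    by (simp add: A_def B_def mult_assoc_dim dims simps)
  have "adj V * adj (U' * rect_diag m n s * adj V') * U'
      = adj V * adj (U * rect_diag m n s * adj V) * U'" by (simp only: eq)
  then have BA: "B * rect_diag n m s = rect_diag n m s * A"
    by (simp add: A_def B_def dim_algebra dims simps)
  have A: "A \<in> unitaries K m" and B: "B \<in> unitaries K n"
    unfolding A_def B_def by (intro unitaries_mult unitaries_adjoint UV' svd)+
  have W: "adj U * H * V = A * M * adj B"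
    by (simp add: A_def B_def M_def dim_algebra dims simps)
  interpret adapted_direction K m n A B s M h U V H
  proof unfold_locales
    show "M $$ (i, j) = (if i = j then of_real (h $ i) else 0)"
      if "i < m" "j < n" "s $ i = 0" "j < m \<Longrightarrow> s $ j = 0" for i j
      using M_zero[OF that] that by (simp add: h_def)
    show "h $ j \<le> h $ i" if "i \<le> j" "j < m" "s $ i = s $ j" for i j
      using mono[OF that] that by (simp add: h_def)
    show "0 \<le> h $ i" if "i < m" "s $ i = 0" for i
      using nonneg[OF that] that by (simp add: h_def)
  qed (use mn A B s_props AB BA M_off W dims in \<open>auto simp: h_def M_def\<close>)
  have d: "g s $ j = c * g s $ i" if "i < m" "j < m" "c \<in> {1, - 1}" "s $ j = c * s $ i" for i j c
    using g_entries[OF _ that] sD by (simp add: s_def)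
  have p': "phi h $ j = c * phi h $ i"
    if "i < m" "j < m" "c \<in> {1, - 1}" "s $ j = c * s $ i" "h $ j = c * h $ i" for i j c
    by (rule derivative_symmetric[OF _ _ p that]) (use sD in \<open>simp_all add: s_def h_def\<close>)
  have dd: "dim_row (div_diff_part n s (g s) M) = m" "dim_col (div_diff_part n s (g s) M) = n"
    by (simp_all add: div_diff_part_def s_props)
  have "div_dir_diff K m n g U V X H = div_diff_part n s (g s) (adj U * H * V) + Phi_hat K n s phi (D_map m n s U V H)"
    unfolding div_dir_diff_def Let_def s_def[symmetric] phi_def[symmetric]
    by (subst hcat_hadamard_eq_div_diff_part[of U m V n H]) (simp_all add: dims s_props mn)
  also have "\<dots> = A * div_diff_part n s (g s) M * adj B + A * rect_diag m n (phi h) * adj B"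
  proof -
    have "div_diff_part n s (g s) (A * M * adj B) = A * div_diff_part n s (g s) M * adj B"
      by (rule div_diff_part_conj) (use d M in auto)
    moreover have "Phi_hat K n s phi (D_map m n s U V H) = A * rect_diag m n (phi h) * adj B"
      by (rule Phi_hat_conj[OF refl]) (rule p')
    ultimately show ?thesis by (simp only: W)
  qed
  finally have div: "div_dir_diff K m n g U V X H
    = A * div_diff_part n s (g s) M * adj B + A * rect_diag m n (phi h) * adj B" .
  show ?thesis unfolding div A_def B_def
    by (simp add: dim_algebra dims dd simps)
qed

text \<open>The curve of singular values is not straight, but it is \<open>s + t h\<^sub>k\<close> with \<open>h\<^sub>k \<rightarrow> h\<close>. Here Hadamard
  differentiability of \<open>g\<close>, rather than mere directional differentiability, is used.\<close>

theorem spectral_op_hadamard: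
  assumes X: "X \<in> mats K m n" and UV: "(U, V) \<in> svd_pairs K X" and sD: "sing_vals X \<in> D"
    and g': "hadamard_dir_differentiable (vec_eucl m) (vec_eucl m) g (sing_vals X)"
    and H: "H \<in> mats K m n"
  shows "limitin TM
      (quot_G X)
      (U * div_dir_diff K m n g U V X H * adj V)
      (at_right 0 \<times>\<^sub>F nhdsin TM H)"
proof (rule mat_space.limitin_prodI_sequences)
  show "H \<in> points (mat_eucl K m n)" using H by simp
  fix t :: "nat \<Rightarrow> real" and Hs :: "nat \<Rightarrow> complex mat"
  assume t: "\<And>k. t k > 0" "t \<longlonglongrightarrow> 0" and "\<And>k. Hs k \<in> points (mat_eucl K m n)"
    and Hs_lim: "limitin TM Hs H sequentially"
  then have Hs: "\<And>k. Hs k \<in> mats K m n" by simp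
  have Hs': "entries_tendsto Hs H" using Hs_lim limitin_mat_iff[of Hs K m n H] Hs by blast
  define s where "s = sing_vals X"
  obtain r Us Vs U' V' where r: "strict_mono r" and
    path: "svd_path K m n U' V' X H (sing_vals X) (\<lambda>k. t (r k)) (\<lambda>k. Hs (r k)) Us Vs
       (\<lambda>k. sing_vals (X + of_real (t (r k)) \<cdot>\<^sub>m Hs (r k)))"
    and op: "\<And>k. spectral_op K g (X + of_real (t (r k)) \<cdot>\<^sub>m Hs (r k))
       = Us k * rect_diag m n (g (sing_vals (X + of_real (t (r k)) \<cdot>\<^sub>m Hs (r k)))) * adj (Vs k)"
    by (rule path_subsequence[OF X t Hs Hs']) (rule that)
  define Xs where "Xs k = X + of_real (t (r k)) \<cdot>\<^sub>m Hs (r k)" for k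
  define ss where "ss k = sing_vals (Xs k)" for k
  have Xs: "Xs k \<in> mats K m n" for k
    unfolding Xs_def using X Hs by (intro mats_add mats_smult) auto
  note ss = sing_vals_props[OF Xs mn, folded ss_def]
  interpret path: svd_path K m n U' V' X H s "\<lambda>k. t (r k)" "\<lambda>k. Hs (r k)" Us Vs ss
    using path unfolding ss_def Xs_def s_def .
  define h where "h = vec m (\<lambda>i. Re (path.M $$ (i, i)))"
  define phi where "phi = dir_deriv (vec_eucl m) (vec_eucl m) g s"
  have h: "h \<in> carrier_vec m" by (simp add: h_def)
  note phi = dir_deriv_hadamard[OF g' h, folded s_def, folded phi_def]
  have sX: "X = U' * rect_diag m n (sing_vals X) * adj V'" using path.X by (simp add: s_def)
  have dH: "dim_row H = m" "dim_col H = n" using H by (simp_all add: mats_dim)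
  have target: "U' * (div_diff_part n s (g s) path.M + rect_diag m n (phi h)) * adj V'
      = U * div_dir_diff K m n g U V X H * adj V"
    unfolding path.M_def phi_def h_def s_def
  proof (rule limit_in_fixed_basis[OF X UV sD path.U path.V sX dH], fold s_def path.M_def)
    show "Re (path.M $$ (j, j)) \<le> Re (path.M $$ (i, i))" if "i \<le> j" "j < m" "s $ i = s $ j" for i j
      using path.derivative_monotone[OF ss(2,1) that] .
    show "0 \<le> Re (path.M $$ (i, i))" if "i < m" "s $ i = 0" for i
      using path.derivative_nonneg[OF ss(3) that] .
    show "has_dir_deriv (vec_eucl m) (vec_eucl m) g s (vec m (\<lambda>i. Re (path.M $$ (i, i))))
        (dir_deriv (vec_eucl m) (vec_eucl m) g s (vec m (\<lambda>i. Re (path.M $$ (i, i)))))"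
      using phi(2) by (simp add: h_def phi_def)
  qed (use path.block_offdiagonal path.zero_block in blast)+
  \<comment> \<open>The direction whose ray from \<open>s\<close> meets the curve of singular values at \<open>ss k\<close>.\<close>
  define hs where "hs k = vec m (\<lambda>i. (ss k $ i - s $ i) / t (r k))" for k
  have g_lim: "(\<lambda>k. (g (ss k) $ i - g s $ i) / t (r k)) \<longlonglongrightarrow> phi h $ i" if i: "i < m" for i
  proof -
    have "limitin TV hs h sequentially"
      unfolding vec_space.limitin_iff
      using path.sing_val_derivative by (auto simp: hs_def h_def)
    then have "limitin TV
        (\<lambda>k. quot_g s (t (r k), hs k)) (phi h) sequentially"
      by (intro vec_space.limitin_prod_sequences[OF phi(1)] path.t_pos path.t_0)
    then have "(\<lambda>k. diff_quot (vec_eucl m) (vec_eucl m) g s (t (r k)) (hs k) $ i) \<longlonglongrightarrow> phi h $ i"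
      using i by (simp add: vec_space.limitin_iff)
    moreover have "s + t (r k) \<cdot>\<^sub>v hs k = ss k" for k
      using path.t_pos[of k] path.s ss(1) by (intro eq_vecI) (auto simp: hs_def)
    ultimately show ?thesis
      using i path.s by (simp add: diff_quot_vec)
  qed
  have GX: "spectral_op K g X = U' * rect_diag m n (g s) * adj V'"
    unfolding s_def by (rule spectral_op_svd[OF X path.U path.V sX sD])
  let ?F = "\<lambda>k. quot_G X (t (r k), Hs (r k))"
  have F: "?F k = of_real (1 / t (r k)) \<cdot>\<^sub>m
      (Us k * rect_diag m n (g (ss k)) * adj (Vs k) - U' * rect_diag m n (g s) * adj V')" for k
    unfolding prod.case diff_quot_mat op GX ss_def Xs_def ..
  have "entries_tendsto ?F (U' * (div_diff_part n s (g s) path.M + rect_diag m n (phi h)) * adj V')"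
    unfolding F
  proof (rule path.spectral_limit)
    show "g s $ j = c * g s $ i" if "i < m" "j < m" "c \<in> {1, - 1}" "s $ j = c * s $ i" for i j c
      using g_entries[OF _ that] sD by (simp add: s_def)
  qed (rule g_lim)
  then have lim: "entries_tendsto ?F (U * div_dir_diff K m n g U V X H * adj V)"
    unfolding target .
  have F_mats: "?F k \<in> mats K m n" for k
    unfolding prod.case diff_quot_mat using X Hs mn
    by (intro mats_smult mats_minus spectral_op_mats mats_add) auto
  have "limitin TM ?F (U * div_dir_diff K m n g U V X H * adj V) sequentially"
    using limitin_mat_iff[of ?F K m n] F_mats lim mats_limit[of ?F m n, OF F_mats lim] by blast
  then show "\<exists>r. strict_mono r \<and> limitin TM
      (\<lambda>k. quot_G X (t (r k), Hs (r k)))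
      (U * div_dir_diff K m n g U V X H * adj V) sequentially"
    using r by blast
qed

text \<open>\<open>E\<close> embeds vectors as diagonal matrices in a fixed pair of singular bases. It carries the difference quotients
  of \<open>g\<close> at \<open>\<sigma>(X)\<close> to those of the spectral operator, and the real part of the diagonal recovers them.\<close>

theorem hadamard_of_spectral_op:
  assumes N: "openin TM N" "sing_vals ` N \<subseteq> D" "X \<in> N"
    and G: "hadamard_dir_differentiable (mat_eucl K m n) (mat_eucl K m n) (spectral_op K g) X"
  shows "hadamard_dir_differentiable (vec_eucl m) (vec_eucl m) g (sing_vals X)"
  unfolding hadamard_dir_differentiable_def
proof
  fix h assume "h \<in> points (vec_eucl m)"
  then have h: "h \<in> carrier_vec m" by simp
  define s where "s = sing_vals X"
  have X: "X \<in> mats K m n" using openin_subset[OF N(1)] N(3)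
    unfolding mat_space.topology_eq mat_space.M.topspace_mtopology by auto
  have sD: "s \<in> D" using N(2,3) by (auto simp: s_def)
  have s: "dim_vec s = m" using sD D_carrier by auto
  obtain UV where "UV \<in> svd_pairs K X" using svd_exists[OF X mn] by blast
  then obtain U V where UV: "(U, V) \<in> svd_pairs K X" by (cases UV) auto
  note svd = svd_pairsD[OF UV X, folded s_def]
  have dims: "dim_row U = m" "dim_col U = m" "dim_row V = n" "dim_col V = n"
    using svd(1,2) by (simp_all add: unitaries_dim)
  define E where "E x = U * rect_diag m n x * adj V" for x
  have E: "E x \<in> mats K m n" for x unfolding E_def using svd by (auto intro!: mats_intros)
  have dE: "dim_row (E x) = m" "dim_col (E x) = n" for x using E[of x] by (simp_all add: mats_dim)
  obtain L where L: "limitin TM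
      (quot_G X) L
      (at_right 0 \<times>\<^sub>F nhdsin TM (E h))"
    using G E unfolding hadamard_dir_differentiable_def by auto
  define p where "p = vec m (\<lambda>i. Re ((adj U * L * V) $$ (i, i)))"
  have "limitin TV (quot_g s) p
      (at_right 0 \<times>\<^sub>F nhdsin TV h)"
  proof (rule vec_space.limitin_prodI_sequences)
    show "h \<in> points (vec_eucl m)" using h by simp
    fix t :: "nat \<Rightarrow> real" and hs :: "nat \<Rightarrow> real vec"
    assume t: "\<And>k. t k > 0" "t \<longlonglongrightarrow> 0" and "\<And>k. hs k \<in> points (vec_eucl m)"
      and hs_lim: "limitin TV hs h sequentially"
    then have hs: "\<And>k. dim_vec (hs k) = m" by auto
    have hs_i: "(\<lambda>k. hs k $ i) \<longlonglongrightarrow> h $ i" if "i < m" for i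
      using hs_lim that by (simp add: vec_space.limitin_iff)
    define x where "x k = s + t k \<cdot>\<^sub>v hs k" for k
    have dx: "dim_vec (x k) = m" for k using hs by (simp add: x_def)
    have x_i: "(\<lambda>k. x k $ i) \<longlonglongrightarrow> s $ i" if "i < m" for i
    proof -
      have "(\<lambda>k. s $ i + t k * hs k $ i) \<longlonglongrightarrow> s $ i + 0 * h $ i"
        by (intro tendsto_intros t hs_i that)
      then show ?thesis using that s hs by (simp add: x_def)
    qed
    have E_lim: "entries_tendsto (\<lambda>k. E (y k)) (E z)" if "\<And>i. i < m \<Longrightarrow> (\<lambda>k. y k $ i) \<longlonglongrightarrow> z $ i" for y z
    proof -
      have "entries_tendsto (\<lambda>k. rect_diag m n (y k)) (rect_diag m n z)"
        using that by (auto simp: entries_tendsto_def intro!: tendsto_of_real)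
      then show ?thesis
        unfolding E_def by (intro entries_tendsto_mult entries_tendsto_const) (simp_all add: dims)
    qed
    have X_path: "X + of_real (t k) \<cdot>\<^sub>m E (hs k) = E (x k)" for k
    proof -
      have "rect_diag m n (x k) = rect_diag m n s + of_real (t k) \<cdot>\<^sub>m rect_diag m n (hs k)"
        using s hs by (intro eq_matI) (auto simp: x_def)
      then show ?thesis using svd(3) by (simp add: E_def dim_algebra dims)
    qed
    have "limitin TM (\<lambda>k. E (x k)) (E s) sequentially"
      using limitin_mat_iff[of "\<lambda>k. E (x k)" K m n "E s"] E E_lim[of x s] x_i by blast
    moreover have "E s = X" using svd(3) by (simp add: E_def)
    ultimately have ev: "\<forall>\<^sub>F k in sequentially. E (x k) \<in> N" using N by (auto simp: limitin_def)
    have GX: "spectral_op K g X = E (g s)"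
      unfolding E_def s_def by (rule spectral_op_svd[OF X svd(1,2)]) (use svd(3) sD in \<open>simp_all add: s_def\<close>)
    let ?F = "\<lambda>k. quot_G X (t k, E (hs k))"
    have "limitin TM (\<lambda>k. E (hs k)) (E h) sequentially"
      using limitin_mat_iff[of "\<lambda>k. E (hs k)" K m n "E h"] E E_lim[of hs h] hs_i by blast
    then have F_lim: "limitin TM ?F L sequentially"
      by (rule mat_space.limitin_prod_sequences[OF L t])
    have F_mats: "?F k \<in> mats K m n" for k
      unfolding prod.case diff_quot_mat using X E mn
      by (intro mats_smult mats_minus spectral_op_mats mats_add) auto
    have L_mats: "L \<in> mats K m n" and "entries_tendsto ?F L"
      using F_lim limitin_mat_iff[of ?F K m n L] F_mats by blast+
    then have UFV: "entries_tendsto (\<lambda>k. adj U * ?F k * V) (adj U * L * V)"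
      by (intro entries_tendsto_mult entries_tendsto_const) (simp_all add: dims mats_dim[OF L_mats])
    have F_eq: "\<forall>\<^sub>F k in sequentially. adj U * ?F k * V
        = of_real (1 / t k) \<cdot>\<^sub>m (rect_diag m n (g (x k)) - rect_diag m n (g s))"
      using ev
    proof eventually_elim
      case (elim k)
      then have "sing_vals (E (x k)) \<in> D" using N(2) by blast
      then have "spectral_op K g (E (x k)) = E (g (x k))"
        unfolding E_def by (intro spectral_op_diagonalized svd(1,2) dx)
      then have "?F k = of_real (1 / t k) \<cdot>\<^sub>m (E (g (x k)) - E (g s))"
        unfolding prod.case diff_quot_mat X_path GX by simp
      then show ?case
        unfolding E_def by (simp add: dim_algebra dims unitaries_simps[OF svd(1)] unitaries_simps[OF svd(2)])
    qed
    have "(\<lambda>k. diff_quot (vec_eucl m) (vec_eucl m) g s (t k) (hs k) $ i) \<longlonglongrightarrow> p $ i" if i: "i < m" for i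
    proof -
      have "(\<lambda>k. Re ((adj U * ?F k * V) $$ (i, i))) \<longlonglongrightarrow> Re ((adj U * L * V) $$ (i, i))"
        using i mn by (intro tendsto_Re entries_tendstoD[OF UFV]) (simp_all add: dims)
      moreover have "\<forall>\<^sub>F k in sequentially. Re ((adj U * ?F k * V) $$ (i, i))
          = diff_quot (vec_eucl m) (vec_eucl m) g s (t k) (hs k) $ i"
        using F_eq
      proof eventually_elim
        case (elim k)
        have "Re ((of_real (1 / t k) \<cdot>\<^sub>m (rect_diag m n (g (x k)) - rect_diag m n (g s))) $$ (i, i))
            = (1 / t k) * (g (x k) $ i - g s $ i)"
          using i mn by simp
        then show ?case
          unfolding elim using i dx s by (simp add: diff_quot_vec x_def[symmetric])
      qed
      ultimately show ?thesis
        using i by (simp add: p_def tendsto_cong)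
    qed
    moreover have "diff_quot (vec_eucl m) (vec_eucl m) g s (t k) (hs k) \<in> carrier_vec m" for k
      using dx s by (auto simp: diff_quot_vec x_def[symmetric] intro!: carrier_vecI)
    ultimately have "limitin TV
        (\<lambda>k. quot_g s (t k, hs k)) p sequentially"
      by (auto simp: vec_space.limitin_iff p_def)
    then show "\<exists>r. strict_mono r \<and> limitin TV
        (\<lambda>k. quot_g s (t (r k), hs (r k))) p sequentially"
      by (intro exI[of _ id]) (simp add: strict_mono_def)
  qed
  then show "\<exists>L. limitin TV (quot_g (sing_vals X)) L
      (at_right 0 \<times>\<^sub>F nhdsin TV h)"
    unfolding s_def by blast
qed

end

theorem theorem3p2:
  fixes K :: "complex set" and m n :: nat
    and N :: "complex mat set" and D :: "real vec set"
    and g :: "real vec \<Rightarrow> real vec"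
    and X U V :: "complex mat"
  assumes "K = \<real> \<or> K = UNIV"
    and "m \<le> n"
    and "openin (eucl_topology (mat_eucl K m n)) N" and "N \<noteq> {}"
    and "openin (eucl_topology (vec_eucl m)) D" and "sing_vals ` N \<subseteq> D"
    and "g \<in> carrier_vec m \<rightarrow> carrier_vec m"
    and "abs_symmetric_on m D g"
    and "X \<in> N" and "(U, V) \<in> svd_pairs K X"
  shows "(hadamard_dir_differentiable (mat_eucl K m n) (mat_eucl K m n) (spectral_op K g) X
            \<longleftrightarrow> hadamard_dir_differentiable (vec_eucl m) (vec_eucl m) g (sing_vals X))
       \<and> (hadamard_dir_differentiable (vec_eucl m) (vec_eucl m) g (sing_vals X)
            \<longrightarrow> (\<forall>H \<in> mats K m n.
                  has_dir_deriv (mat_eucl K m n) (mat_eucl K m n) (spectral_op K g) X H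
                    (U * div_dir_diff K m n g U V X H * mat_adjoint V)))"
proof -
  interpret spectral_setting K m n D g
    using assms by unfold_locales auto
  have X: "X \<in> mats K m n"
    using openin_subset[OF assms(3)] assms(9)
    unfolding mat_space.topology_eq mat_space.M.topspace_mtopology by auto
  have sD: "sing_vals X \<in> D" using assms(6,9) by blast
  have limit: "limitin (eucl_topology (mat_eucl K m n))
      (\<lambda>(t, h'). diff_quot (mat_eucl K m n) (mat_eucl K m n) (spectral_op K g) X t h')
      (U * div_dir_diff K m n g U V X H * adj V)
      (at_right 0 \<times>\<^sub>F nhdsin (eucl_topology (mat_eucl K m n)) H)"
    if "hadamard_dir_differentiable (vec_eucl m) (vec_eucl m) g (sing_vals X)" "H \<in> mats K m n" for H
    by (rule spectral_op_hadamard[OF X assms(10) sD that])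
  have "has_dir_deriv (mat_eucl K m n) (mat_eucl K m n) (spectral_op K g) X H
      (U * div_dir_diff K m n g U V X H * adj V)"
    if "hadamard_dir_differentiable (vec_eucl m) (vec_eucl m) g (sing_vals X)" "H \<in> mats K m n" for H
    using mat_space.limitin_fixed_direction[OF limit[OF that]] that(2) by (simp add: has_dir_deriv_def)
  moreover have "hadamard_dir_differentiable (mat_eucl K m n) (mat_eucl K m n) (spectral_op K g) X"
    if "hadamard_dir_differentiable (vec_eucl m) (vec_eucl m) g (sing_vals X)"
    unfolding hadamard_dir_differentiable_def using limit[OF that] by auto
  ultimately show ?thesis
    using hadamard_of_spectral_op[OF assms(3,6,9)] by blast
qed

end
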